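(* For all $k\ge1$, the problem $\mathsf{QCSP}[\mathsf{coverwidth}\le k]$ is decidable in polynomial time.
   Context: Relational structures have finite universes and relations $R^{\mathbf{A}}\subseteq A^r$ for each symbol $R$ of arity $r$ in a finite signature $\sigma$. A quantified relational structure is a pair $(p,\mathbf{A})$ where $p=Q_1v_1\ldots Q_nv_n$ is a quantifier prefix with each $Q_i\in\{\exists,\forall\}$ and $v_1,\ldots,v_n$ exactly the elements of $A$. There is a homomorphism from $(p,\mathbf{A})$ to $\mathbf{B}$ iff $\mathbf{B}$ satisfies the sentence $p\,\bigwedge\{R(a_1,\ldots,a_r): R\in\sigma,(a_1,\ldots,a_r)\in R^{\mathbf{A}}\}$. The QCSP is the problem of deciding, given $(p,\mathbf{A})$ and $\mathbf{B}$, whether there is a homomorphism from $(p,\mathbf{A})$ to $\mathbf{B}$. The prefix splits into maximal blocks of equal quantifiers; $v_j$ comes after $v_i$ in $p$ if they are in the same block or $v_j$'s block follows $v_i$'s block. $H(\mathbf{A})$ is the hypergraph on $A$ with a hyperedge $\{a_1,\ldots,a_r\}$ per tuple of any relation of $\mathbf{A}$. A $k$-union is a union of $k$ hyperedges (the empty set is the $0$-union); the weight of $X\subseteq A$ is the least $k\ge0$ with $X\cap\bigcup_e e$ contained in a $k$-union. A scheme of $(p,\mathbf{A})$ is a graph $(A,F)$ in which every hyperedge of $H(\mathbf{A})$ induces a clique and which has a perfect elimination ordering $v_1,\ldots,v_n$ (for all $i<j<l$, if $\{v_i,v_l\},\{v_j,v_l\}\in F$ then $\{v_i,v_j\}\in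 F$) such that $i<j$ implies $v_j$ comes after $v_i$ in $p$. The weight of a scheme is the maximum weight of its cliques; the coverwidth of $(p,\mathbf{A})$ is the minimum weight over its schemes. $\mathsf{QCSP}[\mathsf{coverwidth}\le k]$ is the QCSP restricted to instances $(p,\mathbf{A}),\mathbf{B}$ with $(p,\mathbf{A})$ of coverwidth $\le k$. *)

theory Defs
  imports Main "HOL-Computational_Algebra.Polynomial"
begin

section \<open>Relational structures and quantified conjunctive sentences\<close>

text \<open>A signature is a finite map from relation symbols to arities; tuples are lists.\<close>

type_synonym 's signature = "'s \<rightharpoonup> nat"

record ('s, 'a) rel_structure =
  universe :: "'a set"
  interp :: "'s \<Rightarrow> 'a list set"

definition is_structure :: "'s signature \<Rightarrow> ('s, 'a) rel_structure \<Rightarrow> bool" where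
  "is_structure \<sigma> A \<longleftrightarrow> finite (dom \<sigma>) \<and> finite (universe A) \<and>
     (\<forall>R r. \<sigma> R = Some r \<longrightarrow> interp A R \<subseteq> {t. length t = r \<and> set t \<subseteq> universe A})"

datatype quantifier = Exists | Forall

type_synonym 'a quant_prefix = "(quantifier \<times> 'a) list"

type_synonym ('s, 'a) quant_structure = "'a quant_prefix \<times> ('s, 'a) rel_structure"

fun is_quant_structure :: "'s signature \<Rightarrow> ('s, 'a) quant_structure \<Rightarrow> bool" where
  "is_quant_structure \<sigma> (p, A) \<longleftrightarrow>
     is_structure \<sigma> A \<and> distinct (map snd p) \<and> set (map snd p) = universe A"

fun sat :: "'b set \<Rightarrow> 'a quant_prefix \<Rightarrow> (('a \<Rightarrow> 'b) \<Rightarrow> bool) \<Rightarrow> ('a \<Rightarrow> 'b) \<Rightarrow> bool" where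
  "sat U [] \<phi> f = \<phi> f"
| "sat U ((Exists, v) # p) \<phi> f = (\<exists>b\<in>U. sat U p \<phi> (f(v := b)))"
| "sat U ((Forall, v) # p) \<phi> f = (\<forall>b\<in>U. sat U p \<phi> (f(v := b)))"

text \<open>The initial assignment is irrelevant, because the prefix binds every element of the
  universe of the left-hand structure.\<close>

fun quant_hom ::
  "'s signature \<Rightarrow> ('s, 'a) quant_structure \<Rightarrow> ('s, 'b) rel_structure \<Rightarrow> bool" where
  "quant_hom \<sigma> (p, A) B \<longleftrightarrow>
     sat (universe B) p (\<lambda>f. \<forall>R\<in>dom \<sigma>. \<forall>t\<in>interp A R. map f t \<in> interp B R) (\<lambda>_. undefined)"


section \<open>Coverwidth\<close>

text \<open>The number of the block containing position \<open>i\<close> is the number of quantifier changes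
  up to \<open>i\<close>.\<close>

definition block :: "'a quant_prefix \<Rightarrow> nat \<Rightarrow> nat" where
  "block p i = card {m. m < i \<and> fst (p ! m) \<noteq> fst (p ! Suc m)}"

definition comes_after :: "'a quant_prefix \<Rightarrow> 'a \<Rightarrow> 'a \<Rightarrow> bool" where
  "comes_after p v u \<longleftrightarrow>
     (\<exists>i j. i < length p \<and> j < length p \<and> snd (p ! i) = u \<and> snd (p ! j) = v \<and>
        block p i \<le> block p j)"

definition hyperedges :: "'s signature \<Rightarrow> ('s, 'a) rel_structure \<Rightarrow> 'a set set" where
  "hyperedges \<sigma> A = {set t | t R. R \<in> dom \<sigma> \<and> t \<in> interp A R}"

definition is_union :: "'a set set \<Rightarrow> nat \<Rightarrow> 'a set \<Rightarrow> bool" where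
  "is_union H k U \<longleftrightarrow> (\<exists>E. E \<subseteq> H \<and> finite E \<and> card E = k \<and> U = \<Union>E)"

definition weight :: "'a set set \<Rightarrow> 'a set \<Rightarrow> nat" where
  "weight H X = (LEAST k. \<exists>U. is_union H k U \<and> X \<inter> \<Union>H \<subseteq> U)"

text \<open>A graph is given by its vertex set and its set of edges, which are two-element sets.\<close>

definition is_graph :: "'a set \<Rightarrow> 'a set set \<Rightarrow> bool" where
  "is_graph V F \<longleftrightarrow> F \<subseteq> {e. e \<subseteq> V \<and> card e = 2}"

definition is_clique :: "'a set \<Rightarrow> 'a set set \<Rightarrow> 'a set \<Rightarrow> bool" where
  "is_clique V F X \<longleftrightarrow> X \<subseteq> V \<and> (\<forall>x\<in>X. \<forall>y\<in>X. x \<noteq> y \<longrightarrow> {x, y} \<in> F)"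

definition perfect_elimination_ordering :: "'a set \<Rightarrow> 'a set set \<Rightarrow> 'a list \<Rightarrow> bool" where
  "perfect_elimination_ordering V F vs \<longleftrightarrow> distinct vs \<and> set vs = V \<and>
     (\<forall>i j l. i < j \<and> j < l \<and> l < length vs \<and> {vs ! i, vs ! l} \<in> F \<and> {vs ! j, vs ! l} \<in> F
        \<longrightarrow> {vs ! i, vs ! j} \<in> F)"

fun is_scheme :: "'s signature \<Rightarrow> ('s, 'a) quant_structure \<Rightarrow> 'a set set \<Rightarrow> bool" where
  "is_scheme \<sigma> (p, A) F \<longleftrightarrow>
     is_graph (universe A) F \<and>
     (\<forall>e\<in>hyperedges \<sigma> A. is_clique (universe A) F e) \<and>
     (\<exists>vs. perfect_elimination_ordering (universe A) F vs \<and>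
        (\<forall>i j. i < j \<and> j < length vs \<longrightarrow> comes_after p (vs ! j) (vs ! i)))"

fun scheme_weight :: "'s signature \<Rightarrow> ('s, 'a) quant_structure \<Rightarrow> 'a set set \<Rightarrow> nat" where
  "scheme_weight \<sigma> (p, A) F = Max {weight (hyperedges \<sigma> A) X | X. is_clique (universe A) F X}"

text \<open>The minimum ranges over a nonempty set: the complete graph, with the vertices ordered as
  in the prefix, is a scheme.\<close>

definition coverwidth :: "'s signature \<Rightarrow> ('s, 'a) quant_structure \<Rightarrow> nat" where
  "coverwidth \<sigma> q = Min {scheme_weight \<sigma> q F | F. is_scheme \<sigma> q F}"


section \<open>Polynomial-time decidability\<close>

text \<open>Deterministic multitape Turing machines. Tapes are infinite in both directions. States and
  tape symbols are initial segments of the naturals; state \<open>0\<close> is initial and symbol \<open>0\<close> is the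
  blank. Symbols \<open>1\<close> to \<open>4\<close> are the input symbols.\<close>

datatype input_symbol = Zero | One | Open | Close

type_synonym input_word = "input_symbol list"

primrec symbol_code :: "input_symbol \<Rightarrow> nat" where
  "symbol_code Zero = 1"
| "symbol_code One = 2"
| "symbol_code Open = 3"
| "symbol_code Close = 4"

datatype move = MoveLeft | Stay | MoveRight

primrec shift :: "move \<Rightarrow> int" where
  "shift MoveLeft = -1"
| "shift Stay = 0"
| "shift MoveRight = 1"

record turing_machine =
  num_tapes :: nat
  num_symbols :: nat
  num_states :: nat
  accept_state :: nat
  reject_state :: nat
  transition :: "nat \<Rightarrow> nat list \<Rightarrow> nat \<times> (nat \<times> move) list"

definition is_turing_machine :: "turing_machine \<Rightarrow> bool" where
  "is_turing_machine M \<longleftrightarrow>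
     num_tapes M \<ge> 1 \<and> num_symbols M \<ge> 5 \<and> num_states M \<ge> 1 \<and>
     accept_state M < num_states M \<and> reject_state M < num_states M \<and>
     accept_state M \<noteq> reject_state M \<and>
     (\<forall>q ss. q < num_states M \<and> length ss = num_tapes M \<and> set ss \<subseteq> {..<num_symbols M} \<longrightarrow>
        (case transition M q ss of (q', acts) \<Rightarrow>
           q' < num_states M \<and> length acts = num_tapes M \<and>
           (\<forall>(s, d)\<in>set acts. s < num_symbols M)))"

text \<open>A tape is a head position together with the contents of the cells.\<close>

type_synonym tape = "int \<times> (int \<Rightarrow> nat)"

type_synonym configuration = "nat \<times> tape list"

fun act :: "nat \<times> move \<Rightarrow> tape \<Rightarrow> tape" where
  "act (s, d) (h, t) = (h + shift d, t(h := s))"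

fun step :: "turing_machine \<Rightarrow> configuration \<Rightarrow> configuration" where
  "step M (q, ts) =
     (if q = accept_state M \<or> q = reject_state M then (q, ts)
      else case transition M q (map (\<lambda>(h, t). t h) ts) of
        (q', acts) \<Rightarrow> (q', map2 act acts ts))"

definition input_tape :: "input_word \<Rightarrow> tape" where
  "input_tape w =
     (0, \<lambda>i. if 0 \<le> i \<and> i < int (length w) then symbol_code (w ! nat i) else 0)"

definition initial_config :: "turing_machine \<Rightarrow> input_word \<Rightarrow> configuration" where
  "initial_config M w = (0, input_tape w # replicate (num_tapes M - 1) (0, \<lambda>_. 0))"

text \<open>Halting configurations are fixed points of \<open>step\<close>, so the state after \<open>n\<close> steps shows
  whether the machine has accepted or rejected within \<open>n\<close> steps.\<close>

definition state_after :: "turing_machine \<Rightarrow> input_word \<Rightarrow> nat \<Rightarrow> nat" where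
  "state_after M w n = fst ((step M ^^ n) (initial_config M w))"

text \<open>A problem is a pair of the set of its instances and the set of positive ones. Inputs that
  do not encode an instance of the problem are not constrained. An instance may
  have several encodings, and the machine has to answer correctly on each of them.\<close>

type_synonym 'i problem = "'i set \<times> 'i set"

fun polytime_decidable :: "('i \<Rightarrow> input_word set) \<Rightarrow> 'i problem \<Rightarrow> bool" where
  "polytime_decidable enc (I, Y) \<longleftrightarrow>
     (\<exists>M (b :: nat poly). is_turing_machine M \<and>
        (\<forall>x\<in>I. \<forall>w\<in>enc x. state_after M w (poly b (length w)) =
           (if x \<in> Y then accept_state M else reject_state M)))"


section \<open>The problem QCSP and its encoding\<close>

text \<open>The signature is part of the instance. Symbols and elements are named by
  natural numbers, but a universe may be any finite set of them.\<close>

type_synonym qcsp_instance =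
  "nat signature \<times> (nat, nat) quant_structure \<times> (nat, nat) rel_structure"

definition QCSP :: "qcsp_instance problem" where
  "QCSP = ({(\<sigma>, q, B). is_quant_structure \<sigma> q \<and> is_structure \<sigma> B},
           {(\<sigma>, q, B). quant_hom \<sigma> q B})"

definition QCSP_coverwidth :: "nat \<Rightarrow> qcsp_instance problem" where
  "QCSP_coverwidth k = (fst QCSP \<inter> {(\<sigma>, q, B). coverwidth \<sigma> q \<le> k}, snd QCSP)"

text \<open>Numbers are written in binary, least significant digit first. Every number and every list
  is bracketed, so that all components of an encoding are self-delimiting.\<close>

fun bits :: "nat \<Rightarrow> input_word" where
  "bits n = (if n = 0 then [] else (if even n then Zero else One) # bits (n div 2))"

declare bits.simps [simp del]

definition enc_nat :: "nat \<Rightarrow> input_word" where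
  "enc_nat n = Open # bits n @ [Close]"

definition enc_list :: "('a \<Rightarrow> input_word) \<Rightarrow> 'a list \<Rightarrow> input_word" where
  "enc_list e xs = Open # concat (map e xs) @ [Close]"

definition enc_pair :: "('a \<Rightarrow> input_word) \<Rightarrow> ('b \<Rightarrow> input_word) \<Rightarrow> 'a \<times> 'b \<Rightarrow> input_word" where
  "enc_pair e1 e2 xy = e1 (fst xy) @ e2 (snd xy)"

primrec enc_quantifier :: "quantifier \<Rightarrow> input_word" where
  "enc_quantifier Exists = [Zero]"
| "enc_quantifier Forall = [One]"

definition signature_encodings :: "nat signature \<Rightarrow> input_word set" where
  "signature_encodings \<sigma> =
     {enc_list (enc_pair enc_nat enc_nat) ss | ss. distinct (map fst ss) \<and> map_of ss = \<sigma>}"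

text \<open>A structure is written as the list of its elements, followed by each relation
  symbol with the list of the tuples of its relation.\<close>

definition structure_encodings ::
  "nat signature \<Rightarrow> (nat, nat) rel_structure \<Rightarrow> input_word set" where
  "structure_encodings \<sigma> A =
     {enc_list enc_nat us @ enc_list (enc_pair enc_nat (enc_list (enc_list enc_nat))) rs | us rs.
        distinct us \<and> set us = universe A \<and>
        distinct (map fst rs) \<and> set (map fst rs) = dom \<sigma> \<and>
        (\<forall>(R, ts)\<in>set rs. distinct ts \<and> set ts = interp A R)}"

fun instance_encodings :: "qcsp_instance \<Rightarrow> input_word set" where
  "instance_encodings (\<sigma>, (p, A), B) =
     {s @ enc_list (enc_pair enc_quantifier enc_nat) p @ a @ b | s a b.
        s \<in> signature_encodings \<sigma> \<and> a \<in> structure_encodings \<sigma> A \<and> b \<in> structure_encodings \<sigma> B}"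

end

theory Submission imports Defs begin

text \<open>The instances of coverwidth at most \<open>k\<close> are decided by a pebble game whose positions are pairs
  of a sequence \<open>xs\<close> of \<open>k\<close> tuples of the left structure and a choice \<open>ys\<close> of tuples of the same
  relations of the right structure; such a pair stands for a partial map on the union of the
  \<open>k\<close> hyperedges. A position is bad if the tuples can be exchanged so that all compatible
  positions are bad, or if some value of a universal variable can be chosen so that all positions
  that agree on the variables before it are bad. A winning strategy for the
  sentence shows that every \<open>xs\<close> has a choice that is not bad. Conversely, along the perfect elimination ordering of a
  scheme of weight at most \<open>k\<close>, the earlier neighbours of a vertex and the vertex itself form a
  clique, hence lie in \<open>k\<close> hyperedges, and the positions that are not bad dictate a value of the vertex;
  since later vertices precede earlier ones in the prefix only when they share
  a block, the values can be assembled to a strategy.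

  There are polynomially many positions, and badness is a least fixed point of a first-order
  formula over the positions of the input word. A machine computes it in place
  by nested loops.\<close>

section \<open>Compiling structured programs to Turing machines\<close>

text \<open>The machine never looks for a scheme. Sequences of \<open>k\<close> tuples stand for all
  \<open>k\<close>-unions, and, apart from an empty right universe, a satisfied sentence leaves a
  candidate that is not bad in every instance whatsoever; small coverwidth only serves to assemble
  such candidates to a strategy.

  The delicate point is the order of the quantifiers. Variables of the same block count as earlier
  even if they stand later in the prefix, so a new value of a universal variable must preserve the
  later variables of its block. Strategies are therefore handled as sets of plays with an exchange
  property (\<open>responsive\<close>) and not as Skolem functions.

  For the running time: with \<open>k\<close> fixed, all relations have fixed arity over the
  positions of the word, so each is an array of polynomial length, and a least fixed point is
  reached after as many rounds as there are tuples. One element occurs at many positions, so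
  elements are compared through their numerals, by a relation that is itself a least fixed point. A
  finite automaton that labels each letter with its context takes the place of a parser.\<close>

type_synonym 't store = "'t \<Rightarrow> tape"

definition scan :: "'t store \<Rightarrow> 't \<Rightarrow> nat" where
  "scan s t = snd (s t) (fst (s t))"

text \<open>Tests and actions are arbitrary functions of the scanned symbols. They stand in for a
  language of expressions: with finitely many symbols, a transition table can absorb any of
  them.\<close>

datatype 't com =
    Act "('t \<Rightarrow> nat) \<Rightarrow> 't \<Rightarrow> nat \<times> move"
  | Seq "'t com" "'t com"
  | Cond "('t \<Rightarrow> nat) \<Rightarrow> bool" "'t com" "'t com"
  | Loop "('t \<Rightarrow> nat) \<Rightarrow> bool" "'t com"

text \<open>Each construct is charged the one step in which \<open>run1\<close> unfolds it, so that
  \<open>exec_run1\<close> gives an exact count.\<close>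

inductive exec :: "'t com \<Rightarrow> 't store \<Rightarrow> nat \<Rightarrow> 't store \<Rightarrow> bool" where
  exec_Act: "exec (Act a) s 1 (\<lambda>t. act (a (scan s) t) (s t))"
| exec_Seq: "exec c s m s' \<Longrightarrow> exec d s' n s'' \<Longrightarrow> exec (Seq c d) s (Suc (m + n)) s''"
| exec_Cond: "exec (if b (scan s) then c else d) s n s' \<Longrightarrow> exec (Cond b c d) s (Suc n) s'"
| exec_Loop_end: "\<not> b (scan s) \<Longrightarrow> exec (Loop b c) s 1 s"
| exec_Loop: "b (scan s) \<Longrightarrow> exec c s m s' \<Longrightarrow> exec (Loop b c) s' n s''
    \<Longrightarrow> exec (Loop b c) s (Suc (m + n)) s''"

text \<open>The control state of the machine for a command is the stack of the commands that remain to
  be executed; only finitely many stacks are reachable.\<close>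

fun cont :: "'t com list \<Rightarrow> ('t \<Rightarrow> nat) \<Rightarrow> 't com list" where
  "cont [] g = []"
| "cont (Act a # K) g = K"
| "cont (Seq c d # K) g = c # d # K"
| "cont (Cond b c d # K) g = (if b g then c else d) # K"
| "cont (Loop b c # K) g = (if b g then c # Loop b c # K else K)"

fun acts :: "'t com list \<Rightarrow> ('t \<Rightarrow> nat) \<Rightarrow> 't \<Rightarrow> nat \<times> move" where
  "acts (Act a # K) g = a g"
| "acts _ g = (\<lambda>t. (g t, Stay))"

fun run1 :: "'t com list \<times> 't store \<Rightarrow> 't com list \<times> 't store" where
  "run1 (K, s) = (cont K (scan s), \<lambda>t. act (acts K (scan s) t) (s t))"

lemma act_idle [simp]: "act (scan s t, Stay) (s t) = s t"
  by (cases "s t") (simp add: scan_def)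

lemma exec_run1: "exec c s n s' \<Longrightarrow> (run1 ^^ n) (c # K, s) = (K, s')"
proof (induction arbitrary: K rule: exec.induct)
  case (exec_Seq c s m s' d n s'')
  have "(run1 ^^ Suc (m + n)) (Seq c d # K, s) = (run1 ^^ (n + m)) (c # d # K, s)"
    by (simp only: funpow_Suc_right o_apply) (simp add: add.commute)
  also have "\<dots> = (run1 ^^ n) ((run1 ^^ m) (c # d # K, s))"
    by (simp add: funpow_add)
  finally show ?case by (simp add: exec_Seq)
next
  case (exec_Cond b s c d n s')
  have "(run1 ^^ Suc n) (Cond b c d # K, s) = (run1 ^^ n) ((if b (scan s) then c else d) # K, s)"
    by (simp only: funpow_Suc_right o_apply) simp
  then show ?case by (simp only: exec_Cond)
next
  case (exec_Loop b s c m s' n s'')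
  have "(run1 ^^ Suc (m + n)) (Loop b c # K, s) = (run1 ^^ (n + m)) (c # Loop b c # K, s)"
    by (simp only: funpow_Suc_right o_apply) (simp add: exec_Loop add.commute)
  also have "\<dots> = (run1 ^^ n) ((run1 ^^ m) (c # Loop b c # K, s))"
    by (simp add: funpow_add)
  finally show ?case by (simp add: exec_Loop)
qed simp_all

text \<open>All stacks that can occur before \<open>K\<close> is exposed. Below the body of a loop
  lies the loop itself, so the recursion descends in the command alone and the set is finite
  although the program may loop.\<close>

primrec conts :: "'t com \<Rightarrow> 't com list \<Rightarrow> 't com list set" where
  "conts (Act a) K = {Act a # K}"
| "conts (Seq c d) K = insert (Seq c d # K) (conts c (d # K) \<union> conts d K)"
| "conts (Cond b c d) K = insert (Cond b c d # K) (conts c K \<union> conts d K)"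
| "conts (Loop b c) K = insert (Loop b c # K) (conts c (Loop b c # K))"

lemma finite_conts: "finite (conts c K)"
  by (induction c arbitrary: K) auto

lemma conts_start: "c # K \<in> conts c K"
  by (cases c) auto

lemma conts_closed: "L \<in> conts c K \<Longrightarrow> cont L g \<in> insert K (conts c K)"
proof (induction c arbitrary: K)
  case (Seq c d)
  from Seq.prems consider "L = Seq c d # K" | "L \<in> conts c (d # K)" | "L \<in> conts d K" by auto
  then show ?case
    using conts_start[of c "d # K"] conts_start[of d K] Seq.IH(1)[of "d # K"] Seq.IH(2)[of K]
    by cases auto
next
  case (Cond b c d)
  then show ?case using conts_start[of c K] conts_start[of d K] by auto
next
  case (Loop b c)
  then show ?case using conts_start[of c "Loop b c # K"] by (auto split: if_splits)
qed auto

text \<open>The type of tape names may be infinite, whereas the machine has one tape for each member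
  of \<open>T\<close>. Elsewhere an action has to be idle, and everywhere it has to write symbols
  below \<open>G\<close>.\<close>

definition ok_act :: "nat \<Rightarrow> 't set \<Rightarrow> (('t \<Rightarrow> nat) \<Rightarrow> 't \<Rightarrow> nat \<times> move) \<Rightarrow> bool" where
  "ok_act G T a \<longleftrightarrow> (\<forall>g t. (\<forall>u. g u < G) \<longrightarrow> fst (a g t) < G \<and> (t \<notin> T \<longrightarrow> a g t = (g t, Stay)))"

primrec ok_com :: "nat \<Rightarrow> 't set \<Rightarrow> 't com \<Rightarrow> bool" where
  "ok_com G T (Act a) = ok_act G T a"
| "ok_com G T (Seq c d) = (ok_com G T c \<and> ok_com G T d)"
| "ok_com G T (Cond b c d) = (ok_com G T c \<and> ok_com G T d)"
| "ok_com G T (Loop b c) = ok_com G T c"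

lemma ok_acts: "ok_com G T c \<Longrightarrow> L \<in> conts c K \<Longrightarrow> ok_act G T (acts L)"
  by (induction c arbitrary: K) (auto simp: ok_act_def)

section \<open>The Turing machine of a program\<close>

definition look :: "'t list \<Rightarrow> nat list \<Rightarrow> 't \<Rightarrow> nat" where
  "look ts ss t = (case map_of (zip ts ss) t of None \<Rightarrow> 0 | Some x \<Rightarrow> x)"

lemma look_map:
  assumes "\<And>t. t \<notin> set ts \<Longrightarrow> g t = 0"
  shows "look ts (map g ts) = g"
proof
  fix t
  show "look ts (map g ts) t = g t"
    using assms by (auto simp: look_def map_of_zip_map split: option.splits)
qed

lemma look_less:
  assumes "set ss \<subseteq> {..<G}" "G > 0"
  shows "look ts ss t < G"
  using assms by (auto simp: look_def split: option.splits dest!: map_of_SomeD set_zip_rightD)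

definition state_index :: "'a list \<Rightarrow> 'a \<Rightarrow> nat" where
  "state_index ks x = (LEAST i. i < length ks \<and> ks ! i = x)"

lemma state_index: "x \<in> set ks \<Longrightarrow> state_index ks x < length ks \<and> ks ! state_index ks x = x"
  unfolding state_index_def by (rule LeastI_ex) (auto simp: in_set_conv_nth)

text \<open>The empty stack means that the program has ended; the symbol on tape \<open>r\<close>
  then selects one of the two halting states, which are numbered after the states for
  stacks.\<close>

definition machine :: "nat \<Rightarrow> 't list \<Rightarrow> 't com list list \<Rightarrow> 't \<Rightarrow> turing_machine" where
  "machine G ts ks r = \<lparr>num_tapes = length ts, num_symbols = G, num_states = length ks + 2,
     accept_state = length ks, reject_state = Suc (length ks),
     transition = (\<lambda>q ss.
       if q < length ks \<and> ks ! q \<noteq> []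
       then (state_index ks (cont (ks ! q) (look ts ss)), map (acts (ks ! q) (look ts ss)) ts)
       else (if look ts ss r = 1 then length ks else Suc (length ks),
             map (\<lambda>t. (look ts ss t, Stay)) ts))\<rparr>"

definition start_store :: "'t \<Rightarrow> input_word \<Rightarrow> 't store" where
  "start_store t0 w = (\<lambda>t. if t = t0 then input_tape w else (0, \<lambda>_. 0))"

theorem com_polytime_decidable:
  fixes c :: "'t com" and b :: "nat poly"
  assumes ok: "ok_com G (set ts) c" and G: "G \<ge> 5" and dist: "distinct ts"
    and ts: "ts = t0 # ts'" and r: "r \<in> set ts"
    and runs: "\<And>x w. x \<in> I \<Longrightarrow> w \<in> enc x \<Longrightarrow> \<exists>n s'. exec c (start_store t0 w) n s' \<and>
      n \<le> poly b (length w) \<and> (scan s' r = 1 \<longleftrightarrow> x \<in> Y)"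
  shows "polytime_decidable enc (I, Y)"
proof -
  have "finite (conts c [])" by (rule finite_conts)
  then obtain ks0 where ks0: "set ks0 = insert [] (conts c [])"
    using finite_list[of "insert [] (conts c [])"] by auto
  \<comment> \<open>State 0 is the initial one, so the starting stack comes first. Its second
    occurrence in \<open>ks0\<close> is harmless, as \<open>state_index\<close> takes the least
    index.\<close>
  define ks where "ks = [c] # ks0"
  have set_ks: "set ks = insert [] (conts c [])"
    using ks0 conts_start[of c "[]"] by (auto simp: ks_def)
  define M where "M = machine G ts ks r"
  have M_simps: "num_tapes M = length ts" "num_symbols M = G" "num_states M = length ks + 2"
      "accept_state M = length ks" "reject_state M = Suc (length ks)"
    by (simp_all add: M_def machine_def)
  have ok_ks: "ok_act G (set ts) (acts L)" if "L \<in> set ks" for L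
    using that ok_acts[OF ok, of L "[]"] by (auto simp: set_ks ok_act_def)
  have closed: "cont L g \<in> set ks" if "L \<in> set ks" for L g
    using that conts_closed[of L c "[]" g] by (auto simp: set_ks)
  have tm: "is_turing_machine M"
    unfolding is_turing_machine_def M_simps
  proof (intro conjI allI impI)
    fix q ss
    assume as: "q < length ks + 2 \<and> length ss = length ts \<and> set ss \<subseteq> {..<G}"
    have less: "look ts ss t < G" for t using look_less[of ss G ts t] as G by auto
    have "fst (acts (ks ! q) (look ts ss) t) < G" if "q < length ks" for t
      using ok_ks[of "ks ! q"] that less by (auto simp: ok_act_def)
    moreover have "state_index ks (cont (ks ! q) (look ts ss)) < length ks" if "q < length ks"
      using state_index[OF closed[of "ks ! q"]] that by auto
    ultimately show "case transition M q ss of (q', as) \<Rightarrow> q' < length ks + 2 \<and>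
        length as = length ts \<and> (\<forall>(s, d)\<in>set as. s < G)"
      using less by (auto simp: M_def machine_def) (metis fst_conv)
  qed (use G ts in auto)
  define conf where "conf = (\<lambda>(q, s). (q :: nat, map (s :: 't store) ts))"
  \<comment> \<open>The machine does not possess the tapes outside \<open>ts\<close>; on a clean
    store they show the blank that \<open>look\<close> supplies for them.\<close>
  define clean where "clean s \<longleftrightarrow> (\<forall>t. t \<notin> set ts \<longrightarrow> s t = (0, \<lambda>_. 0))" for s :: "'t store"
  have syms: "look ts (map (\<lambda>(h, t). t h) (map s ts)) = scan s" if "clean s" for s
  proof -
    have "map (\<lambda>(h, t). t h) (map s ts) = map (scan s) ts"
      by (simp add: scan_def case_prod_beta)
    moreover have "look ts (map (scan s) ts) = scan s"
      using that by (intro look_map) (simp add: clean_def scan_def)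
    ultimately show ?thesis by (simp only:)
  qed
  have map2: "map2 act (map f ts) (map s ts) = map (\<lambda>t. act (f t) (s t)) ts" for f and s :: "'t store"
    by (simp add: zip_map_map zip_same_conv_map)
  have one: "Defs.step M (conf (state_index ks K, s)) = conf (state_index ks (fst (run1 (K, s))), snd (run1 (K, s)))"
      and one': "clean (snd (run1 (K, s)))" if K: "K \<in> set ks" and s: "clean s" and G0: "\<forall>t. scan s t < G" and "K \<noteq> []" for K s
  proof -
    show "Defs.step M (conf (state_index ks K, s)) = conf (state_index ks (fst (run1 (K, s))), snd (run1 (K, s)))"
      using state_index[OF K] that(4) syms[OF s]
      by (auto simp: conf_def M_def machine_def map2)
    show "clean (snd (run1 (K, s)))"
      using s ok_ks[OF K] G0 by (auto simp: clean_def ok_act_def scan_def)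
  qed
  define bnd where "bnd s \<longleftrightarrow> (\<forall>t z. snd (s t) z < G)" for s :: "'t store"
  have bnd_scan: "\<forall>t. scan s t < G" if "bnd s" for s using that by (auto simp: bnd_def scan_def)
  have bnd1: "bnd (snd (run1 (K, s)))" if "K \<in> set ks" "bnd s" for K s
  proof -
    have "snd (act (acts K (scan s) t) (s t)) z < G" for t z
    proof -
      have "fst (acts K (scan s) t) < G"
        using ok_ks[OF that(1)] bnd_scan[OF that(2)] by (auto simp: ok_act_def)
      moreover have "snd (s t) z < G" using that(2) by (auto simp: bnd_def)
      ultimately show ?thesis by (cases "acts K (scan s) t"; cases "s t") auto
    qed
    then show ?thesis by (simp add: bnd_def)
  qed
  define inv where "inv = (\<lambda>(K, s). K \<in> set ks \<and> clean s \<and> bnd s)"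
  \<comment> \<open>Only \<open>m \<le> n\<close>, because \<open>run1\<close> idles on the empty
    stack while the machine leaves the corresponding state.\<close>
  have sim: "inv (K, s) \<Longrightarrow> (run1 ^^ n) (K, s) = ([], s') \<Longrightarrow>
      inv ([], s') \<and> (\<exists>m\<le>n. (Defs.step M ^^ m) (conf (state_index ks K, s)) = conf (state_index ks [], s'))"
    for n K s s'
  proof (induction n arbitrary: K s)
    case 0
    then show ?case by (auto intro!: exI[of _ "0::nat"])
  next
    case (Suc n)
    show ?case
    proof (cases "K = []")
      case True
      have "(run1 ^^ j) ([], s) = ([], s)" for j
        by (induction j) auto
      then have "s' = s" using Suc.prems(2) True by (metis prod.inject)
      then show ?thesis using Suc.prems True by (auto intro!: exI[of _ "0::nat"])
    next
      case False
      obtain K1 s1 where r1: "run1 (K, s) = (K1, s1)" by fastforce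
      from Suc.prems have K: "K \<in> set ks" "clean s" "bnd s" by (auto simp: inv_def)
      have inv1: "inv (K1, s1)"
        using one'[OF K(1,2) bnd_scan[OF K(3)] False] bnd1[OF K(1,3)] closed[OF K(1), of "scan s"] r1
        by (auto simp: inv_def)
      have "(run1 ^^ n) (K1, s1) = ([], s')"
        using Suc.prems(2) r1 by (simp only: funpow_Suc_right o_apply)
      from Suc.IH[OF inv1 this] obtain m where m: "inv ([], s')" "m \<le> n"
        "(Defs.step M ^^ m) (conf (state_index ks K1, s1)) = conf (state_index ks [], s')" by auto
      have "(Defs.step M ^^ Suc m) (conf (state_index ks K, s)) = conf (state_index ks [], s')"
        using one[OF K(1,2) bnd_scan[OF K(3)] False] r1 m(3)
        by (simp only: funpow_Suc_right o_apply fst_conv snd_conv)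
      then show ?thesis using m by (intro conjI exI[of _ "Suc m"]) auto
    qed
  qed
  have init: "initial_config M w = conf (state_index ks [c], start_store t0 w)" for w
  proof -
    have "state_index ks [c] = 0"
      using Least_le[of "\<lambda>i. i < length ks \<and> ks ! i = [c]" 0] by (simp add: state_index_def ks_def)
    moreover have "map (start_store t0 w) ts' = replicate (length ts') (0, \<lambda>_. 0)"
      using dist ts by (auto simp: start_store_def map_replicate_const[symmetric] cong: map_cong)
    ultimately show ?thesis
      using ts by (simp add: initial_config_def conf_def M_simps start_store_def)
  qed
  have init_inv: "inv ([c], start_store t0 w)" for w
  proof -
    have "symbol_code a < G" for a using G by (cases a) auto
    then show ?thesis using G ts
      by (auto simp: inv_def clean_def bnd_def start_store_def input_tape_def ks_def)
  qed
  have halt: "(Defs.step M ^^ j) (q, us) = (q, us)" if "q = length ks \<or> q = Suc (length ks)" for j q us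
    using that by (induction j) (auto simp: M_simps)
  show ?thesis
    unfolding polytime_decidable.simps
  \<comment> \<open>The additional step leads from the state of the empty stack to a halting
    state.\<close>
  proof (intro exI[of _ M] exI[of _ "b + 1"] conjI ballI tm)
    fix x w
    assume "x \<in> I" "w \<in> enc x"
    from runs[OF this] obtain n s' where n: "exec c (start_store t0 w) n s'"
      "n \<le> poly b (length w)" "scan s' r = 1 \<longleftrightarrow> x \<in> Y" by auto
    from sim[OF init_inv exec_run1[OF n(1)]] obtain m where m: "inv ([], s')" "m \<le> n"
      "(Defs.step M ^^ m) (initial_config M w) = conf (state_index ks [], s')"
      by (auto simp: init)
    have "[] \<in> set ks" by (simp add: set_ks)
    then have last: "Defs.step M (conf (state_index ks [], s')) =
       (if x \<in> Y then length ks else Suc (length ks), map (\<lambda>t. act (scan s' t, Stay) (s' t)) ts)"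
      using state_index[of "[]" ks] syms[of s'] m(1) n(3)
      by (auto simp: conf_def M_def machine_def map2 inv_def simp del: act_idle)
    have "poly (b + 1) (length w) = (poly b (length w) - m) + Suc m"
      using m(2) n(2) by simp
    then have "(Defs.step M ^^ poly (b + 1) (length w)) (initial_config M w) =
        (Defs.step M ^^ (poly b (length w) - m)) (Defs.step M ((Defs.step M ^^ m) (initial_config M w)))"
      by (simp only: funpow_add funpow.simps o_apply)
    also have "fst \<dots> = (if x \<in> Y then length ks else Suc (length ks))"
      unfolding m(3) last by (subst halt) auto
    finally show "state_after M w (poly (b + 1) (length w)) =
        (if x \<in> Y then accept_state M else reject_state M)"
      by (simp add: state_after_def M_simps)
  qed
qed

section \<open>Programs over the positions of the input word\<close>

text \<open>A context consists of the bracket depth and the number of the top-level bracket that is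
  reached. Both are cut off at 7, so that a finite automaton can keep track of them.\<close>

fun advance :: "nat \<times> nat \<Rightarrow> input_symbol \<Rightarrow> nat \<times> nat" where
  "advance (d, s) Open = (min 7 (Suc d), s)"
| "advance (d, s) Close = (d - 1, if d = 1 then min 7 (Suc s) else s)"
| "advance (d, s) Zero = (d, s)"
| "advance (d, s) One = (d, s)"

definition ctx :: "input_word \<Rightarrow> nat \<Rightarrow> nat \<times> nat" where
  "ctx w i = foldl advance (0, 0) (take i w)"

text \<open>A numeral in mixed radix: the letter is below 5, depth and section number are below 8,
  which makes 320 symbols. The letter part of a label is nonzero, so labels differ from the
  blank.\<close>

definition label :: "input_symbol \<Rightarrow> nat \<times> nat \<Rightarrow> nat" where
  "label a c = symbol_code a + 5 * (fst c + 8 * snd c)"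

definition lab :: "input_word \<Rightarrow> nat \<Rightarrow> nat" where
  "lab w i = (if i < length w then label (w ! i) (ctx w i) else 0)"

lemma ctx_less: "fst (ctx w i) < 8 \<and> snd (ctx w i) < 8"
proof -
  have "fst c < 8 \<and> snd c < 8 \<Longrightarrow> fst (foldl advance c u) < 8 \<and> snd (foldl advance c u) < 8" for c u
  proof (induction u arbitrary: c)
    case (Cons a u)
    show ?case unfolding foldl_Cons
      by (rule Cons.IH) (use Cons.prems in \<open>cases c; cases a; auto\<close>)
  qed simp
  then show ?thesis by (simp add: ctx_def)
qed

lemma label_less: "fst c < 8 \<Longrightarrow> snd c < 8 \<Longrightarrow> label a c < 320"
  by (cases a) (auto simp: label_def)

lemma lab_less: "lab w i < 320"
  using label_less ctx_less[of w i] by (auto simp: lab_def)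

lemma lab_nonzero: "i < length w \<Longrightarrow> lab w i \<noteq> 0"
  by (cases "w ! i") (auto simp: lab_def label_def)

section \<open>Formulas and loop programs over the positions of a word\<close>

datatype fm =
    Letter nat "nat \<Rightarrow> bool"
  | Rel nat "nat list"
  | Neg fm
  | Conj fm fm
  | Ex fm

text \<open>A tuple is read as a numeral in base \<open>Suc N\<close>: variables take the values
  \<open>0\<close> to \<open>N\<close>, the last being the end of the word.\<close>

primrec addr :: "nat \<Rightarrow> nat list \<Rightarrow> nat" where
  "addr N [] = 0"
| "addr N (x # xs) = x * Suc N ^ length xs + addr N xs"

lemma addr_less: "(\<And>x. x \<in> set xs \<Longrightarrow> x \<le> N) \<Longrightarrow> addr N xs < Suc N ^ length xs"
proof (induction xs)
  case (Cons x xs)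
  have "addr N (x # xs) < x * Suc N ^ length xs + Suc N ^ length xs"
    using Cons by simp
  also have "\<dots> \<le> Suc N * Suc N ^ length xs"
    using Cons.prems[of x] by (simp flip: mult_Suc del: mult_Suc add: add.commute)
  finally show ?case by simp
qed simp

lemma addr_inj:
  assumes "length xs = length ys" "\<And>x. x \<in> set xs \<Longrightarrow> x \<le> N" "\<And>y. y \<in> set ys \<Longrightarrow> y \<le> N"
    "addr N xs = addr N ys"
  shows "xs = ys"
  using assms
proof (induction xs ys rule: list_induct2)
  case (Cons x xs y ys)
  let ?M = "Suc N ^ length xs"
  have l: "addr N xs < ?M" "addr N ys < ?M"
    using addr_less[of xs N] addr_less[of ys N] Cons by auto
  have e: "x * ?M + addr N xs = y * ?M + addr N ys"
    using Cons by simp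
  have "(x * ?M + addr N xs) div ?M = x" "(y * ?M + addr N ys) div ?M = y"
    using l by auto
  with e have "x = y" by simp
  with e Cons show ?case by auto
qed simp

text \<open>Variables are de Bruijn levels: below \<open>d\<close> binders, \<open>Ex\<close> binds the variable \<open>d\<close>. The
  content of an array at the address of a tuple is the truth value of a relation.\<close>

fun ev :: "input_word \<Rightarrow> (nat \<Rightarrow> nat \<Rightarrow> bool) \<Rightarrow> nat \<Rightarrow> (nat \<Rightarrow> nat) \<Rightarrow> fm \<Rightarrow> bool" where
  "ev w ar d xs (Letter i p) = p (lab w (xs i))"
| "ev w ar d xs (Rel a js) = ar a (addr (length w) (map xs js))"
| "ev w ar d xs (Neg \<phi>) = (\<not> ev w ar d xs \<phi>)"
| "ev w ar d xs (Conj \<phi> \<psi>) = (ev w ar d xs \<phi> \<and> ev w ar d xs \<psi>)"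
| "ev w ar d xs (Ex \<phi>) = (\<exists>y\<le>length w. ev w ar (Suc d) (xs(d := y)) \<phi>)"

text \<open>The offset in \<open>Mark\<close> exists for the sake of the successor relation, which
  is obtained from the layout of the array: the cell to the right of that of \<open>[y, y]\<close>
  is that of \<open>[y, Suc y]\<close>. \<open>Rep\<close> binds no variable and serves to iterate
  fixed points.\<close>

datatype prog =
    Mark nat "nat list" nat
  | When fm prog
  | For prog
  | Then prog prog
  | Rep prog

fun sem :: "input_word \<Rightarrow> nat \<Rightarrow> (nat \<Rightarrow> nat) \<Rightarrow> prog \<Rightarrow> (nat \<Rightarrow> nat \<Rightarrow> bool) \<Rightarrow> (nat \<Rightarrow> nat \<Rightarrow> bool)" where
  "sem w d xs (Mark a js k) ar = ar(a := (ar a)(addr (length w) (map xs js) + k := True))"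
| "sem w d xs (When \<phi> p) ar = (if ev w ar d xs \<phi> then sem w d xs p ar else ar)"
| "sem w d xs (For p) ar = fold (\<lambda>y. sem w (Suc d) (xs(d := y)) p) [0..<Suc (length w)] ar"
| "sem w d xs (Then p q) ar = sem w d xs q (sem w d xs p ar)"
| "sem w d xs (Rep p) ar = (sem w d xs p ^^ Suc (length w)) ar"

section \<open>Tapes and the stores between commands\<close>

datatype tp = Inp | Aut | Ptr nat nat | Flag nat | Arr nat

definition tapes :: "nat \<Rightarrow> tp set" where
  "tapes K = {Inp, Aut} \<union> {Ptr k i | k i. k < 4 \<and> i < K} \<union> Flag ` {..<K} \<union> Arr ` {..<K}"

lemma in_tapes [simp]:
  "Inp \<in> tapes K" "Aut \<in> tapes K" "Ptr k i \<in> tapes K \<longleftrightarrow> k < 4 \<and> i < K"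
  "Flag i \<in> tapes K \<longleftrightarrow> i < K" "Arr i \<in> tapes K \<longleftrightarrow> i < K"
  by (auto simp: tapes_def)

text \<open>A copy of the labelled word is blank exactly outside \<open>0..<length w\<close>, so a
  head notices both ends. The position \<open>length w\<close> is a legal value of a variable
  although its cell is blank; this shapes all loops below.\<close>

definition content :: "input_word \<Rightarrow> int \<Rightarrow> nat" where
  "content w z = (if 0 \<le> z then lab w (nat z) else 0)"

lemma content_int [simp]: "content w (int x) = lab w x"
  by (simp add: content_def)

lemma lab_eq_0_iff: "lab w i = 0 \<longleftrightarrow> i \<ge> length w"
proof (cases "i < length w")
  case True
  then show ?thesis using lab_nonzero[of i w] by simp
qed (simp add: lab_def)

lemma content_eq_0_iff: "content w z = 0 \<longleftrightarrow> z < 0 \<or> z \<ge> int (length w)"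
  by (cases "0 \<le> z") (simp_all add: content_def lab_eq_0_iff le_nat_iff del: content_int)

definition ctx_code :: "input_word \<Rightarrow> nat \<Rightarrow> nat" where
  "ctx_code w i = fst (ctx w i) + 8 * snd (ctx w i)"

text \<open>Every pointer tape carries its own copy of the labelled input. The pointers of group 0 hold
  the variables, those of groups 1 and 2 count strides and repetitions, and the one of group 3 is
  the scratch counter of \<open>repeat_val\<close> (below). The symbol 2 marks the left end of an array.\<close>

definition st :: "nat \<Rightarrow> input_word \<Rightarrow> (tp \<Rightarrow> int) \<Rightarrow> (nat \<Rightarrow> bool) \<Rightarrow> (nat \<Rightarrow> nat \<Rightarrow> bool) \<Rightarrow> tp store" where
  "st K w pos fl ar = (\<lambda>t. if t \<notin> tapes K then (0, \<lambda>_. 0) else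
     (case t of
        Inp \<Rightarrow> (int (length w), snd (input_tape w))
      | Aut \<Rightarrow> (0, (\<lambda>_. 0)(0 := ctx_code w (length w)))
      | Ptr k i \<Rightarrow> (pos t, content w)
      | Flag i \<Rightarrow> (0, (\<lambda>_. 0)(0 := of_bool (fl i)))
      | Arr a \<Rightarrow> (pos t, \<lambda>z. if z = -1 then 2 else of_bool (z \<ge> 0 \<and> ar a (nat z)))))"

lemma scan_st:
  "Ptr k i \<in> tapes K \<Longrightarrow> scan (st K w pos fl ar) (Ptr k i) = content w (pos (Ptr k i))"
  "Flag i \<in> tapes K \<Longrightarrow> scan (st K w pos fl ar) (Flag i) = of_bool (fl i)"
  "Arr a \<in> tapes K \<Longrightarrow> scan (st K w pos fl ar) (Arr a) =
     (if pos (Arr a) = -1 then 2 else of_bool (pos (Arr a) \<ge> 0 \<and> ar a (nat (pos (Arr a)))))"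
  by (auto simp: scan_def st_def)

section \<open>Execution within a time bound\<close>

definition exec_le :: "'t com \<Rightarrow> 't store \<Rightarrow> nat \<Rightarrow> 't store \<Rightarrow> bool" where
  "exec_le c s T s' \<longleftrightarrow> (\<exists>n\<le>T. exec c s n s')"

lemma le_Act: "s' = (\<lambda>t. act (a (scan s) t) (s t)) \<Longrightarrow> 1 \<le> T \<Longrightarrow> exec_le (Act a) s T s'"
  unfolding exec_le_def using exec_Act by blast

lemma le_Seq: "exec_le c s m s' \<Longrightarrow> exec_le d s' n s'' \<Longrightarrow> Suc (m + n) \<le> T \<Longrightarrow> exec_le (Seq c d) s T s''"
  unfolding exec_le_def by (meson add_mono_thms_linordered_semiring(1) exec_Seq le_trans not_less_eq_eq)

lemma le_Cond: "exec_le (if b (scan s) then c else d) s m s' \<Longrightarrow> Suc m \<le> T \<Longrightarrow> exec_le (Cond b c d) s T s'"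
  unfolding exec_le_def by (meson exec_Cond le_trans not_less_eq_eq)

lemma le_mono: "exec_le c s m s' \<Longrightarrow> m \<le> T \<Longrightarrow> exec_le c s T s'"
  unfolding exec_le_def by (meson le_trans)

text \<open>The loop is described by the sequence \<open>S\<close> of the stores at its head; each
  round costs the body and one step for the test.\<close>

lemma le_Loop:
  assumes "\<And>m. m < n \<Longrightarrow> b (scan (S m)) \<and> exec_le c (S m) T (S (Suc m))" "\<not> b (scan (S n))"
  shows "exec_le (Loop b c) (S 0) (n * Suc T + 1) (S n)"
  using assms
proof (induction n arbitrary: S)
  case 0
  then show ?case unfolding exec_le_def using exec_Loop_end[of b "S 0" c] by fastforce
next
  case (Suc n)
  have "exec_le (Loop b c) (S (Suc 0)) (n * Suc T + 1) (S (Suc n))"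
    using Suc.IH[of "\<lambda>m. S (Suc m)"] Suc.prems by auto
  moreover have "b (scan (S 0))" "exec_le c (S 0) T (S (Suc 0))" using Suc.prems(1)[of 0] by auto
  ultimately obtain l m where "l \<le> T" "exec c (S 0) l (S (Suc 0))" "m \<le> n * Suc T + 1"
    "exec (Loop b c) (S (Suc 0)) m (S (Suc n))" by (auto simp: exec_le_def)
  then have "exec (Loop b c) (S 0) (Suc (l + m)) (S (Suc n))" "Suc (l + m) \<le> Suc n * Suc T + 1"
    using exec_Loop[of b "S 0", OF \<open>b (scan (S 0))\<close>] by (auto simp: algebra_simps)
  then show ?case unfolding exec_le_def by blast
qed

section \<open>The compiler from formulas and loop programs to commands\<close>

definition skip :: "tp com" where
  "skip = Act (\<lambda>g u. (g u, Stay))"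

definition mv :: "tp \<Rightarrow> move \<Rightarrow> tp com" where
  "mv t m = Act (\<lambda>g u. (g u, if u = t then m else Stay))"

definition set_flag :: "nat \<Rightarrow> ((tp \<Rightarrow> nat) \<Rightarrow> bool) \<Rightarrow> tp com" where
  "set_flag f b = Act (\<lambda>g u. (if u = Flag f then of_bool (b g) else g u, Stay))"

definition mark :: "nat \<Rightarrow> tp com" where
  "mark a = Act (\<lambda>g u. (if u = Arr a then 1 else g u, Stay))"

text \<open>The head may stand on the blank at \<open>length w\<close>, where the loop would stop at
  once; hence the first move to the left. The loop ends at -1, hence the last move to the
  right.\<close>

definition reset :: "tp \<Rightarrow> tp com" where
  "reset t = Seq (mv t MoveLeft) (Seq (Loop (\<lambda>g. g t \<noteq> 0) (mv t MoveLeft)) (mv t MoveRight))"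

text \<open>The body runs once before the loop and once after each move. The last move leads onto
  the blank at \<open>length w\<close>, which makes \<open>Suc (length w)\<close> runs.\<close>

definition forall_pos :: "tp \<Rightarrow> tp com \<Rightarrow> tp com" where
  "forall_pos t c = Seq c (Seq (Loop (\<lambda>g. g t \<noteq> 0) (Seq (mv t MoveRight) c)) (reset t))"

text \<open>Runs \<open>c\<close> as often as the position of \<open>v\<close> says. The head of
  \<open>v\<close> moves down to the blank at -1, starting one cell to the left so that the value
  \<open>length w\<close> is treated like the others; \<open>u\<close> counts the runs and then
  brings \<open>v\<close> back.\<close>

definition repeat_val :: "tp \<Rightarrow> tp \<Rightarrow> tp com \<Rightarrow> tp com" where
  "repeat_val v u c = Seq (mv v MoveLeft)
     (Seq (Loop (\<lambda>g. g v \<noteq> 0) (Seq c (Seq (mv u MoveRight) (mv v MoveLeft))))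
     (Seq (mv u MoveLeft)
     (Seq (Loop (\<lambda>g. g u \<noteq> 0) (Seq (mv v MoveRight) (mv u MoveLeft)))
     (Seq (mv u MoveRight) (mv v MoveRight)))))"

text \<open>The weight \<open>Suc N ^ m\<close> of a digit is realised by \<open>m\<close> nested
  sweeps over pointer tapes, so that no arithmetic has to be programmed.\<close>

primrec stride :: "nat \<Rightarrow> nat \<Rightarrow> tp com" where
  "stride a 0 = mv (Arr a) MoveRight"
| "stride a (Suc m) = forall_pos (Ptr 1 m) (stride a m)"

primrec goto :: "nat \<Rightarrow> nat list \<Rightarrow> tp com" where
  "goto a [] = skip"
| "goto a (i # js) = Seq (repeat_val (Ptr 0 i) (Ptr 3 0) (stride a (length js))) (goto a js)"

text \<open>Unmarked cells of an array are blank, so a blank cannot announce the left end; the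
  symbol 2 does.\<close>

definition rewind :: "nat \<Rightarrow> tp com" where
  "rewind a = Seq (Loop (\<lambda>g. g (Arr a) \<noteq> 2) (mv (Arr a) MoveLeft)) (mv (Arr a) MoveRight)"

text \<open>Flags are a stack of registers: the result goes to flag \<open>f\<close>, and the higher
  ones are cleared after use, so each subformula finds the flags from its own register on clear. In
  the case of \<open>Ex\<close> flag \<open>f\<close> accumulates the disjunction during the sweep.
  The level \<open>d\<close> names the pointer of the next bound variable.\<close>

fun comp_fm :: "nat \<Rightarrow> nat \<Rightarrow> fm \<Rightarrow> tp com" where
  "comp_fm f d (Letter i p) = set_flag f (\<lambda>g. p (g (Ptr 0 i)))"
| "comp_fm f d (Rel a js) = Seq (goto a js) (Seq (set_flag f (\<lambda>g. g (Arr a) = 1)) (rewind a))"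
| "comp_fm f d (Neg \<phi>) = Seq (comp_fm f d \<phi>) (set_flag f (\<lambda>g. g (Flag f) = 0))"
| "comp_fm f d (Conj \<phi> \<psi>) = Seq (comp_fm f d \<phi>) (Seq (comp_fm (Suc f) d \<psi>)
     (Seq (set_flag f (\<lambda>g. g (Flag f) = 1 \<and> g (Flag (Suc f)) = 1)) (set_flag (Suc f) (\<lambda>g. False))))"
| "comp_fm f d (Ex \<phi>) = forall_pos (Ptr 0 d) (Seq (comp_fm (Suc f) (Suc d) \<phi>)
     (Seq (set_flag f (\<lambda>g. g (Flag f) = 1 \<or> g (Flag (Suc f)) = 1)) (set_flag (Suc f) (\<lambda>g. False))))"

text \<open>The level \<open>e\<close> names the next free repetition counter, in the same way as
  \<open>d\<close> names the next variable. Flag 0 is cleared before the guarded program starts, so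
  programs always begin with all flags clear.\<close>

fun comp_prog :: "nat \<Rightarrow> nat \<Rightarrow> prog \<Rightarrow> tp com" where
  "comp_prog e d (Mark a js k) = Seq (goto a js)
     (Seq (((\<lambda>c. Seq (mv (Arr a) MoveRight) c) ^^ k) (mark a)) (rewind a))"
| "comp_prog e d (When \<phi> p) = Seq (comp_fm 0 d \<phi>)
     (Cond (\<lambda>g. g (Flag 0) = 1) (Seq (set_flag 0 (\<lambda>g. False)) (comp_prog e d p)) skip)"
| "comp_prog e d (For p) = forall_pos (Ptr 0 d) (comp_prog e (Suc d) p)"
| "comp_prog e d (Then p q) = Seq (comp_prog e d p) (comp_prog e d q)"
| "comp_prog e d (Rep p) = forall_pos (Ptr 2 e) (comp_prog (Suc e) d p)"

fun bounded_fm :: "nat \<Rightarrow> nat \<Rightarrow> nat \<Rightarrow> fm \<Rightarrow> bool" where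
  "bounded_fm K f d (Letter i p) = (f < K \<and> i < K)"
| "bounded_fm K f d (Rel a js) = (f < K \<and> a < K \<and> length js < K \<and> (\<forall>i\<in>set js. i < K))"
| "bounded_fm K f d (Neg \<phi>) = (f < K \<and> bounded_fm K f d \<phi>)"
| "bounded_fm K f d (Conj \<phi> \<psi>) = (Suc f < K \<and> bounded_fm K f d \<phi> \<and> bounded_fm K (Suc f) d \<psi>)"
| "bounded_fm K f d (Ex \<phi>) = (d < K \<and> Suc f < K \<and> bounded_fm K (Suc f) (Suc d) \<phi>)"

fun bounded_prog :: "nat \<Rightarrow> nat \<Rightarrow> nat \<Rightarrow> prog \<Rightarrow> bool" where
  "bounded_prog K e d (Mark a js k) = (a < K \<and> length js < K \<and> (\<forall>i\<in>set js. i < K))"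
| "bounded_prog K e d (When \<phi> p) = (bounded_fm K 0 d \<phi> \<and> bounded_prog K e d p)"
| "bounded_prog K e d (For p) = (d < K \<and> bounded_prog K e (Suc d) p)"
| "bounded_prog K e d (Then p q) = (bounded_prog K e d p \<and> bounded_prog K e d q)"
| "bounded_prog K e d (Rep p) = (e < K \<and> bounded_prog K (Suc e) d p)"

lemma ev_bounded_list: "\<forall>\<^sub>F K in sequentially. \<forall>i\<in>set js. i < K"
  by (simp add: eventually_ball_finite eventually_gt_at_top)

text \<open>All constraints on the number of tapes are lower bounds, so they hold for large
  \<open>K\<close>; with \<open>eventually\<close> the bounds of the parts combine without an
  explicit maximum.\<close>

lemma bounded_fm: "\<forall>\<^sub>F K in sequentially. bounded_fm K f d \<phi>"
  by (induction \<phi> arbitrary: f d)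
    (auto intro!: eventually_conj eventually_gt_at_top ev_bounded_list)

lemma bounded_prog: "\<forall>\<^sub>F K in sequentially. bounded_prog K e d p"
  by (induction p arbitrary: e d)
    (auto intro!: eventually_conj eventually_gt_at_top ev_bounded_list bounded_fm)

abbreviation ok :: "nat \<Rightarrow> tp com \<Rightarrow> bool" where
  "ok K \<equiv> ok_com 320 (tapes K)"

lemma ok_basic:
  "ok K skip" "t \<in> tapes K \<Longrightarrow> ok K (mv t m)" "i < K \<Longrightarrow> ok K (set_flag i b)"
  "a < K \<Longrightarrow> ok K (mark a)" "a < K \<Longrightarrow> ok K (rewind a)"
  by (auto simp: skip_def mv_def set_flag_def mark_def rewind_def ok_act_def)

lemma ok_derived:
  "t \<in> tapes K \<Longrightarrow> ok K c \<Longrightarrow> ok K (forall_pos t c)"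
  "u \<in> tapes K \<Longrightarrow> v \<in> tapes K \<Longrightarrow> ok K c \<Longrightarrow> ok K (repeat_val v u c)"
  by (auto simp: forall_pos_def repeat_val_def reset_def ok_basic)

lemma ok_stride: "a < K \<Longrightarrow> m \<le> K \<Longrightarrow> ok K (stride a m)"
  by (induction m) (auto simp: ok_basic ok_derived)

lemma ok_goto: "a < K \<Longrightarrow> length js \<le> K \<Longrightarrow> (\<forall>i\<in>set js. i < K) \<Longrightarrow> ok K (goto a js)"
  by (induction js) (auto simp: ok_basic ok_derived ok_stride)

lemma ok_comp_fm: "bounded_fm K f d \<phi> \<Longrightarrow> ok K (comp_fm f d \<phi>)"
  by (induction \<phi> arbitrary: f d) (auto simp: ok_basic ok_derived ok_goto)

lemma ok_comp_prog: "bounded_prog K e d p \<Longrightarrow> 0 < K \<Longrightarrow> ok K (comp_prog e d p)"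
proof (induction p arbitrary: e d)
  case (Mark a js k)
  then have "ok K (((\<lambda>c. Seq (mv (Arr a) MoveRight) c) ^^ k) (mark a))"
    by (induction k) (auto simp: ok_basic)
  with Mark show ?case by (auto simp: ok_basic ok_goto)
qed (auto simp: ok_basic ok_derived ok_comp_fm)

section \<open>Correctness and running time of the compiled commands\<close>

lemma le_skip: "1 \<le> T \<Longrightarrow> exec_le skip s T s"
  unfolding skip_def by (rule le_Act) auto

lemma le_mv:
  assumes "t \<in> tapes K" "(\<exists>k i. t = Ptr k i) \<or> (\<exists>a. t = Arr a)" "1 \<le> T"
    "pos' = pos(t := pos t + shift m)"
  shows "exec_le (mv t m) (st K w pos fl ar) T (st K w pos' fl ar)"
  unfolding mv_def assms(4)
  by (rule le_Act) (use assms(1-3) in \<open>auto simp: st_def scan_def fun_eq_iff split: tp.splits\<close>)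

lemma le_set_flag:
  assumes "f < K" "fl' = fl(f := b (scan (st K w pos fl ar)))" "1 \<le> T"
  shows "exec_le (set_flag f b) (st K w pos fl ar) T (st K w pos fl' ar)"
  unfolding set_flag_def assms(2)
  by (rule le_Act) (use assms(1,3) in \<open>auto simp: st_def scan_def fun_eq_iff split: tp.splits\<close>)

lemma le_mark:
  assumes "a < K" "pos (Arr a) = int x" "ar' = ar(a := (ar a)(x := True))" "1 \<le> T"
  shows "exec_le (mark a) (st K w pos fl ar) T (st K w pos fl ar')"
  unfolding mark_def assms(3)
  by (rule le_Act) (use assms(1,2,4) in \<open>auto simp: st_def scan_def fun_eq_iff split: tp.splits\<close>)

lemma le_reset:
  assumes t: "t = Ptr k i" "t \<in> tapes K" and "pos t = int x" "x \<le> length w"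
  shows "exec_le (reset t) (st K w pos fl ar) (2 * length w + 6) (st K w (pos(t := 0)) fl ar)"
proof -
  define S where "S m = st K w (pos(t := int x - 1 - int m)) fl ar" for m
  have "exec_le (Loop (\<lambda>g. g t \<noteq> 0) (mv t MoveLeft)) (S 0) (x * Suc 1 + 1) (S x)"
  proof (rule le_Loop)
    fix m assume "m < x"
    then have "scan (S m) t \<noteq> 0"
      using assms by (simp add: S_def scan_st content_eq_0_iff)
    moreover have "exec_le (mv t MoveLeft) (S m) 1 (S (Suc m))"
      unfolding S_def by (rule le_mv) (use t in auto)
    ultimately show "scan (S m) t \<noteq> 0 \<and> exec_le (mv t MoveLeft) (S m) 1 (S (Suc m))" by simp
  next
    show "\<not> scan (S x) t \<noteq> 0" using assms by (simp add: S_def scan_st content_eq_0_iff)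
  qed
  moreover have "exec_le (mv t MoveLeft) (st K w pos fl ar) 1 (S 0)"
    unfolding S_def by (rule le_mv) (use assms in auto)
  moreover have "exec_le (mv t MoveRight) (S x) 1 (st K w (pos(t := 0)) fl ar)"
    unfolding S_def by (rule le_mv) (use assms in auto)
  ultimately show ?thesis
    unfolding reset_def using assms(4) by (intro le_Seq[OF _ le_Seq[OF _ _ le_refl]]) auto
qed

text \<open>The families \<open>pos\<close>, \<open>fl\<close> and \<open>ar\<close> are indexed by
  the number of completed runs. The head of \<open>t\<close> is kept apart from them, since it moves
  between the runs and not within.\<close>

lemma le_forall_pos:
  assumes t: "t = Ptr k i" "t \<in> tapes K" and N: "N = length w"
    and body: "\<And>m. m \<le> N \<Longrightarrow> exec_le c (st K w ((pos m)(t := int m)) (fl m) (ar m)) T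
      (st K w ((pos (Suc m))(t := int m)) (fl (Suc m)) (ar (Suc m)))"
    and s0: "s0 = st K w ((pos 0)(t := 0)) (fl 0) (ar 0)"
    and s1: "s1 = st K w ((pos (Suc N))(t := 0)) (fl (Suc N)) (ar (Suc N))"
  shows "exec_le (forall_pos t c) s0 (Suc N * (T + 9)) s1"
proof -
  define S where "S m = st K w ((pos (Suc m))(t := int m)) (fl (Suc m)) (ar (Suc m))" for m
  have "exec_le (Loop (\<lambda>g. g t \<noteq> 0) (Seq (mv t MoveRight) c)) (S 0) (N * Suc (T + 2) + 1) (S N)"
  proof (rule le_Loop)
    fix m assume m: "m < N"
    have "scan (S m) t \<noteq> 0"
      using m t by (simp add: S_def scan_st content_eq_0_iff N del: content_int)
    moreover have "exec_le (Seq (mv t MoveRight) c) (S m) (T + 2) (S (Suc m))"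
      unfolding S_def
      by (rule le_Seq[OF le_mv body[of "Suc m"]]) (use t m in auto)
    ultimately show "scan (S m) t \<noteq> 0 \<and> exec_le (Seq (mv t MoveRight) c) (S m) (T + 2) (S (Suc m))" by simp
  next
    show "\<not> scan (S N) t \<noteq> 0"
      using t by (simp add: S_def scan_st content_eq_0_iff N del: content_int)
  qed
  moreover have "exec_le c s0 T (S 0)"
    using body[of 0] by (simp add: S_def s0)
  moreover have "exec_le (reset t) (S N) (2 * N + 6) s1"
    using le_reset[OF t, of "(pos (Suc N))(t := int N)" N w "fl (Suc N)" "ar (Suc N)"] N by (simp add: S_def s1)
  ultimately show ?thesis
    unfolding forall_pos_def by (rule_tac le_Seq[OF _ le_Seq[OF _ _ le_refl]]) (auto simp: algebra_simps)
qed

text \<open>The body is assumed correct for all positions \<open>a\<close>, \<open>b\<close> of the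
  two counting heads, because these move from run to run while the body must not depend on
  them.\<close>

lemma le_repeat_val:
  assumes v: "v = Ptr k i" "v \<in> tapes K" and u: "u = Ptr k' i'" "u \<in> tapes K" and uv: "u \<noteq> v"
    and x: "x \<le> length w"
    and body: "\<And>m a b. m < x \<Longrightarrow> exec_le c (st K w ((pos m)(v := a, u := b)) fl ar) T
      (st K w ((pos (Suc m))(v := a, u := b)) fl ar)"
    and s0: "s0 = st K w ((pos 0)(v := int x, u := 0)) fl ar"
    and s1: "s1 = st K w ((pos x)(v := int x, u := 0)) fl ar"
  shows "exec_le (repeat_val v u c) s0 (length w * (T + 9) + 11) s1"
proof -
  have ex: "(\<exists>k i. v = Ptr k i) \<or> (\<exists>a. v = Arr a)" "(\<exists>k i. u = Ptr k i) \<or> (\<exists>a. u = Arr a)"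
    using u v by auto
  note vu = ex u(2) v(2) uv
  define S where "S m = st K w ((pos m)(v := int x - 1 - int m, u := int m)) fl ar" for m
  have L1: "exec_le (Loop (\<lambda>g. g v \<noteq> 0) (Seq c (Seq (mv u MoveRight) (mv v MoveLeft)))) (S 0)
      (x * Suc (T + 4) + 1) (S x)"
  proof (rule le_Loop)
    fix m assume m: "m < x"
    have "scan (S m) v \<noteq> 0"
      using m v uv x by (simp add: S_def scan_st content_eq_0_iff)
    moreover have "exec_le (Seq c (Seq (mv u MoveRight) (mv v MoveLeft))) (S m) (T + 4) (S (Suc m))"
      unfolding S_def
      by (rule le_Seq[OF body[OF m] le_Seq[OF le_mv[OF _ _ order_refl refl] le_mv[OF _ _ order_refl] order_refl]]) (use vu in \<open>simp_all add: fun_eq_iff\<close>)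
    ultimately show "scan (S m) v \<noteq> 0 \<and>
        exec_le (Seq c (Seq (mv u MoveRight) (mv v MoveLeft))) (S m) (T + 4) (S (Suc m))" by simp
  next
    show "\<not> scan (S x) v \<noteq> 0"
      using v uv by (simp add: S_def scan_st content_eq_0_iff)
  qed
  define S' where "S' m = st K w ((pos x)(v := int m - 1, u := int x - 1 - int m)) fl ar" for m
  have L2: "exec_le (Loop (\<lambda>g. g u \<noteq> 0) (Seq (mv v MoveRight) (mv u MoveLeft))) (S' 0)
      (x * Suc 3 + 1) (S' x)"
  proof (rule le_Loop)
    fix m assume m: "m < x"
    have "scan (S' m) u \<noteq> 0"
      using m u uv x by (simp add: S'_def scan_st content_eq_0_iff)
    moreover have "exec_le (Seq (mv v MoveRight) (mv u MoveLeft)) (S' m) 3 (S' (Suc m))"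
      unfolding S'_def
      by (rule le_Seq[OF le_mv[OF _ _ order_refl refl] le_mv[OF _ _ order_refl]]) (use vu in \<open>simp_all add: fun_eq_iff\<close>)
    ultimately show "scan (S' m) u \<noteq> 0 \<and>
        exec_le (Seq (mv v MoveRight) (mv u MoveLeft)) (S' m) 3 (S' (Suc m))" by simp
  next
    show "\<not> scan (S' x) u \<noteq> 0"
      using u uv by (simp add: S'_def scan_st content_eq_0_iff)
  qed
  have a: "exec_le (mv v MoveLeft) s0 1 (S 0)"
    unfolding S_def s0 by (rule le_mv) (use vu in \<open>simp_all add: fun_eq_iff\<close>)
  have b: "exec_le (mv u MoveLeft) (S x) 1 (S' 0)"
    unfolding S_def S'_def by (rule le_mv) (use vu in \<open>simp_all add: fun_eq_iff\<close>)
  have c: "exec_le (Seq (mv u MoveRight) (mv v MoveRight)) (S' x) 3 s1"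
    unfolding S'_def s1 by (rule le_Seq[OF le_mv[OF _ _ order_refl refl] le_mv[OF _ _ order_refl]]) (use vu in \<open>simp_all add: fun_eq_iff\<close>)
  have "exec_le (repeat_val v u c) s0 (x * (T + 9) + 11) s1"
    unfolding repeat_val_def
    by (rule le_Seq[OF a le_Seq[OF L1 le_Seq[OF b le_Seq[OF L2 c le_refl] le_refl] le_refl]])
      (simp add: algebra_simps)
  then show ?thesis by (rule le_mono) (use x in simp)
qed

text \<open>The polynomial comes before \<open>K\<close>, the word and the store: it depends on the
  syntax alone. All bounds below have this form, which is what lets them be nested.\<close>

lemma le_stride:
  "\<exists>b::nat poly. \<forall>K w pos fl ar. a < K \<longrightarrow> m \<le> K \<longrightarrow> (\<forall>j<m. pos (Ptr 1 j) = 0) \<longrightarrow>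
     exec_le (stride a m) (st K w pos fl ar) (poly b (length w))
       (st K w (pos(Arr a := pos (Arr a) + int (Suc (length w) ^ m))) fl ar)"
proof (induction m)
  case 0
  show ?case
    by (rule exI[of _ 1]) (auto intro!: le_mv)
next
  case (Suc m)
  then obtain b :: "nat poly" where b: "\<And>K w pos fl ar. a < K \<Longrightarrow> m \<le> K \<Longrightarrow> (\<forall>j<m. pos (Ptr 1 j) = 0) \<Longrightarrow>
     exec_le (stride a m) (st K w pos fl ar) (poly b (length w))
       (st K w (pos(Arr a := pos (Arr a) + int (Suc (length w) ^ m))) fl ar)" by blast
  show ?case
  proof (intro exI[of _ "[:1, 1:] * (b + [:9:])"] allI impI)
    fix K and w :: input_word and pos fl ar
    assume as: "a < K" "Suc m \<le> K" "\<forall>j<Suc m. pos (Ptr 1 j) = (0::int)"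
    define N where "N = length w"
    let ?c = "int (Suc N ^ m)"
    let ?pos = "\<lambda>i. pos(Arr a := pos (Arr a) + int i * ?c)"
    have "exec_le (forall_pos (Ptr 1 m) (stride a m)) (st K w pos fl ar) (Suc N * (poly b N + 9))
      (st K w (pos(Arr a := pos (Arr a) + int (Suc N ^ Suc m))) fl ar)"
    proof (rule le_forall_pos[of _ 1 m K N w "stride a m" ?pos "\<lambda>_. fl" "\<lambda>_. ar"])
      fix i
      have eq: "(?pos (Suc i))(Ptr 1 m := int i) = ((?pos i)(Ptr 1 m := int i))(Arr a := ((?pos i)(Ptr 1 m := int i)) (Arr a) + ?c)"
        by (auto simp: fun_eq_iff algebra_simps)
      show "exec_le (stride a m) (st K w ((?pos i)(Ptr 1 m := int i)) fl ar) (poly b N)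
            (st K w ((?pos (Suc i))(Ptr 1 m := int i)) fl ar)"
        unfolding eq unfolding N_def using as by (intro b) auto
      show "st K w pos fl ar = st K w ((?pos 0)(Ptr 1 m := 0)) fl ar"
        using as(3) by (intro arg_cong[of _ _ "\<lambda>p. st K w p fl ar"]) auto
      show "st K w (pos(Arr a := pos (Arr a) + int (Suc N ^ Suc m))) fl ar
          = st K w ((?pos (Suc N))(Ptr 1 m := 0)) fl ar"
        using as(3) by (intro arg_cong[of _ _ "\<lambda>p. st K w p fl ar"]) (auto simp: fun_eq_iff algebra_simps)
    qed (use as N_def in auto)
    then show "exec_le (stride a (Suc m)) (st K w pos fl ar) (poly ([:1, 1:] * (b + [:9:])) (length w))
       (st K w (pos(Arr a := pos (Arr a) + int (Suc (length w) ^ Suc m))) fl ar)"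
      by (simp add: N_def algebra_simps)
  qed
qed

text \<open>The heads between commands: apart from the variables and the repetition counters, every
  head is back at 0.\<close>

definition vpos :: "(nat \<Rightarrow> nat) \<Rightarrow> (nat \<Rightarrow> nat) \<Rightarrow> tp \<Rightarrow> int" where
  "vpos cs xs t = (case t of Ptr k i \<Rightarrow> if k = 0 then int (xs i) else if k = 2 then int (cs i) else 0 | _ \<Rightarrow> 0)"

lemma vpos_simps [simp]: "vpos cs xs (Ptr 0 i) = int (xs i)" "vpos cs xs (Ptr 2 i) = int (cs i)"
  "vpos cs xs (Ptr 1 i) = 0" "vpos cs xs (Ptr (Suc 0) i) = 0" "vpos cs xs (Ptr 3 i) = 0" "vpos cs xs (Arr a) = 0"
  by (auto simp: vpos_def)

lemma le_goto:
  "\<exists>b::nat poly. \<forall>K w cs xs h fl ar. a < K \<longrightarrow> length js \<le> K \<longrightarrow> (\<forall>i\<in>set js. i < K) \<longrightarrow> 0 < K \<longrightarrow>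
     (\<forall>i. xs i \<le> length w) \<longrightarrow>
     exec_le (goto a js) (st K w ((vpos cs xs)(Arr a := h)) fl ar) (poly b (length w))
       (st K w ((vpos cs xs)(Arr a := h + int (addr (length w) (map xs js)))) fl ar)"
proof (induction js)
  case Nil
  show ?case by (rule exI[of _ 1]) (auto intro!: le_skip)
next
  case (Cons i js)
  obtain b1 :: "nat poly" where b1: "\<And>K w pos fl ar. a < K \<Longrightarrow> length js \<le> K \<Longrightarrow> (\<forall>j<length js. pos (Ptr 1 j) = 0) \<Longrightarrow>
     exec_le (stride a (length js)) (st K w pos fl ar) (poly b1 (length w))
       (st K w (pos(Arr a := pos (Arr a) + int (Suc (length w) ^ length js))) fl ar)"
    using le_stride[of a "length js"] by blast
  from Cons obtain b2 :: "nat poly" where b2: "\<And>K w cs xs h fl ar. a < K \<Longrightarrow> length js \<le> K \<Longrightarrow> (\<forall>i\<in>set js. i < K) \<Longrightarrow> 0 < K \<Longrightarrow>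
     (\<forall>i. xs i \<le> length w) \<Longrightarrow>
     exec_le (goto a js) (st K w ((vpos cs xs)(Arr a := h)) fl ar) (poly b2 (length w))
       (st K w ((vpos cs xs)(Arr a := h + int (addr (length w) (map xs js)))) fl ar)" by blast
  show ?case
  proof (intro exI[of _ "[:0, 1:] * (b1 + [:9:]) + [:12:] + b2"] allI impI)
    fix K and w :: input_word and cs xs :: "nat \<Rightarrow> nat" and h fl ar
    assume as: "a < K" "length (i # js) \<le> K" "\<forall>i\<in>set (i # js). i < K" "0 < K" "\<forall>i. xs i \<le> length w"
    define N where "N = length w"
    let ?c = "int (Suc N ^ length js)"
    let ?pos = "\<lambda>m. (vpos cs xs)(Arr a := h + int m * ?c)"
    have "exec_le (repeat_val (Ptr 0 i) (Ptr 3 0) (stride a (length js))) (st K w ((vpos cs xs)(Arr a := h)) fl ar)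
       (length w * (poly b1 N + 9) + 11) (st K w (?pos (xs i)) fl ar)"
    proof (rule le_repeat_val[of _ 0 i K _ 3 0 "xs i" w "stride a (length js)" ?pos])
      fix m p q
      have eq: "(?pos (Suc m))(Ptr 0 i := p, Ptr 3 0 := q) = ((?pos m)(Ptr 0 i := p, Ptr 3 0 := q))(Arr a :=
        ((?pos m)(Ptr 0 i := p, Ptr 3 0 := q)) (Arr a) + ?c)"
        by (auto simp: fun_eq_iff algebra_simps)
      show "exec_le (stride a (length js)) (st K w ((?pos m)(Ptr 0 i := p, Ptr 3 0 := q)) fl ar) (poly b1 N)
         (st K w ((?pos (Suc m))(Ptr 0 i := p, Ptr 3 0 := q)) fl ar)"
        unfolding eq unfolding N_def using as by (intro b1) auto
      show "st K w ((vpos cs xs)(Arr a := h)) fl ar = st K w ((?pos 0)(Ptr 0 i := int (xs i), Ptr 3 0 := 0)) fl ar"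
        by (intro arg_cong[of _ _ "\<lambda>p. st K w p fl ar"]) (auto simp: fun_eq_iff)
      show "st K w (?pos (xs i)) fl ar = st K w ((?pos (xs i))(Ptr 0 i := int (xs i), Ptr 3 0 := 0)) fl ar"
        by (intro arg_cong[of _ _ "\<lambda>p. st K w p fl ar"]) (auto simp: fun_eq_iff)
    qed (use as in auto)
    moreover have "exec_le (goto a js) (st K w (?pos (xs i)) fl ar) (poly b2 (length w))
       (st K w ((vpos cs xs)(Arr a := h + int (xs i) * ?c + int (addr (length w) (map xs js)))) fl ar)"
      using as by (intro b2) auto
    ultimately show "exec_le (goto a (i # js)) (st K w ((vpos cs xs)(Arr a := h)) fl ar)
       (poly ([:0, 1:] * (b1 + [:9:]) + [:12:] + b2) (length w))
       (st K w ((vpos cs xs)(Arr a := h + int (addr (length w) (map xs (i # js))))) fl ar)"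
      unfolding goto.simps by (rule le_Seq[THEN back_subst[of "exec_le _ _ _"]]) (auto simp: N_def algebra_simps)
  qed
qed

lemma le_rewind:
  assumes "a < K"
  shows "exec_le (rewind a) (st K w ((vpos cs xs)(Arr a := int h)) fl ar) (2 * h + 5) (st K w (vpos cs xs) fl ar)"
proof -
  define S where "S m = st K w ((vpos cs xs)(Arr a := int h - int m)) fl ar" for m
  have "exec_le (Loop (\<lambda>g. g (Arr a) \<noteq> 2) (mv (Arr a) MoveLeft)) (S 0) (Suc h * Suc 1 + 1) (S (Suc h))"
  proof (rule le_Loop)
    fix m assume "m < Suc h"
    then have "scan (S m) (Arr a) \<noteq> 2"
      using assms by (simp add: S_def scan_st)
    moreover have "exec_le (mv (Arr a) MoveLeft) (S m) 1 (S (Suc m))"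
      unfolding S_def by (rule le_mv) (use assms in auto)
    ultimately show "scan (S m) (Arr a) \<noteq> 2 \<and> exec_le (mv (Arr a) MoveLeft) (S m) 1 (S (Suc m))" by simp
  next
    show "\<not> scan (S (Suc h)) (Arr a) \<noteq> 2" using assms by (simp add: S_def scan_st)
  qed
  moreover have "exec_le (mv (Arr a) MoveRight) (S (Suc h)) 1 (st K w (vpos cs xs) fl ar)"
    unfolding S_def by (rule le_mv) (use assms in \<open>auto simp: fun_eq_iff\<close>)
  moreover have "S 0 = st K w ((vpos cs xs)(Arr a := int h)) fl ar" by (simp add: S_def)
  ultimately show ?thesis
    unfolding rewind_def using le_Seq by fastforce
qed

text \<open>Hence the way to a cell and back is polynomial in the length of the word for a fixed
  arity.\<close>

lemma addr_le:
  assumes "\<forall>i. xs i \<le> N"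
  shows "addr N (map xs js) \<le> Suc N ^ length js"
  using addr_less[of "map xs js" N] assms by fastforce

text \<open>The hypotheses say that the resources from level \<open>d\<close> and register
  \<open>f\<close> on are at rest. A sweep returns its pointer to 0, so they are at rest again
  afterwards, except for flag \<open>f\<close> with the result.\<close>

lemma le_comp_fm:
  "\<exists>b::nat poly. \<forall>K w cs xs fl ar. bounded_fm K f d \<phi> \<longrightarrow> (\<forall>i. xs i \<le> length w) \<longrightarrow>
     (\<forall>i\<ge>d. xs i = 0) \<longrightarrow> (\<forall>i\<ge>f. \<not> fl i) \<longrightarrow>
     exec_le (comp_fm f d \<phi>) (st K w (vpos cs xs) fl ar) (poly b (length w))
       (st K w (vpos cs xs) (fl(f := ev w ar d xs \<phi>)) ar)"
proof (induction \<phi> arbitrary: f d)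
  case (Letter i p)
  show ?case by (rule exI[of _ 1]) (auto intro!: le_set_flag simp: scan_st)
next
  case (Rel a js)
  obtain b :: "nat poly" where b: "\<And>K w cs xs h fl ar. a < K \<Longrightarrow> length js \<le> K \<Longrightarrow> (\<forall>i\<in>set js. i < K) \<Longrightarrow> 0 < K \<Longrightarrow>
     (\<forall>i. xs i \<le> length w) \<Longrightarrow>
     exec_le (goto a js) (st K w ((vpos cs xs)(Arr a := h)) fl ar) (poly b (length w))
       (st K w ((vpos cs xs)(Arr a := h + int (addr (length w) (map xs js)))) fl ar)"
    using le_goto[of a js] by blast
  show ?case
  proof (intro exI[of _ "b + 2 * [:1, 1:] ^ length js + [:8:]"] allI impI)
    fix K and w :: input_word and cs xs :: "nat \<Rightarrow> nat" and fl ar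
    assume as: "bounded_fm K f d (Rel a js)" "\<forall>i. xs i \<le> length w"
    let ?h = "addr (length w) (map xs js)"
    have 1: "exec_le (goto a js) (st K w (vpos cs xs) fl ar) (poly b (length w))
       (st K w ((vpos cs xs)(Arr a := int ?h)) fl ar)"
      using b[of K xs w cs 0] as fun_upd_triv[of "vpos cs xs" "Arr a"] by simp
    have 2: "exec_le (set_flag f (\<lambda>g. g (Arr a) = 1)) (st K w ((vpos cs xs)(Arr a := int ?h)) fl ar) 1
       (st K w ((vpos cs xs)(Arr a := int ?h)) (fl(f := ar a ?h)) ar)"
      by (rule le_set_flag) (use as in \<open>auto simp: scan_st\<close>)
    show "exec_le (comp_fm f d (Rel a js)) (st K w (vpos cs xs) fl ar)
       (poly (b + 2 * [:1, 1:] ^ length js + [:8:]) (length w))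
       (st K w (vpos cs xs) (fl(f := ev w ar d xs (Rel a js))) ar)"
      unfolding comp_fm.simps
      by (rule le_Seq[OF 1 le_Seq[OF 2 _ le_refl]], unfold ev.simps, rule le_rewind)
        (use as addr_le[OF as(2), of js] in \<open>auto simp: poly_power\<close>)
  qed
next
  case (Neg \<phi>)
  then obtain b :: "nat poly" where b: "\<And>K w cs xs fl ar. bounded_fm K f d \<phi> \<Longrightarrow> (\<forall>i. xs i \<le> length w) \<Longrightarrow>
     (\<forall>i\<ge>d. xs i = 0) \<Longrightarrow> (\<forall>i\<ge>f. \<not> fl i) \<Longrightarrow>
     exec_le (comp_fm f d \<phi>) (st K w (vpos cs xs) fl ar) (poly b (length w))
       (st K w (vpos cs xs) (fl(f := ev w ar d xs \<phi>)) ar)" by blast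
  show ?case
    by (rule exI[of _ "b + [:2:]"])
      (auto intro!: le_Seq[OF b le_set_flag[OF _ _ order_refl]] simp: scan_st)
next
  case (Conj \<phi> \<psi>)
  from Conj(1)[of f d] obtain b :: "nat poly" where b: "\<And>K w cs xs fl ar. bounded_fm K f d \<phi> \<Longrightarrow> (\<forall>i. xs i \<le> length w) \<Longrightarrow>
     (\<forall>i\<ge>d. xs i = 0) \<Longrightarrow> (\<forall>i\<ge>f. \<not> fl i) \<Longrightarrow>
     exec_le (comp_fm f d \<phi>) (st K w (vpos cs xs) fl ar) (poly b (length w))
       (st K w (vpos cs xs) (fl(f := ev w ar d xs \<phi>)) ar)" by blast
  from Conj(2)[of "Suc f" d] obtain b' :: "nat poly" where b': "\<And>K w cs xs fl ar. bounded_fm K (Suc f) d \<psi> \<Longrightarrow> (\<forall>i. xs i \<le> length w) \<Longrightarrow>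
     (\<forall>i\<ge>d. xs i = 0) \<Longrightarrow> (\<forall>i\<ge>Suc f. \<not> fl i) \<Longrightarrow>
     exec_le (comp_fm (Suc f) d \<psi>) (st K w (vpos cs xs) fl ar) (poly b' (length w))
       (st K w (vpos cs xs) (fl(Suc f := ev w ar d xs \<psi>)) ar)" by blast
  show ?case
  proof (intro exI[of _ "b + b' + [:6:]"] allI impI)
    fix K and w :: input_word and cs xs :: "nat \<Rightarrow> nat" and fl ar
    assume as: "bounded_fm K f d (Conj \<phi> \<psi>)" "\<forall>i. xs i \<le> length w" "\<forall>i\<ge>d. xs i = 0" "\<forall>i\<ge>f. \<not> fl i"
    show "exec_le (comp_fm f d (Conj \<phi> \<psi>)) (st K w (vpos cs xs) fl ar) (poly (b + b' + [:6:]) (length w))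
       (st K w (vpos cs xs) (fl(f := ev w ar d xs (Conj \<phi> \<psi>))) ar)"
      unfolding comp_fm.simps
      by (rule le_Seq[OF b le_Seq[OF b' le_Seq[OF
              le_set_flag[OF _ refl order_refl] le_set_flag[OF _ _ order_refl] order_refl] order_refl]])
        (use as in \<open>auto simp: fun_eq_iff scan_st\<close>)
  qed
next
  case (Ex \<phi>)
  from Ex[of "Suc f" "Suc d"] obtain b :: "nat poly" where b: "\<And>K w cs xs fl ar. bounded_fm K (Suc f) (Suc d) \<phi> \<Longrightarrow> (\<forall>i. xs i \<le> length w) \<Longrightarrow>
     (\<forall>i\<ge>Suc d. xs i = 0) \<Longrightarrow> (\<forall>i\<ge>Suc f. \<not> fl i) \<Longrightarrow>
     exec_le (comp_fm (Suc f) (Suc d) \<phi>) (st K w (vpos cs xs) fl ar) (poly b (length w))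
       (st K w (vpos cs xs) (fl(Suc f := ev w ar (Suc d) xs \<phi>)) ar)" by blast
  show ?case
  proof (intro exI[of _ "[:1, 1:] * (b + [:13:])"] allI impI)
    fix K and w :: input_word and cs xs :: "nat \<Rightarrow> nat" and fl ar
    assume as: "bounded_fm K f d (Ex \<phi>)" "\<forall>i. xs i \<le> length w" "\<forall>i\<ge>d. xs i = 0" "\<forall>i\<ge>f. \<not> fl i"
    define N where "N = length w"
    \<comment> \<open>After \<open>m\<close> runs the flag holds the disjunction over the values
      below \<open>m\<close>.\<close>
    let ?fl = "\<lambda>m. fl(f := \<exists>y<m. ev w ar (Suc d) (xs(d := y)) \<phi>)"
    have upd: "(vpos cs xs)(Ptr 0 d := int m) = vpos cs (xs(d := m))" for m
      by (auto simp: fun_eq_iff vpos_def split: tp.splits)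
    have "exec_le (comp_fm f d (Ex \<phi>)) (st K w (vpos cs xs) fl ar) (Suc N * (poly b N + 4 + 9))
       (st K w (vpos cs xs) (?fl (Suc N)) ar)"
      unfolding comp_fm.simps
    proof (rule le_forall_pos[of _ 0 d K N w _ "\<lambda>_. vpos cs xs" ?fl "\<lambda>_. ar"])
      fix m assume "m \<le> N"
      show "exec_le (Seq (comp_fm (Suc f) (Suc d) \<phi>)
          (Seq (set_flag f (\<lambda>g. g (Flag f) = 1 \<or> g (Flag (Suc f)) = 1)) (set_flag (Suc f) (\<lambda>g. False))))
        (st K w ((vpos cs xs)(Ptr 0 d := int m)) (?fl m) ar) (poly b N + 4)
        (st K w ((vpos cs xs)(Ptr 0 d := int m)) (?fl (Suc m)) ar)"
        unfolding upd N_def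
        by (rule le_Seq[OF b le_Seq[OF
              le_set_flag[OF _ refl order_refl] le_set_flag[OF _ _ order_refl] order_refl]])
          (use as \<open>m \<le> N\<close> N_def in \<open>auto simp: fun_eq_iff scan_st less_Suc_eq\<close>)
    next
      have e: "(vpos cs xs)(Ptr 0 d := 0) = vpos cs xs" "?fl 0 = fl"
        using as(3,4) by (auto simp: fun_eq_iff)
      show "st K w (vpos cs xs) fl ar = st K w ((vpos cs xs)(Ptr 0 d := 0)) (?fl 0) ar"
        by (simp only: e)
      show "st K w (vpos cs xs) (?fl (Suc N)) ar = st K w ((vpos cs xs)(Ptr 0 d := 0)) (?fl (Suc N)) ar"
        by (simp only: e)
    qed (use as N_def in auto)
    then show "exec_le (comp_fm f d (Ex \<phi>)) (st K w (vpos cs xs) fl ar) (poly ([:1, 1:] * (b + [:13:])) (length w))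
       (st K w (vpos cs xs) (fl(f := ev w ar d xs (Ex \<phi>))) ar)"
      by (simp add: N_def algebra_simps less_Suc_eq_le)
  qed
qed

lemma le_mark_offset:
  assumes "a < K"
  shows "exec_le (((\<lambda>c. Seq (mv (Arr a) MoveRight) c) ^^ k) (mark a)) (st K w ((vpos cs xs)(Arr a := int h)) fl ar)
    (2 * k + 1) (st K w ((vpos cs xs)(Arr a := int (h + k))) fl (ar(a := (ar a)(h + k := True))))"
proof (induction k arbitrary: h)
  case 0
  have "exec_le (mark a) (st K w ((vpos cs xs)(Arr a := int h)) fl ar) 1
      (st K w ((vpos cs xs)(Arr a := int h)) fl (ar(a := (ar a)(h := True))))"
    by (rule le_mark[OF assms _ refl]) simp_all
  then show ?case by (simp del: fun_upd_apply)
next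
  case (Suc k)
  have "exec_le (mv (Arr a) MoveRight) (st K w ((vpos cs xs)(Arr a := int h)) fl ar) 1
      (st K w ((vpos cs xs)(Arr a := int (Suc h))) fl ar)"
    by (rule le_mv) (use assms in auto)
  from le_Seq[OF this Suc[of "Suc h"] order_refl] show ?case by (simp del: fun_upd_apply)
qed

text \<open>All flags are clear at both ends, so consecutive programs fit together without mention
  of registers.\<close>

lemma le_comp_prog:
  "\<exists>b::nat poly. \<forall>K w cs xs ar. bounded_prog K e d p \<longrightarrow> 0 < K \<longrightarrow> (\<forall>i. xs i \<le> length w) \<longrightarrow>
     (\<forall>i\<ge>d. xs i = 0) \<longrightarrow> (\<forall>i\<ge>e. cs i = 0) \<longrightarrow>
     exec_le (comp_prog e d p) (st K w (vpos cs xs) (\<lambda>_. False) ar) (poly b (length w))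
       (st K w (vpos cs xs) (\<lambda>_. False) (sem w d xs p ar))"
proof (induction p arbitrary: e d)
  case (Mark a js k)
  obtain b :: "nat poly" where b: "\<And>K w cs xs h fl ar. a < K \<Longrightarrow> length js \<le> K \<Longrightarrow> (\<forall>i\<in>set js. i < K) \<Longrightarrow> 0 < K \<Longrightarrow>
     (\<forall>i. xs i \<le> length w) \<Longrightarrow>
     exec_le (goto a js) (st K w ((vpos cs xs)(Arr a := h)) fl ar) (poly b (length w))
       (st K w ((vpos cs xs)(Arr a := h + int (addr (length w) (map xs js)))) fl ar)"
    using le_goto[of a js] by blast
  show ?case
  proof (intro exI[of _ "b + 2 * [:1, 1:] ^ length js + [:4 * k + 8:]"] allI impI)
    fix K and w :: input_word and cs xs :: "nat \<Rightarrow> nat" and ar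
    assume as: "bounded_prog K e d (Mark a js k)" "0 < K" "\<forall>i. xs i \<le> length w"
    let ?h = "addr (length w) (map xs js)"
    have 1: "exec_le (goto a js) (st K w (vpos cs xs) (\<lambda>_. False) ar) (poly b (length w))
       (st K w ((vpos cs xs)(Arr a := int ?h)) (\<lambda>_. False) ar)"
      using b[of K xs w cs 0] as fun_upd_triv[of "vpos cs xs" "Arr a"] by simp
    have aK: "a < K" using as by simp
    show "exec_le (comp_prog e d (Mark a js k)) (st K w (vpos cs xs) (\<lambda>_. False) ar)
       (poly (b + 2 * [:1, 1:] ^ length js + [:4 * k + 8:]) (length w))
       (st K w (vpos cs xs) (\<lambda>_. False) (sem w d xs (Mark a js k) ar))"
      unfolding comp_prog.simps sem.simps
      by (rule le_Seq[OF 1 le_Seq[OF le_mark_offset[OF aK] le_rewind[OF aK] le_refl]])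
        (use as addr_le[OF as(3), of js] in \<open>auto simp: poly_power\<close>)
  qed
next
  case (When \<phi> p)
  obtain b :: "nat poly" where b: "\<And>K w cs xs fl ar. bounded_fm K 0 d \<phi> \<Longrightarrow> (\<forall>i. xs i \<le> length w) \<Longrightarrow>
     (\<forall>i\<ge>d. xs i = 0) \<Longrightarrow> (\<forall>i\<ge>0. \<not> fl i) \<Longrightarrow>
     exec_le (comp_fm 0 d \<phi>) (st K w (vpos cs xs) fl ar) (poly b (length w))
       (st K w (vpos cs xs) (fl(0 := ev w ar d xs \<phi>)) ar)"
    using le_comp_fm[of 0 d \<phi>] by blast
  from When[of e d] obtain b' :: "nat poly" where b': "\<And>K w cs xs ar. bounded_prog K e d p \<Longrightarrow> 0 < K \<Longrightarrow> (\<forall>i. xs i \<le> length w) \<Longrightarrow>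
     (\<forall>i\<ge>d. xs i = 0) \<Longrightarrow> (\<forall>i\<ge>e. cs i = 0) \<Longrightarrow>
     exec_le (comp_prog e d p) (st K w (vpos cs xs) (\<lambda>_. False) ar) (poly b' (length w))
       (st K w (vpos cs xs) (\<lambda>_. False) (sem w d xs p ar))" by blast
  show ?case
  proof (intro exI[of _ "b + b' + [:4:]"] allI impI)
    fix K and w :: input_word and cs xs :: "nat \<Rightarrow> nat" and ar
    assume as: "bounded_prog K e d (When \<phi> p)" "0 < K" "\<forall>i. xs i \<le> length w" "\<forall>i\<ge>d. xs i = 0" "\<forall>i\<ge>e. cs i = 0"
    let ?s = "st K w (vpos cs xs) ((\<lambda>_. False)(0 := ev w ar d xs \<phi>)) ar"
    have 1: "exec_le (comp_fm 0 d \<phi>) (st K w (vpos cs xs) (\<lambda>_. False) ar) (poly b (length w)) ?s"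
      using as by (intro b) auto
    have 2: "exec_le (Seq (set_flag 0 (\<lambda>g. False)) (comp_prog e d p)) ?s (poly b' (length w) + 2)
       (st K w (vpos cs xs) (\<lambda>_. False) (sem w d xs p ar))"
      by (rule le_Seq[OF le_set_flag[OF _ _ order_refl] b'[of K]]) (use as in auto)
    have 3: "scan ?s (Flag 0) = 1 \<longleftrightarrow> ev w ar d xs \<phi>"
      using as by (simp add: scan_st)
    show "exec_le (comp_prog e d (When \<phi> p)) (st K w (vpos cs xs) (\<lambda>_. False) ar) (poly (b + b' + [:4:]) (length w))
       (st K w (vpos cs xs) (\<lambda>_. False) (sem w d xs (When \<phi> p) ar))"
      unfolding comp_prog.simps
    proof (rule le_Seq[OF 1 le_Cond[where m = "poly b' (length w) + 2", OF _ order_refl]])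
      show "exec_le (if scan ?s (Flag 0) = 1 then Seq (set_flag 0 (\<lambda>g. False)) (comp_prog e d p) else skip)
         ?s (poly b' (length w) + 2) (st K w (vpos cs xs) (\<lambda>_. False) (sem w d xs (When \<phi> p) ar))"
      proof (cases "ev w ar d xs \<phi>")
        case True
        with 2 3 show ?thesis by simp
      next
        case False
        then have "(\<lambda>_. False)(0 := ev w ar d xs \<phi>) = (\<lambda>_::nat. False)" by auto
        then have "?s = st K w (vpos cs xs) (\<lambda>_. False) ar" by (simp only:)
        with False 3 show ?thesis by (simp add: le_skip del: fun_upd_apply)
      qed
    qed simp
  qed
next
  case (For p)
  from For[of e "Suc d"] obtain b :: "nat poly" where b: "\<And>K w cs xs ar. bounded_prog K e (Suc d) p \<Longrightarrow> 0 < K \<Longrightarrow> (\<forall>i. xs i \<le> length w) \<Longrightarrow>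
     (\<forall>i\<ge>Suc d. xs i = 0) \<Longrightarrow> (\<forall>i\<ge>e. cs i = 0) \<Longrightarrow>
     exec_le (comp_prog e (Suc d) p) (st K w (vpos cs xs) (\<lambda>_. False) ar) (poly b (length w))
       (st K w (vpos cs xs) (\<lambda>_. False) (sem w (Suc d) xs p ar))" by blast
  show ?case
  proof (intro exI[of _ "[:1, 1:] * (b + [:9:])"] allI impI)
    fix K and w :: input_word and cs xs :: "nat \<Rightarrow> nat" and ar
    assume as: "bounded_prog K e d (For p)" "0 < K" "\<forall>i. xs i \<le> length w" "\<forall>i\<ge>d. xs i = 0" "\<forall>i\<ge>e. cs i = 0"
    define N where "N = length w"
    let ?ar = "\<lambda>m. fold (\<lambda>y. sem w (Suc d) (xs(d := y)) p) [0..<m] ar"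
    have upd: "(vpos cs xs)(Ptr 0 d := int m) = vpos cs (xs(d := m))" for m
      by (auto simp: fun_eq_iff vpos_def split: tp.splits)
    have e: "(vpos cs xs)(Ptr 0 d := 0) = vpos cs xs"
      using as(4) by (auto simp: fun_eq_iff)
    have "exec_le (comp_prog e d (For p)) (st K w (vpos cs xs) (\<lambda>_. False) ar) (Suc N * (poly b N + 9))
       (st K w (vpos cs xs) (\<lambda>_. False) (?ar (Suc N)))"
      unfolding comp_prog.simps
    proof (rule le_forall_pos[of _ 0 d K N w _ "\<lambda>_. vpos cs xs" "\<lambda>_ _. False" ?ar])
      fix m assume "m \<le> N"
      have "exec_le (comp_prog e (Suc d) p) (st K w (vpos cs (xs(d := m))) (\<lambda>_. False) (?ar m)) (poly b (length w))
        (st K w (vpos cs (xs(d := m))) (\<lambda>_. False) (sem w (Suc d) (xs(d := m)) p (?ar m)))"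
        by (rule b) (use as \<open>m \<le> N\<close> N_def in auto)
      then show "exec_le (comp_prog e (Suc d) p) (st K w ((vpos cs xs)(Ptr 0 d := int m)) (\<lambda>_. False) (?ar m)) (poly b N)
        (st K w ((vpos cs xs)(Ptr 0 d := int m)) (\<lambda>_. False) (?ar (Suc m)))"
        unfolding upd by (simp add: N_def)
    next
      show "st K w (vpos cs xs) (\<lambda>_. False) ar = st K w ((vpos cs xs)(Ptr 0 d := 0)) (\<lambda>_. False) (?ar 0)"
        by (simp only: e) simp
      show "st K w (vpos cs xs) (\<lambda>_. False) (?ar (Suc N)) = st K w ((vpos cs xs)(Ptr 0 d := 0)) (\<lambda>_. False) (?ar (Suc N))"
        by (simp only: e)
    qed (use as N_def in auto)
    then show "exec_le (comp_prog e d (For p)) (st K w (vpos cs xs) (\<lambda>_. False) ar) (poly ([:1, 1:] * (b + [:9:])) (length w))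
       (st K w (vpos cs xs) (\<lambda>_. False) (sem w d xs (For p) ar))"
      by (simp add: N_def algebra_simps)
  qed
next
  case (Then p q)
  from Then(1)[of e d] obtain b :: "nat poly" where b: "\<And>K w cs xs ar. bounded_prog K e d p \<Longrightarrow> 0 < K \<Longrightarrow> (\<forall>i. xs i \<le> length w) \<Longrightarrow>
     (\<forall>i\<ge>d. xs i = 0) \<Longrightarrow> (\<forall>i\<ge>e. cs i = 0) \<Longrightarrow>
     exec_le (comp_prog e d p) (st K w (vpos cs xs) (\<lambda>_. False) ar) (poly b (length w))
       (st K w (vpos cs xs) (\<lambda>_. False) (sem w d xs p ar))" by blast
  from Then(2)[of e d] obtain b' :: "nat poly" where b': "\<And>K w cs xs ar. bounded_prog K e d q \<Longrightarrow> 0 < K \<Longrightarrow> (\<forall>i. xs i \<le> length w) \<Longrightarrow>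
     (\<forall>i\<ge>d. xs i = 0) \<Longrightarrow> (\<forall>i\<ge>e. cs i = 0) \<Longrightarrow>
     exec_le (comp_prog e d q) (st K w (vpos cs xs) (\<lambda>_. False) ar) (poly b' (length w))
       (st K w (vpos cs xs) (\<lambda>_. False) (sem w d xs q ar))" by blast
  show ?case
    by (rule exI[of _ "b + b' + [:1:]"]) (auto intro!: le_Seq[OF b b'])
next
  case (Rep p)
  from Rep[of "Suc e" d] obtain b :: "nat poly" where b: "\<And>K w cs xs ar. bounded_prog K (Suc e) d p \<Longrightarrow> 0 < K \<Longrightarrow> (\<forall>i. xs i \<le> length w) \<Longrightarrow>
     (\<forall>i\<ge>d. xs i = 0) \<Longrightarrow> (\<forall>i\<ge>Suc e. cs i = 0) \<Longrightarrow>
     exec_le (comp_prog (Suc e) d p) (st K w (vpos cs xs) (\<lambda>_. False) ar) (poly b (length w))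
       (st K w (vpos cs xs) (\<lambda>_. False) (sem w d xs p ar))" by blast
  show ?case
  proof (intro exI[of _ "[:1, 1:] * (b + [:9:])"] allI impI)
    fix K and w :: input_word and cs xs :: "nat \<Rightarrow> nat" and ar
    assume as: "bounded_prog K e d (Rep p)" "0 < K" "\<forall>i. xs i \<le> length w" "\<forall>i\<ge>d. xs i = 0" "\<forall>i\<ge>e. cs i = 0"
    define N where "N = length w"
    let ?ar = "\<lambda>m. (sem w d xs p ^^ m) ar"
    have upd: "(vpos cs xs)(Ptr 2 e := int m) = vpos (cs(e := m)) xs" for m
      by (auto simp: fun_eq_iff vpos_def split: tp.splits)
    have e: "(vpos cs xs)(Ptr 2 e := 0) = vpos cs xs"
      using as(5) by (auto simp: fun_eq_iff)
    have "exec_le (comp_prog e d (Rep p)) (st K w (vpos cs xs) (\<lambda>_. False) ar) (Suc N * (poly b N + 9))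
       (st K w (vpos cs xs) (\<lambda>_. False) (?ar (Suc N)))"
      unfolding comp_prog.simps
    proof (rule le_forall_pos[of _ 2 e K N w _ "\<lambda>_. vpos cs xs" "\<lambda>_ _. False" ?ar])
      fix m assume "m \<le> N"
      have "exec_le (comp_prog (Suc e) d p) (st K w (vpos (cs(e := m)) xs) (\<lambda>_. False) (?ar m)) (poly b (length w))
        (st K w (vpos (cs(e := m)) xs) (\<lambda>_. False) (sem w d xs p (?ar m)))"
        by (rule b) (use as \<open>m \<le> N\<close> N_def in auto)
      then show "exec_le (comp_prog (Suc e) d p) (st K w ((vpos cs xs)(Ptr 2 e := int m)) (\<lambda>_. False) (?ar m)) (poly b N)
        (st K w ((vpos cs xs)(Ptr 2 e := int m)) (\<lambda>_. False) (?ar (Suc m)))"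
        unfolding upd by (simp add: N_def)
    next
      show "st K w (vpos cs xs) (\<lambda>_. False) ar = st K w ((vpos cs xs)(Ptr 2 e := 0)) (\<lambda>_. False) (?ar 0)"
        by (simp only: e) simp
      show "st K w (vpos cs xs) (\<lambda>_. False) (?ar (Suc N)) = st K w ((vpos cs xs)(Ptr 2 e := 0)) (\<lambda>_. False) (?ar (Suc N))"
        by (simp only: e)
    qed (use as N_def in auto)
    then show "exec_le (comp_prog e d (Rep p)) (st K w (vpos cs xs) (\<lambda>_. False) ar) (poly ([:1, 1:] * (b + [:9:])) (length w))
       (st K w (vpos cs xs) (\<lambda>_. False) (sem w d xs (Rep p) ar))"
      by (simp add: N_def algebra_simps)
  qed
qed

section \<open>Labelling the input by one sweep\<close>

definition next_ctx :: "nat \<Rightarrow> nat \<Rightarrow> nat" where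
  "next_ctx q a = (if a = 3 then min 7 (Suc (q mod 8)) + 8 * (q div 8)
     else if a = 4 then (q mod 8 - 1) + 8 * (if q mod 8 = 1 then min 7 (Suc (q div 8)) else q div 8)
     else q)"

text \<open>\<open>next_ctx\<close> is \<open>advance\<close> on the code \<open>d + 8 * s\<close>;
  the numbers 3 and 4 are the codes of the two brackets.\<close>

lemma next_ctx:
  assumes "i < length w"
  shows "next_ctx (ctx_code w i) (symbol_code (w ! i)) = ctx_code w (Suc i)"
proof -
  obtain d s where ds: "ctx w i = (d, s)" "d < 8" "s < 8"
    using ctx_less[of w i] by (cases "ctx w i") auto
  have "ctx w (Suc i) = advance (d, s) (w ! i)"
    using assms ds by (simp add: ctx_def take_Suc_conv_app_nth)
  then show ?thesis using ds
    by (cases "w ! i") (auto simp: next_ctx_def ctx_code_def)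
qed

lemma ctx_code_less: "ctx_code w i < 64"
  using ctx_less[of w i] by (auto simp: ctx_code_def)

definition ptr_act :: "nat \<Rightarrow> move \<Rightarrow> tp com" where
  "ptr_act K m = Act (\<lambda>g u. (g u, if u \<in> tapes K \<and> (\<exists>k i. u = Ptr k i) then m else Stay))"

text \<open>Reduction modulo 320 makes the action respect the alphabet for arbitrary scanned
  symbols, as \<open>ok_act\<close> demands.\<close>

definition scan_step :: "nat \<Rightarrow> (tp \<Rightarrow> nat) \<Rightarrow> tp \<Rightarrow> nat \<times> move" where
  "scan_step K g u = (if u \<notin> tapes K then (g u, Stay) else
     (case u of Inp \<Rightarrow> (g u, MoveRight)
      | Aut \<Rightarrow> (next_ctx (g Aut) (g Inp) mod 320, Stay)
      | Ptr k i \<Rightarrow> ((g Inp + 5 * g Aut) mod 320, MoveRight)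
      | _ \<Rightarrow> (g u, Stay)))"

text \<open>While the input is read, the automaton state on \<open>Aut\<close> is combined with the
  current letter and the label is written to all pointer tapes at once. The pointers then return in
  lockstep, so the test of \<open>Ptr 0 0\<close> serves for all of them. The first two actions put
  the end marker on every array.\<close>

definition init_com :: "nat \<Rightarrow> tp com" where
  "init_com K =
     Seq (Act (\<lambda>g u. (g u, if u \<in> tapes K \<and> (\<exists>a. u = Arr a) then MoveLeft else Stay)))
    (Seq (Act (\<lambda>g u. if u \<in> tapes K \<and> (\<exists>a. u = Arr a) then (2, MoveRight) else (g u, Stay)))
    (Seq (Loop (\<lambda>g. g Inp \<noteq> 0) (Act (scan_step K)))
    (Seq (ptr_act K MoveLeft)
    (Seq (Loop (\<lambda>g. g (Ptr 0 0) \<noteq> 0) (ptr_act K MoveLeft))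
    (ptr_act K MoveRight)))))"

lemma ok_init_com: "ok K (init_com K)"
  by (auto simp: init_com_def ptr_act_def scan_step_def ok_act_def split: tp.splits)

definition init_store :: "nat \<Rightarrow> input_word \<Rightarrow> nat \<Rightarrow> tp store" where
  "init_store K w m = (\<lambda>t. if t \<notin> tapes K then (0, \<lambda>_. 0) else
     (case t of
        Inp \<Rightarrow> (int m, snd (input_tape w))
      | Aut \<Rightarrow> (0, (\<lambda>_. 0)(0 := ctx_code w m))
      | Ptr k i \<Rightarrow> (int m, \<lambda>z. if z < int m then content w z else 0)
      | Flag i \<Rightarrow> (0, \<lambda>_. 0)
      | Arr a \<Rightarrow> (0, \<lambda>z. if z = -1 then 2 else 0)))"

lemma le_init_com:
  assumes "0 < K"
  shows "exec_le (init_com K) (start_store Inp w) (6 * length w + 20)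
    (st K w (vpos (\<lambda>_. 0) (\<lambda>_. 0)) (\<lambda>_. False) (\<lambda>_ _. False))"
proof -
  define N where "N = length w"
  define s1 :: "tp store" where "s1 = (\<lambda>u. if u \<in> tapes K \<and> (\<exists>a. u = Arr a) then (-1, \<lambda>_. 0) else start_store Inp w u)"
  define pp :: "int \<Rightarrow> tp \<Rightarrow> int" where "pp x = (\<lambda>t. case t of Ptr _ _ \<Rightarrow> x | _ \<Rightarrow> 0)" for x
  define S where "S x = st K w (pp x) (\<lambda>_. False) (\<lambda>_ _. False)" for x
  have idle: "act (snd x (fst x), Stay) x = x" for x
    by (cases x) simp
  have 1: "exec_le (Act (\<lambda>g u. (g u, if u \<in> tapes K \<and> (\<exists>a. u = Arr a) then MoveLeft else Stay))) (start_store Inp w) 1 s1"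
    by (rule le_Act) (auto simp: s1_def start_store_def scan_def fun_eq_iff idle)
  have 2: "exec_le (Act (\<lambda>g u. if u \<in> tapes K \<and> (\<exists>a. u = Arr a) then (2, MoveRight) else (g u, Stay))) s1 1 (init_store K w 0)"
  proof (rule le_Act)
    show "init_store K w 0 = (\<lambda>t. act (if t \<in> tapes K \<and> (\<exists>a. t = Arr a) then (2, MoveRight) else (scan s1 t, Stay)) (s1 t))"
    proof
      fix t
      have "init_store K w 0 t = s1 t" if "\<not> (t \<in> tapes K \<and> (\<exists>a. t = Arr a))"
        using that
        by (cases t) (auto simp: s1_def start_store_def init_store_def ctx_code_def ctx_def fun_eq_iff
          content_def input_tape_def)
      then show "init_store K w 0 t = act (if t \<in> tapes K \<and> (\<exists>a. t = Arr a) then (2, MoveRight) else (scan s1 t, Stay)) (s1 t)"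
        using act_idle[of s1 t]
        by (cases "t \<in> tapes K \<and> (\<exists>a. t = Arr a)") (auto simp: s1_def init_store_def fun_eq_iff)
    qed
  qed simp
  have inp: "snd (input_tape w) (int m) = (if m < length w then symbol_code (w ! m) else 0)" for m
    by (simp add: input_tape_def)
  have code: "symbol_code a \<noteq> 0" "symbol_code a < 5" for a by (cases a; simp)+
  have 3: "exec_le (Loop (\<lambda>g. g Inp \<noteq> 0) (Act (scan_step K))) (init_store K w 0) (N * Suc 1 + 1) (init_store K w N)"
  proof (rule le_Loop)
    fix m assume m: "m < N"
    have gI: "scan (init_store K w m) Inp = symbol_code (w ! m)"
      using m by (simp add: scan_def init_store_def inp N_def)
    have gA: "scan (init_store K w m) Aut = ctx_code w m"
      by (simp add: scan_def init_store_def)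
    have l: "(symbol_code (w ! m) + 5 * ctx_code w m) mod 320 = lab w m"
      using m lab_less[of w m] by (simp add: lab_def label_def ctx_code_def N_def)
    have c: "next_ctx (ctx_code w m) (symbol_code (w ! m)) mod 320 = ctx_code w (Suc m)"
      using m ctx_code_less[of w "Suc m"] by (simp add: next_ctx N_def)
    have "act (scan_step K (scan (init_store K w m)) t) (init_store K w m t) = init_store K w (Suc m) t" for t
    proof (cases "t \<in> tapes K")
      case True
      show ?thesis
      proof (cases t)
        case Inp
        then have "scan_step K (scan (init_store K w m)) t = (symbol_code (w ! m), MoveRight)"
          by (simp add: scan_step_def gI)
        moreover have "(snd (input_tape w))(int m := symbol_code (w ! m)) = snd (input_tape w)"
          using m by (simp add: fun_eq_iff inp N_def)
        ultimately show ?thesis using Inp by (simp add: init_store_def del: fun_upd_apply)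
      next
        case Aut
        then have "scan_step K (scan (init_store K w m)) t = (ctx_code w (Suc m), Stay)"
          by (simp add: scan_step_def gI gA c)
        then show ?thesis using Aut by (simp add: init_store_def)
      next
        case (Ptr k i)
        have "content w z = lab w m" if "z < 1 + int m" "\<not> z < int m" for z
        proof -
          have "z = int m" using that by linarith
          then show ?thesis by simp
        qed
        moreover have "scan_step K (scan (init_store K w m)) t = (lab w m, MoveRight)"
          using True Ptr by (simp add: scan_step_def gI gA l)
        ultimately show ?thesis
          using True Ptr by (auto simp: init_store_def fun_eq_iff)
      next
        case (Flag i)
        then have "scan_step K (scan (init_store K w m)) t = (0, Stay)"
          using True by (simp add: scan_step_def scan_def init_store_def)
        then show ?thesis using True Flag by (simp add: init_store_def fun_eq_iff)
      next
        case (Arr a)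
        then have "scan_step K (scan (init_store K w m)) t = (0, Stay)"
          using True by (simp add: scan_step_def scan_def init_store_def)
        then show ?thesis using True Arr by (simp add: init_store_def fun_eq_iff)
      qed
    next
      case False
      then have "scan_step K (scan (init_store K w m)) t = (0, Stay)"
        by (simp add: scan_step_def scan_def init_store_def)
      then show ?thesis using False by (simp add: init_store_def fun_eq_iff)
    qed
    then have "init_store K w (Suc m) = (\<lambda>t. act (scan_step K (scan (init_store K w m)) t) (init_store K w m t))"
      by (simp add: fun_eq_iff)
    then have "exec_le (Act (scan_step K)) (init_store K w m) 1 (init_store K w (Suc m))"
      by (intro le_Act) auto
    then show "scan (init_store K w m) Inp \<noteq> 0 \<and> exec_le (Act (scan_step K)) (init_store K w m) 1 (init_store K w (Suc m))"
      using code by (simp add: gI)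
  next
    show "\<not> scan (init_store K w N) Inp \<noteq> 0"
      by (simp add: scan_def init_store_def inp N_def)
  qed
  have cN: "(if z < int N then content w z else 0) = content w z" for z
    using content_eq_0_iff[of w z] by (auto simp: N_def)
  have S0: "init_store K w N = S (int N)"
    by (auto simp: init_store_def S_def st_def pp_def content_eq_0_iff N_def fun_eq_iff split: tp.splits)
  have mvp: "exec_le (ptr_act K m) (S x) 1 (S (x + shift m))" for m x
    unfolding ptr_act_def
    by (rule le_Act) (auto simp: S_def st_def pp_def scan_def fun_eq_iff split: tp.splits)
  have 4: "exec_le (ptr_act K MoveLeft) (S (int N)) 1 (S (int N - 1 - int 0))"
    using mvp[of MoveLeft "int N"] by simp
  have 5: "exec_le (Loop (\<lambda>g. g (Ptr 0 0) \<noteq> 0) (ptr_act K MoveLeft)) (S (int N - 1 - int 0)) (N * Suc 1 + 1) (S (int N - 1 - int N))"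
  proof (rule le_Loop[where S = "\<lambda>m. S (int N - 1 - int m)"])
    fix m assume m: "m < N"
    have "scan (S (int N - 1 - int m)) (Ptr 0 0) \<noteq> 0"
      using assms m by (simp add: S_def scan_st content_eq_0_iff pp_def N_def)
    moreover have "exec_le (ptr_act K MoveLeft) (S (int N - 1 - int m)) 1 (S (int N - 1 - int (Suc m)))"
      using mvp[of MoveLeft "int N - 1 - int m"] by (simp add: algebra_simps)
    ultimately show "scan (S (int N - 1 - int m)) (Ptr 0 0) \<noteq> 0 \<and>
      exec_le (ptr_act K MoveLeft) (S (int N - 1 - int m)) 1 (S (int N - 1 - int (Suc m)))" by simp
  next
    show "\<not> scan (S (int N - 1 - int N)) (Ptr 0 0) \<noteq> 0"
      using assms by (simp add: S_def scan_st content_eq_0_iff pp_def)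
  qed
  have 6: "exec_le (ptr_act K MoveRight) (S (int N - 1 - int N)) 1 (S 0)"
    using mvp[of MoveRight "-1"] by simp
  have "S 0 = st K w (vpos (\<lambda>_. 0) (\<lambda>_. 0)) (\<lambda>_. False) (\<lambda>_ _. False)"
    unfolding S_def
    by (intro arg_cong[of _ _ "\<lambda>p. st K w p (\<lambda>_. False) (\<lambda>_ _. False)"]) (auto simp: pp_def vpos_def fun_eq_iff split: tp.splits)
  with 6 have 6: "exec_le (ptr_act K MoveRight) (S (int N - 1 - int N)) 1
    (st K w (vpos (\<lambda>_. 0) (\<lambda>_. 0)) (\<lambda>_. False) (\<lambda>_ _. False))" by simp
  show ?thesis
    unfolding init_com_def
    by (rule le_Seq[OF 1 le_Seq[OF 2 le_Seq[OF 3[unfolded S0] le_Seq[OF 4 le_Seq[OF 5 6 le_refl] le_refl] le_refl] le_refl]])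
      (simp add: N_def)
qed

text \<open>The interface to the rest: Turing machines disappear, and what remains is a loop program
  and a formula whose truth value on each encoding is membership.\<close>

theorem prog_polytime_decidable:
  assumes "\<And>x w. x \<in> I \<Longrightarrow> w \<in> enc x \<Longrightarrow>
    ev w (sem w 0 (\<lambda>_. 0) p (\<lambda>_ _. False)) 0 (\<lambda>_. 0) \<phi> \<longleftrightarrow> x \<in> Y"
  shows "polytime_decidable enc (I, Y)"
proof -
  have "\<forall>\<^sub>F K in sequentially. bounded_prog K 0 0 p \<and> bounded_fm K 0 0 \<phi> \<and> 0 < K"
    by (intro eventually_conj bounded_prog bounded_fm eventually_gt_at_top)
  then obtain K where K: "bounded_prog K 0 0 p" "bounded_fm K 0 0 \<phi>" "0 < K"
    using eventually_happens'[OF sequentially_bot] by blast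
  obtain b1 :: "nat poly" where b1: "\<And>K w cs xs ar. bounded_prog K 0 0 p \<Longrightarrow> 0 < K \<Longrightarrow> (\<forall>i. xs i \<le> length w) \<Longrightarrow>
     (\<forall>i\<ge>0. xs i = 0) \<Longrightarrow> (\<forall>i\<ge>0. cs i = 0) \<Longrightarrow>
     exec_le (comp_prog 0 0 p) (st K w (vpos cs xs) (\<lambda>_. False) ar) (poly b1 (length w))
       (st K w (vpos cs xs) (\<lambda>_. False) (sem w 0 xs p ar))"
    using le_comp_prog[of 0 0 p] by blast
  obtain b2 :: "nat poly" where b2: "\<And>K w cs xs fl ar. bounded_fm K 0 0 \<phi> \<Longrightarrow> (\<forall>i. xs i \<le> length w) \<Longrightarrow>
     (\<forall>i\<ge>0. xs i = 0) \<Longrightarrow> (\<forall>i\<ge>0. \<not> fl i) \<Longrightarrow>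
     exec_le (comp_fm 0 0 \<phi>) (st K w (vpos cs xs) fl ar) (poly b2 (length w))
       (st K w (vpos cs xs) (fl(0 := ev w ar 0 xs \<phi>)) ar)"
    using le_comp_fm[of 0 0 \<phi>] by blast
  have "finite (tapes K)"
  proof -
    have "{Ptr k i | k i. k < 4 \<and> i < K} \<subseteq> (\<lambda>(k, i). Ptr k i) ` ({..<4} \<times> {..<K})" by auto
    then have "finite {Ptr k i | k i. k < 4 \<and> i < K}" by (rule finite_subset) auto
    then show ?thesis by (simp add: tapes_def)
  qed
  then obtain ts' where ts': "set ts' = tapes K - {Inp}" "distinct ts'"
    using finite_distinct_list[of "tapes K - {Inp}"] by blast
  define ts where "ts = Inp # ts'"
  have set_ts: "set ts = tapes K" unfolding ts_def list.set ts'(1) by (rule insert_Diff) simp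
  let ?c = "Seq (init_com K) (Seq (comp_prog 0 0 p) (comp_fm 0 0 \<phi>))"
  show ?thesis
  \<comment> \<open>\<open>[:22, 6:]\<close> is the bound of \<open>le_init_com\<close> plus one
    step for each \<open>Seq\<close>.\<close>
  proof (rule com_polytime_decidable[of 320 ts ?c Inp ts' "Flag 0" I enc "[:22, 6:] + b1 + b2" Y])
    show "ok_com 320 (set ts) ?c"
      using K by (simp add: set_ts ok_init_com ok_comp_prog ok_comp_fm)
    show "Flag 0 \<in> set ts" using K by (simp add: set_ts)
    fix x w assume xw: "x \<in> I" "w \<in> enc x"
    let ?ar = "sem w 0 (\<lambda>_. 0) p (\<lambda>_ _. False)"
    let ?s = "st K w (vpos (\<lambda>_. 0) (\<lambda>_. 0)) ((\<lambda>_. False)(0 := ev w ?ar 0 (\<lambda>_. 0) \<phi>)) ?ar"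
    have "exec_le ?c (start_store Inp w) (poly ([:22, 6:] + b1 + b2) (length w)) ?s"
      by (rule le_Seq[OF le_init_com le_Seq[OF b1 b2 le_refl]]) (use K in auto)
    moreover have "scan ?s (Flag 0) = 1 \<longleftrightarrow> x \<in> Y"
      using assms[OF xw] K by (simp add: scan_st)
    ultimately show "\<exists>n s'. exec ?c (start_store Inp w) n s' \<and> n \<le> poly ([:22, 6:] + b1 + b2) (length w) \<and>
        (scan s' (Flag 0) = 1 \<longleftrightarrow> x \<in> Y)"
      unfolding exec_le_def by blast
  qed (use ts' in \<open>simp_all add: ts_def\<close>)
qed

section \<open>The cover game\<close>

text \<open>A set of total assignments in which a universal variable can be given any value without
  changing the variables that it comes after: the possible outcomes of a strategy.\<close>

definition responsive :: "'b set \<Rightarrow> 'a quant_prefix \<Rightarrow> ('a \<Rightarrow> 'a \<Rightarrow> bool) \<Rightarrow> ('a \<Rightarrow> 'b) set \<Rightarrow> bool" where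
  "responsive U p bef P \<longleftrightarrow> (\<forall>f\<in>P. \<forall>v b. (Forall, v) \<in> set p \<longrightarrow> b \<in> U \<longrightarrow>
     (\<exists>g\<in>P. g v = b \<and> (\<forall>u. u \<noteq> v \<longrightarrow> bef u v \<longrightarrow> g u = f u)))"

text \<open>A form of \<open>comes_after\<close> for universal \<open>v\<close> that follows the
  recursion of \<open>sat\<close>: \<open>u\<close> stands before \<open>v\<close>, or behind it
  with only universal quantifiers from \<open>v\<close> up to \<open>u\<close>.\<close>

fun sees :: "'a quant_prefix \<Rightarrow> 'a \<Rightarrow> 'a \<Rightarrow> bool" where
  "sees [] u v = False"
| "sees ((q, x) # p) u v = (if x = v then u \<in> snd ` set (takeWhile (\<lambda>y. fst y = Forall) p)
     else u = x \<or> sees p u v)"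

text \<open>The last conjunct is what makes the induction work: the variables of the leading
  universal block can be given arbitrary values simultaneously. When the value of the first of them
  is changed, one needs a play of the subgame for the new value that retains the values of the
  others in the block. Variables outside the remaining prefix count as seen, as they are fixed
  already.\<close>

lemma sat_imp_plays:
  assumes "sat U p \<phi> f" "distinct (map snd p)" "U \<noteq> {} \<or> p = []"
  shows "\<exists>P. P \<noteq> {} \<and> responsive U p (\<lambda>u v. u \<notin> snd ` set p \<or> sees p u v) P \<and>
    (\<forall>g\<in>P. \<phi> g \<and> (\<forall>u. u \<notin> snd ` set p \<longrightarrow> g u = f u) \<and> g ` snd ` set p \<subseteq> U) \<and>
    (\<forall>h. (\<forall>u. h u \<in> U) \<longrightarrow> (\<exists>g\<in>P. \<forall>u\<in>snd ` set (takeWhile (\<lambda>y. fst y = Forall) p). g u = h u))"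
  using assms
proof (induction p arbitrary: f)
  case Nil
  then show ?case by (auto intro!: exI[of _ "{f}"] simp: responsive_def)
next
  case (Cons qx p)
  obtain q x where qx: "qx = (q, x)" by fastforce
  let ?W = "\<lambda>p. snd ` set (takeWhile (\<lambda>y. fst y = Forall) p)"
  have W: "?W p \<subseteq> snd ` set p" by (auto dest: set_takeWhileD)
  have x: "x \<notin> snd ` set p" "distinct (map snd p)" "U \<noteq> {}" using Cons.prems qx by auto
  let ?good = "\<lambda>b P. P \<noteq> {} \<and> responsive U p (\<lambda>u v. u \<notin> snd ` set p \<or> sees p u v) P \<and>
    (\<forall>g\<in>P. \<phi> g \<and> (\<forall>u. u \<notin> snd ` set p \<longrightarrow> g u = (f(x := b)) u) \<and> g ` snd ` set p \<subseteq> U) \<and>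
    (\<forall>h. (\<forall>u. h u \<in> U) \<longrightarrow> (\<exists>g\<in>P. \<forall>u\<in>?W p. g u = h u))"
  show ?case
  proof (cases q)
    case Exists
    then obtain b where b: "b \<in> U" "sat U p \<phi> (f(x := b))" using Cons.prems qx by auto
    from Cons.IH[OF b(2)] x obtain P where P: "?good b P" by auto
    have "responsive U (qx # p) (\<lambda>u v. u \<notin> snd ` set (qx # p) \<or> sees (qx # p) u v) P"
      unfolding responsive_def
    proof (intro ballI allI impI)
      fix g v c assume g: "g \<in> P" and v: "(Forall, v) \<in> set (qx # p)" and c: "c \<in> U"
      have v': "(Forall, v) \<in> set p" "v \<noteq> x" using v x qx Exists by (auto simp: image_iff)
      then obtain g' where g': "g' \<in> P" "g' v = c" "\<forall>u. u \<noteq> v \<longrightarrow> u \<notin> snd ` set p \<or> sees p u v \<longrightarrow> g' u = g u"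
        using P g c unfolding responsive_def by blast
      have "\<forall>u. u \<noteq> v \<longrightarrow> u \<notin> snd ` set (qx # p) \<or> sees (qx # p) u v \<longrightarrow> g' u = g u"
        using g'(3) v' x qx by auto
      with g' show "\<exists>g'\<in>P. g' v = c \<and> (\<forall>u. u \<noteq> v \<longrightarrow> u \<notin> snd ` set (qx # p) \<or> sees (qx # p) u v \<longrightarrow> g' u = g u)"
        by blast
    qed
    then show ?thesis using P b x qx Exists by (intro exI[of _ P]) (auto; fail)
  next
    case Forall
    define good where "good b P \<longleftrightarrow> ?good b P" for b P
    have "\<exists>P. good b P" if "b \<in> U" for b
    proof -
      have "sat U p \<phi> (f(x := b))" using Cons.prems qx Forall that by auto
      from Cons.IH[OF this] x show ?thesis unfolding good_def by auto
    qed
    then obtain P where "\<And>b. b \<in> U \<Longrightarrow> good b (P b)" by metis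
    then have P: "\<And>b. b \<in> U \<Longrightarrow> ?good b (P b)" unfolding good_def .
    have P_ne: "P b \<noteq> {}" if "b \<in> U" for b
      using P[OF that] by (elim conjE)
    have P_resp: "responsive U p (\<lambda>u v. u \<notin> snd ` set p \<or> sees p u v) (P b)" if "b \<in> U" for b
      using P[OF that] by (elim conjE)
    have P_top: "\<forall>h. (\<forall>u. h u \<in> U) \<longrightarrow> (\<exists>g\<in>P b. \<forall>u\<in>?W p. g u = h u)" if "b \<in> U" for b
      using P[OF that] by (elim conjE)
    have P_all: "\<phi> g \<and> (\<forall>u. u \<notin> snd ` set p \<longrightarrow> g u = (f(x := b)) u) \<and> g ` snd ` set p \<subseteq> U"
      if "b \<in> U" "g \<in> P b" for b g
      using P[OF that(1)] that(2) by (elim conjE) (erule(1) bspec)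
    have P_mem: "\<phi> g" "u \<notin> snd ` set p \<Longrightarrow> g u = (f(x := b)) u" "g ` snd ` set p \<subseteq> U"
      if "b \<in> U" "g \<in> P b" for b g u using P_all[OF that] by simp_all
    let ?P = "\<Union>b\<in>U. P b"
    have Px: "g x = b" if "g \<in> P b" "b \<in> U" for g b
      using P_mem(2)[OF that(2,1) x(1)] by simp
    \<comment> \<open>The last conjunct asks for total functions into \<open>U\<close>; the play
      \<open>g\<close> may leave \<open>U\<close> outside the prefix, so its values are replaced
      there.\<close>
    have in_U: "\<exists>h. (\<forall>u. h u \<in> U) \<and> (\<forall>u\<in>A. g u \<in> U \<longrightarrow> h u = g u)" for g A
      using x(3) by (intro exI[of _ "\<lambda>u. if g u \<in> U then g u else SOME z. z \<in> U"]) (auto intro: someI_ex)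
    have R1: "responsive U (qx # p) (\<lambda>u v. u \<notin> snd ` set (qx # p) \<or> sees (qx # p) u v) ?P"
      unfolding responsive_def
    proof (intro ballI allI impI)
      fix g v c assume g: "g \<in> ?P" and v: "(Forall, v) \<in> set (qx # p)" and c: "c \<in> U"
      then obtain b where b: "b \<in> U" "g \<in> P b" by auto
      show "\<exists>g'\<in>?P. g' v = c \<and> (\<forall>u. u \<noteq> v \<longrightarrow> u \<notin> snd ` set (qx # p) \<or> sees (qx # p) u v \<longrightarrow> g' u = g u)"
      proof (cases "v = x")
        case True
        obtain h where h: "\<forall>u. h u \<in> U" "\<forall>u\<in>?W p. g u \<in> U \<longrightarrow> h u = g u" using in_U[of "?W p" g] by blast
        then obtain g' where g': "g' \<in> P c" "\<forall>u\<in>?W p. g' u = h u" using P_top[OF c] by blast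
        have "g' u = g u" if u: "u \<noteq> v" "u \<notin> snd ` set (qx # p) \<or> sees (qx # p) u v" for u
        proof (cases "u \<in> ?W p")
          case True
          then have "g u \<in> U" using P_mem(3)[OF b] W by blast
          then have "h u = g u" using h(2) True by blast
          moreover have "g' u = h u" using g'(2) True by blast
          ultimately show ?thesis by simp
        next
          case False
          then have "u \<notin> snd ` set p" using u True qx by auto
          then show ?thesis using P_mem(2)[OF b, of u] P_mem(2)[OF c g'(1), of u] u True by simp
        qed
        with g' c True Px[OF g'(1) c] show ?thesis by blast
      next
        case False
        then have v': "(Forall, v) \<in> set p" using v qx by auto
        then obtain g' where g': "g' \<in> P b" "g' v = c" "\<forall>u. u \<noteq> v \<longrightarrow> u \<notin> snd ` set p \<or> sees p u v \<longrightarrow> g' u = g u"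
          using P_resp[OF b(1)] b(2) c unfolding responsive_def by blast
        have "\<forall>u. u \<noteq> v \<longrightarrow> u \<notin> snd ` set (qx # p) \<or> sees (qx # p) u v \<longrightarrow> g' u = g u"
          using g'(3) False x qx by auto
        with g' b show ?thesis by blast
      qed
    qed
    have R2: "\<exists>g\<in>?P. \<forall>u\<in>?W (qx # p). g u = h u" if h: "\<forall>u. h u \<in> U" for h
    proof -
      obtain g where "g \<in> P (h x)" "\<forall>u\<in>?W p. g u = h u" using P_top[of "h x"] h by blast
      moreover have "g x = h x" using Px[OF \<open>g \<in> P (h x)\<close>] h by auto
      ultimately show ?thesis using h qx Forall by auto
    qed
    have R3: "?P \<noteq> {}" using P_ne x(3) by blast
    have R4: "\<phi> g \<and> (\<forall>u. u \<notin> snd ` set (qx # p) \<longrightarrow> g u = f u) \<and> g ` snd ` set (qx # p) \<subseteq> U" if "g \<in> ?P" for g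
    proof -
      from that obtain b where b: "b \<in> U" "g \<in> P b" by auto
      show ?thesis using P_mem[OF b] b Px[OF b(2,1)] qx by auto
    qed
    show ?thesis
    proof (rule exI[of _ ?P], rule conjI[OF R3], rule conjI[OF R1], rule conjI)
      show "\<forall>g\<in>?P. \<phi> g \<and> (\<forall>u. u \<notin> snd ` set (qx # p) \<longrightarrow> g u = f u) \<and> g ` snd ` set (qx # p) \<subseteq> U"
        by (intro ballI R4)
      show "\<forall>h. (\<forall>u. h u \<in> U) \<longrightarrow> (\<exists>g\<in>?P. \<forall>u\<in>?W (qx # p). g u = h u)"
        by (intro allI impI R2) (erule spec)
    qed
  qed
qed

section \<open>Blocks of the prefix\<close>

lemma block_mono: "i \<le> j \<Longrightarrow> block p i \<le> block p j"
  unfolding block_def by (rule card_mono) auto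

lemma block_eq_iff:
  assumes "i \<le> j"
  shows "block p j \<le> block p i \<longleftrightarrow> (\<forall>m. i \<le> m \<and> m \<le> j \<longrightarrow> fst (p ! m) = fst (p ! i))"
proof
  assume le: "block p j \<le> block p i"
  let ?A = "\<lambda>i. {m. m < i \<and> fst (p ! m) \<noteq> fst (p ! Suc m)}"
  have A: "?A i = ?A j"
    using le assms by (intro card_seteq) (auto simp: block_def)
  have eq: "fst (p ! m) = fst (p ! Suc m)" if "i \<le> m" "m < j" for m
  proof (rule ccontr)
    assume "fst (p ! m) \<noteq> fst (p ! Suc m)"
    then have "m \<in> ?A j" using that by simp
    then have "m \<in> ?A i" by (simp only: A)
    then show False using that by simp
  qed
  have "fst (p ! m) = fst (p ! i)" if "i \<le> m" "m \<le> j" for m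
    using that by (induction m rule: dec_induct) (use eq in auto)
  then show "\<forall>m. i \<le> m \<and> m \<le> j \<longrightarrow> fst (p ! m) = fst (p ! i)" by blast
next
  assume eq: "\<forall>m. i \<le> m \<and> m \<le> j \<longrightarrow> fst (p ! m) = fst (p ! i)"
  have "{m. m < j \<and> fst (p ! m) \<noteq> fst (p ! Suc m)} = {m. m < i \<and> fst (p ! m) \<noteq> fst (p ! Suc m)}"
  proof -
    have "m < i" if "m < j" "fst (p ! m) \<noteq> fst (p ! Suc m)" for m
      using eq[rule_format, of m] eq[rule_format, of "Suc m"] that by (cases "m < i") auto
    then show ?thesis using assms by auto
  qed
  then show "block p j \<le> block p i" by (simp add: block_def)
qed

lemma comes_after_iff:
  assumes "distinct (map snd p)" "i < length p" "j < length p"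
  shows "comes_after p (snd (p ! j)) (snd (p ! i)) \<longleftrightarrow>
    i \<le> j \<or> (\<forall>m. j \<le> m \<and> m \<le> i \<longrightarrow> fst (p ! m) = fst (p ! j))"
proof -
  have "i' = i" if "i' < length p" "snd (p ! i') = snd (p ! i)" for i'
    using assms that nth_eq_iff_index_eq[of "map snd p" i' i] by auto
  moreover have "j' = j" if "j' < length p" "snd (p ! j') = snd (p ! j)" for j'
    using assms that nth_eq_iff_index_eq[of "map snd p" j' j] by auto
  ultimately have "comes_after p (snd (p ! j)) (snd (p ! i)) \<longleftrightarrow> block p i \<le> block p j"
    unfolding comes_after_def using assms by metis
  then show ?thesis
    using block_mono[of i j p] block_eq_iff[of j i p] nat_le_linear[of i j] by blast
qed

lemma sees_if_comes_after:
  assumes "distinct (map snd p)" "comes_after p v u" "(Forall, v) \<in> set p" "u \<noteq> v"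
  shows "sees p u v"
proof -
  obtain i j where ij: "i < length p" "j < length p" "snd (p ! i) = u" "snd (p ! j) = v"
    using assms(2) unfolding comes_after_def by blast
  obtain j' where j': "j' < length p" "p ! j' = (Forall, v)" using assms(3) by (auto simp: in_set_conv_nth)
  have "j' = j" using assms(1) ij j' nth_eq_iff_index_eq[of "map snd p" j' j] by auto
  then have pj: "p ! j = (Forall, v)" using j' by simp
  have "i \<le> j \<or> (\<forall>m. j \<le> m \<and> m \<le> i \<longrightarrow> fst (p ! m) = Forall)"
    using comes_after_iff[OF assms(1) ij(1,2)] assms(2) ij pj by simp
  moreover have "i \<noteq> j" using ij assms(4) by auto
  ultimately have "i < j \<or> j < i \<and> (\<forall>m. j \<le> m \<and> m \<le> i \<longrightarrow> fst (p ! m) = Forall)" by auto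
  then show ?thesis using assms(1) ij(1-3) pj
  proof (induction p arbitrary: i j)
    case (Cons qx p)
    obtain q x where qx: "qx = (q, x)" by fastforce
    show ?case
    proof (cases j)
      case 0
      then have xv: "x = v" using Cons.prems qx by simp
      from Cons.prems 0 obtain i' where i: "i = Suc i'" "i' < length p" "snd (p ! i') = u"
        by (cases i) auto
      have "fst (p ! m) = Forall" if "m \<le> i'" for m
        using Cons.prems(1) 0 i that by (auto dest: spec[of _ "Suc m"])
      then have "i' < length (takeWhile (\<lambda>y. fst y = Forall) p)"
        using i(2) by (intro length_takeWhile_less_P_nth[THEN less_le_trans[OF lessI]]) auto
      then have "p ! i' \<in> set (takeWhile (\<lambda>y. fst y = Forall) p)"
        by (metis nth_mem takeWhile_nth)
      then show ?thesis using xv qx i(3) by force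
    next
      case (Suc j')
      show ?thesis
      proof (cases i)
        case 0
        have "j' < length p" "p ! j' = (Forall, v)" using Cons.prems Suc by auto
        then have "(Forall, v) \<in> set p" by (metis nth_mem)
        with Cons.prems 0 Suc show ?thesis using qx by (force simp: image_iff)
      next
        case (Suc i')
        have j': "j' < length p" "p ! j' = (Forall, v)" using Cons.prems \<open>j = Suc j'\<close> by auto
        then have "x \<noteq> v" using Cons.prems(2) qx by (metis distinct.simps(2) image_eqI list.set_map list.simps(9) nth_mem snd_conv)
        moreover have "(Forall, v) \<in> set p" using j' nth_mem by metis
        ultimately have "x \<noteq> v" "(Forall, v) \<in> set p" by auto
        moreover have "sees p u v"
        proof (rule Cons.IH)
          show "i' < j' \<or> j' < i' \<and> (\<forall>m. j' \<le> m \<and> m \<le> i' \<longrightarrow> fst (p ! m) = Forall)"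
            using Cons.prems(1) Suc \<open>j = Suc j'\<close> by (auto dest: spec[of _ "Suc _"])
        qed (use Cons.prems Suc \<open>j = Suc j'\<close> \<open>(Forall, v) \<in> set p\<close> in auto)
        ultimately show ?thesis using qx by simp
      qed
    qed
  qed simp
qed

text \<open>The strategy keeps a play in \<open>P\<close> that agrees with all values chosen so far.
  An existential variable takes its value in this play; at a universal one, the exchange property
  yields another play with the value of the opponent. A variable comes after all variables that
  precede it in the prefix, so the new play still agrees with the past.\<close>

lemma responsive_imp_sat:
  assumes P: "P \<noteq> {}" "responsive U p (\<lambda>u v. comes_after p v u) P" "\<And>f. f \<in> P \<Longrightarrow> f ` snd ` set p \<subseteq> U"
    and phi: "\<And>f g. f \<in> P \<Longrightarrow> (\<forall>u\<in>snd ` set p. g u = f u) \<Longrightarrow> \<phi> g"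
    and dist: "distinct (map snd p)"
  shows "sat U p \<phi> f0"
proof -
  have "p = p1 @ p2 \<Longrightarrow> f \<in> P \<Longrightarrow> (\<forall>u\<in>snd ` set p1. g u = f u) \<Longrightarrow> sat U p2 \<phi> g" for p1 p2 f g
  proof (induction p2 arbitrary: p1 f g)
    case Nil
    then show ?case using phi[of f g] by simp
  next
    case (Cons qx p2)
    obtain q x where qx: "qx = (q, x)" by fastforce
    have x: "x \<notin> snd ` set p1" using Cons.prems(1) dist qx by auto
    have IH: "sat U p2 \<phi> (g(x := f' x))" if "f' \<in> P" "\<forall>u\<in>snd ` set p1. g u = f' u" for f'
      by (rule Cons.IH[of "p1 @ [qx]" f']) (use Cons.prems that qx in auto)
    show ?case
    proof (cases q)
      case Exists
      have "f x \<in> U" using P(3)[OF Cons.prems(2)] Cons.prems(1) qx by auto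
      then show ?thesis using IH[of f] Cons.prems qx Exists by auto
    next
      case Forall
      have "sat U p2 \<phi> (g(x := b))" if b: "b \<in> U" for b
      proof -
        have "(Forall, x) \<in> set p" using Cons.prems(1) qx Forall by auto
        then obtain f' where f': "f' \<in> P" "f' x = b" "\<And>u. u \<noteq> x \<Longrightarrow> comes_after p x u \<Longrightarrow> f' u = f u"
          using P(2) Cons.prems(2) b unfolding responsive_def by blast
        have "f' u = f u" if "u \<in> snd ` set p1" for u
        proof -
          obtain i where i: "i < length p1" "snd (p1 ! i) = u" using \<open>u \<in> snd ` set p1\<close> by (auto simp: in_set_conv_nth)
          have "comes_after p x u"
            using comes_after_iff[OF dist, of i "length p1"] i Cons.prems(1) qx
            by (simp add: nth_append)
          moreover have "u \<noteq> x" using x that by auto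
          ultimately show ?thesis using f'(3) by blast
        qed
        then show ?thesis using IH[OF f'(1)] f'(2) Cons.prems(3) by simp
      qed
      then show ?thesis using qx Forall by simp
    qed
  qed
  from this[of "[]" p] show ?thesis using P(1) by auto
qed

section \<open>Scopes, candidates and bad positions\<close>

locale cover_game =
  fixes k :: nat and U :: "'b set" and p :: "'a quant_prefix"
    and TA :: "'i set" and ta :: "'i \<Rightarrow> 'a list" and TB :: "'i \<Rightarrow> 'j set" and tb :: "'j \<Rightarrow> 'b list"
  assumes k: "k \<ge> 1"
    and dist: "distinct (map snd p)"
    and ta_sub: "x \<in> TA \<Longrightarrow> set (ta x) \<subseteq> snd ` set p"
    and tb_len: "x \<in> TA \<Longrightarrow> y \<in> TB x \<Longrightarrow> length (tb y) = length (ta x)"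
    and tb_sub: "x \<in> TA \<Longrightarrow> y \<in> TB x \<Longrightarrow> set (tb y) \<subseteq> U"
begin

definition maps :: "'i \<Rightarrow> 'j \<Rightarrow> 'a \<Rightarrow> 'b \<Rightarrow> bool" where
  "maps x y a b \<longleftrightarrow> (\<exists>j<length (ta x). j < length (tb y) \<and> ta x ! j = a \<and> tb y ! j = b)"

text \<open>A relation and not yet a map: that it is single-valued is part of
  \<open>cand\<close>.\<close>

definition pairs :: "'i list \<Rightarrow> 'j list \<Rightarrow> 'a \<Rightarrow> 'b \<Rightarrow> bool" where
  "pairs xs ys a b \<longleftrightarrow> (\<exists>i<k. maps (xs ! i) (ys ! i) a b)"

definition agree :: "'a set \<Rightarrow> 'i list \<Rightarrow> 'j list \<Rightarrow> 'i list \<Rightarrow> 'j list \<Rightarrow> bool" where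
  "agree D xs ys xs' ys' \<longleftrightarrow>
     (\<forall>a b b'. a \<in> D \<longrightarrow> pairs xs ys a b \<longrightarrow> pairs xs' ys' a b' \<longrightarrow> b = b')"

lemma agreeD: "agree D xs ys xs' ys' \<Longrightarrow> a \<in> D \<Longrightarrow> pairs xs ys a b \<Longrightarrow> pairs xs' ys' a b' \<Longrightarrow> b' = b"
  unfolding agree_def by blast

text \<open>Tuples appear through names. In the application these are positions of the word, and a
  tuple that lies in several relations has several names. A scope may repeat names, so fewer than
  \<open>k\<close> hyperedges are covered as well.\<close>

definition scope :: "'i list \<Rightarrow> bool" where
  "scope xs \<longleftrightarrow> length xs = k \<and> set xs \<subseteq> TA"

definition cand :: "'i list \<Rightarrow> 'j list \<Rightarrow> bool" where
  "cand xs ys \<longleftrightarrow> length ys = k \<and> (\<forall>i<k. ys ! i \<in> TB (xs ! i)) \<and> agree UNIV xs ys xs ys"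

text \<open>The base cases are hidden in the premises: if no candidate meets the conditions, there
  is nothing to show and the position is bad at once. In \<open>univ\<close> the scope stays the
  same, and values may change only at \<open>v\<close> itself and at variables that \<open>v\<close>
  does not come after.\<close>

inductive bad :: "'i list \<Rightarrow> 'j list \<Rightarrow> bool" where
  forth: "scope xs' \<Longrightarrow>
    (\<And>ys'. cand xs' ys' \<Longrightarrow> agree UNIV xs ys xs' ys' \<Longrightarrow> bad xs' ys') \<Longrightarrow> bad xs ys"
| univ: "(Forall, v) \<in> set p \<Longrightarrow> b \<in> U \<Longrightarrow>
    (\<And>ys'. cand xs ys' \<Longrightarrow> (\<forall>b'. pairs xs ys' v b' \<longrightarrow> b' = b) \<Longrightarrow>
       agree {u. u \<noteq> v \<and> comes_after p v u} xs ys xs ys' \<Longrightarrow> bad xs ys') \<Longrightarrow> bad xs ys"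

definition sol :: "('a \<Rightarrow> 'b) \<Rightarrow> bool" where
  "sol f \<longleftrightarrow> (\<forall>x\<in>TA. \<exists>y\<in>TB x. map f (ta x) = tb y)"

lemma scope_nth: "scope xs \<Longrightarrow> i < k \<Longrightarrow> xs ! i \<in> TA"
  by (auto simp: scope_def)

lemma sol_imp_cand:
  assumes "sol f" "scope xs"
  shows "\<exists>ys. cand xs ys \<and> (\<forall>a b. pairs xs ys a b \<longrightarrow> b = f a)"
proof -
  obtain y where y: "\<And>x. x \<in> TA \<Longrightarrow> y x \<in> TB x \<and> map f (ta x) = tb (y x)"
    using assms(1) unfolding sol_def by metis
  have val: "b = f a" if "pairs xs (map y xs) a b" for a b
  proof -
    from that obtain i where i: "i < k" "maps (xs ! i) (map y xs ! i) a b"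
      by (auto simp: pairs_def)
    then have m: "maps (xs ! i) (y (xs ! i)) a b"
      using assms(2) by (simp add: scope_def)
    have "map f (ta (xs ! i)) = tb (y (xs ! i))"
      using y[OF scope_nth[OF assms(2) i(1)]] by simp
    then have "tb (y (xs ! i)) ! j = f (ta (xs ! i) ! j)" if "j < length (ta (xs ! i))" for j
      using that by (metis nth_map)
    with m show ?thesis by (auto simp: maps_def)
  qed
  have "map y xs ! i \<in> TB (xs ! i)" if "i < k" for i
    using y[OF scope_nth[OF assms(2) that]] assms(2) that by (simp add: scope_def)
  moreover have "agree UNIV xs (map y xs) xs (map y xs)"
    unfolding agree_def using val by metis
  ultimately have "cand xs (map y xs)"
    using assms(2) by (simp add: cand_def scope_def)
  with val show ?thesis by blast
qed

text \<open>Restrictions of plays are never bad, by induction on \<open>bad\<close>: against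
  \<open>forth\<close> the same play gives the answer on the new scope, against \<open>univ\<close>
  the play from the exchange property does. No scheme is involved.\<close>

lemma sat_imp_not_bad:
  assumes "sat U p sol f0" "U \<noteq> {} \<or> p = []" "scope xs"
  shows "\<exists>ys. cand xs ys \<and> \<not> bad xs ys"
proof -
  obtain P where P: "P \<noteq> {}" "responsive U p (\<lambda>u v. u \<notin> snd ` set p \<or> sees p u v) P" 
      "\<forall>g\<in>P. sol g \<and> (\<forall>u. u \<notin> snd ` set p \<longrightarrow> g u = f0 u) \<and> g ` snd ` set p \<subseteq> U"
    using sat_imp_plays[OF assms(1) dist assms(2)] by (elim exE conjE) (rule that)
  have P_sol: "sol g" if "g \<in> P" for g using P(3) that by blast
  have resp: "\<exists>g\<in>P. g v = b \<and> (\<forall>u. u \<noteq> v \<longrightarrow> comes_after p v u \<longrightarrow> g u = f u)"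
    if fv: "f \<in> P" "(Forall, v) \<in> set p" "b \<in> U" for f v b
  proof -
    obtain g where "g \<in> P" "g v = b" "\<forall>u. u \<noteq> v \<longrightarrow> u \<notin> snd ` set p \<or> sees p u v \<longrightarrow> g u = f u"
      using P(2)[unfolded responsive_def, rule_format, OF fv] by blast
    then show ?thesis using sees_if_comes_after[OF dist _ fv(2)] by blast
  qed
  have "False" if "bad xs ys" "f \<in> P" "\<forall>a b. pairs xs ys a b \<longrightarrow> b = f a" "scope xs" for xs ys f
    using that
  proof (induction arbitrary: f)
    case (forth xs' xs ys)
    obtain ys' where ys': "cand xs' ys'" "\<forall>a b. pairs xs' ys' a b \<longrightarrow> b = f a"
      using sol_imp_cand[OF P_sol[OF forth.prems(1)] forth.hyps(1)] by blast
    have "agree UNIV xs ys xs' ys'"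
      unfolding agree_def using ys'(2) forth.prems(2) by metis
    from forth.IH[OF ys'(1) this forth.prems(1) ys'(2) forth.hyps(1)] show ?case .
  next
    case (univ v b xs ys)
    obtain g where g: "g \<in> P" "g v = b" "\<forall>u. u \<noteq> v \<longrightarrow> comes_after p v u \<longrightarrow> g u = f u"
      using resp[OF univ.prems(1) univ.hyps(1,2)] by blast
    obtain ys' where ys': "cand xs ys'" "\<forall>a b. pairs xs ys' a b \<longrightarrow> b = g a"
      using sol_imp_cand[OF P_sol[OF g(1)] univ.prems(3)] by blast
    have "agree {u. u \<noteq> v \<and> comes_after p v u} xs ys xs ys'"
      unfolding agree_def
    proof (intro allI impI)
      fix a c c' assume a: "a \<in> {u. u \<noteq> v \<and> comes_after p v u}" "pairs xs ys a c" "pairs xs ys' a c'"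
      then have "c = f a" "c' = g a" using ys'(2) univ.prems(2) by blast+
      moreover have "g a = f a" using g(3) a(1) by blast
      ultimately show "c = c'" by simp
    qed
    moreover have "\<forall>b'. pairs xs ys' v b' \<longrightarrow> b' = b" using ys'(2) g(2) by metis
    ultimately show False using univ.IH[OF ys'(1) _ _ g(1) ys'(2) univ.prems(3)] by blast
  qed
  moreover obtain f where "f \<in> P" using P(1) by blast
  moreover obtain ys where "cand xs ys" "\<forall>a b. pairs xs ys a b \<longrightarrow> b = f a"
    using sol_imp_cand[OF P_sol[OF \<open>f \<in> P\<close>] assms(3)] by blast
  ultimately show ?thesis using assms(3) by blast
qed

definition cov :: "'i list \<Rightarrow> 'a set" where
  "cov xs = (\<Union>x\<in>set xs. set (ta x))"

lemma cov_pairs: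
  assumes "scope xs" "cand xs ys" "a \<in> cov xs"
  shows "\<exists>b\<in>U. pairs xs ys a b"
proof -
  obtain i j where ij: "i < k" "j < length (ta (xs ! i))" "a = ta (xs ! i) ! j"
    using assms by (fastforce simp: cov_def scope_def in_set_conv_nth)
  have x: "xs ! i \<in> TA" "ys ! i \<in> TB (xs ! i)" using assms ij by (auto simp: scope_nth cand_def)
  then have "j < length (tb (ys ! i))" using ij(2) tb_len by metis
  then have "tb (ys ! i) ! j \<in> U" using tb_sub[OF x] by auto
  moreover have "maps (xs ! i) (ys ! i) a (tb (ys ! i) ! j)"
    using ij \<open>j < length (tb (ys ! i))\<close> unfolding maps_def by blast
  then have "pairs xs ys a (tb (ys ! i) ! j)" using ij(1) unfolding pairs_def by blast
  ultimately show ?thesis by blast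
qed

lemma pairs_cov: "scope xs \<Longrightarrow> pairs xs ys a b \<Longrightarrow> a \<in> cov xs"
  unfolding cov_def scope_def pairs_def maps_def by (metis UN_I nth_mem)

section \<open>From positions that are not bad to a strategy along a scheme\<close>

context
  fixes F :: "'a set set" and vs :: "'a list"
  assumes vs: "distinct vs" "set vs = snd ` set p"
    and peo: "\<And>i j l. i < j \<Longrightarrow> j < l \<Longrightarrow> l < length vs \<Longrightarrow> {vs ! i, vs ! l} \<in> F \<Longrightarrow> {vs ! j, vs ! l} \<in> F \<Longrightarrow> {vs ! i, vs ! j} \<in> F"
    and order: "\<And>i j. i < j \<Longrightarrow> j < length vs \<Longrightarrow> comes_after p (vs ! j) (vs ! i)"
    and edges: "\<And>x. x \<in> TA \<Longrightarrow> is_clique (set vs) F (set (ta x))"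
    and cover: "\<And>C. is_clique (set vs) F C \<Longrightarrow> TA \<noteq> {} \<Longrightarrow>
      \<exists>xs. scope xs \<and> C \<inter> (\<Union>x\<in>TA. set (ta x)) \<subseteq> cov xs"
    and good: "\<And>xs. scope xs \<Longrightarrow> \<exists>ys. cand xs ys \<and> \<not> bad xs ys"
    and nonempty: "U \<noteq> {} \<or> p = []"
begin

text \<open>The invariant of the construction along \<open>vs\<close>. Correctness is required on
  each clique separately, but with respect to every scope, whether or not it covers the clique; the
  tuples of the structure can then be checked with a scope of one's choice.\<close>

definition consistent :: "'a set \<Rightarrow> ('a \<Rightarrow> 'b) \<Rightarrow> bool" where
  "consistent D g \<longleftrightarrow> g ` D \<subseteq> U \<and> (\<forall>C xs. is_clique (set vs) F C \<longrightarrow> C \<subseteq> D \<longrightarrow> scope xs \<longrightarrow>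
     (\<exists>ys. cand xs ys \<and> \<not> bad xs ys \<and> (\<forall>a b. a \<in> C \<longrightarrow> pairs xs ys a b \<longrightarrow> b = g a)))"

text \<open>If \<open>xs\<close> covers the constrained part of \<open>C\<close>, a candidate on
  \<open>xs\<close> has a value at each of its vertices. By \<open>forth\<close> some candidate on
  \<open>xs'\<close> that is not bad agrees with it, so it is bound to the same values.\<close>

lemma spread:
  assumes "scope xs" "cand xs ys" "\<not> bad xs ys" "\<forall>a b. a \<in> C \<longrightarrow> pairs xs ys a b \<longrightarrow> b = g a"
    "C \<inter> (\<Union>x\<in>TA. set (ta x)) \<subseteq> cov xs" "scope xs'"
  shows "\<exists>ys'. cand xs' ys' \<and> \<not> bad xs' ys' \<and> (\<forall>a b. a \<in> C \<longrightarrow> pairs xs' ys' a b \<longrightarrow> b = g a)"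
proof -
  obtain ys' where ys': "cand xs' ys'" "agree UNIV xs ys xs' ys'" "\<not> bad xs' ys'"
    using forth[OF assms(6)] assms(3) by blast
  have "b' = g a" if "a \<in> C" "pairs xs' ys' a b'" for a b'
  proof -
    have "a \<in> (\<Union>x\<in>TA. set (ta x))"
      using pairs_cov[OF assms(6) that(2)] assms(6) by (auto simp: cov_def scope_def)
    then have "a \<in> cov xs" using assms(5) that(1) by blast
    then obtain b where "pairs xs ys a b" using cov_pairs[OF assms(1,2)] by blast
    then have "b' = b" using agreeD[OF ys'(2) UNIV_I _ that(2)] by blast
    moreover have "b = g a" using assms(4) that(1) \<open>pairs xs ys a b\<close> by blast
    ultimately show ?thesis by simp
  qed
  with ys' show ?thesis by blast
qed

text \<open>Every clique of the new domain through \<open>v\<close> lies in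
  \<open>insert v N\<close>, so a single candidate on a scope that covers this set settles all of
  them, by \<open>spread\<close>. For a universal \<open>v\<close> the candidate is first moved to
  the prescribed value by \<open>univ\<close>; since \<open>v\<close> comes after every member of
  \<open>N\<close>, nothing changes on \<open>N\<close>. For an existential \<open>v\<close> the
  candidate itself supplies the value.\<close>

lemma extend_step:
  assumes g: "consistent (set (take i vs)) g" and i: "i < length vs" and h: "h (vs ! i) \<in> U"
  shows "\<exists>b. consistent (set (take (Suc i) vs)) (g(vs ! i := b)) \<and>
    ((Forall, vs ! i) \<in> set p \<longrightarrow> b = h (vs ! i))"
proof -
  let ?D = "set (take i vs)"
  define v where "v = vs ! i"
  have D': "set (take (Suc i) vs) = insert v ?D" using i by (simp add: take_Suc_conv_app_nth v_def)
  have v: "v \<notin> ?D" "v \<in> set vs" using vs(1) i by (auto simp: v_def in_set_conv_nth nth_eq_iff_index_eq)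
  have D_sub: "?D \<subseteq> set vs" by (rule set_take_subset)
  define N where "N = {u \<in> ?D. {u, v} \<in> F}"
  have N_after: "comes_after p v u" if "u \<in> N" for u
    using that order i by (auto simp: N_def v_def in_set_conv_nth)
  have cliqueN: "is_clique (set vs) F N"
    unfolding is_clique_def
  proof (intro conjI ballI impI)
    show "N \<subseteq> set vs" using D_sub by (auto simp: N_def)
    fix x y assume xy: "x \<in> N" "y \<in> N" "x \<noteq> y"
    then obtain j l where jl: "j < i" "l < i" "x = vs ! j" "y = vs ! l" "{vs ! j, vs ! i} \<in> F" "{vs ! l, vs ! i} \<in> F"
      by (auto simp: N_def v_def in_set_conv_nth)
    then show "{x, y} \<in> F"
      using peo[of j l i] peo[of l j i] i xy(3) by (cases j l rule: linorder_cases) (auto simp: insert_commute)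
  qed
  have cliqueC: "is_clique (set vs) F (insert v N)"
    using cliqueN v by (auto simp: is_clique_def N_def insert_commute)
  have sub: "C \<subseteq> insert v N" if "is_clique (set vs) F C" "C \<subseteq> insert v ?D" "v \<in> C" for C
    using that by (auto simp: is_clique_def N_def)
  \<comment> \<open>The common end of both cases: cliques that avoid \<open>v\<close> inherit
    consistency from \<open>g\<close>, the others get it from the given candidate.\<close>
  have fin: "consistent (insert v ?D) (g(v := b))"
    if b: "b \<in> U" and ex: "TA \<noteq> {} \<Longrightarrow> \<exists>xs ys. scope xs \<and> insert v N \<inter> (\<Union>x\<in>TA. set (ta x)) \<subseteq> cov xs \<and>
      cand xs ys \<and> \<not> bad xs ys \<and> (\<forall>a c. a \<in> insert v N \<longrightarrow> pairs xs ys a c \<longrightarrow> c = (g(v := b)) a)" for b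
    unfolding consistent_def
  proof (intro conjI allI impI)
    show "(g(v := b)) ` insert v ?D \<subseteq> U" using b g by (auto simp: consistent_def)
    fix C xs assume C: "is_clique (set vs) F C" "C \<subseteq> insert v ?D" and xs: "scope xs"
    have "TA \<noteq> {}" using scope_nth[OF xs, of 0] k by auto
    show "\<exists>ys. cand xs ys \<and> \<not> bad xs ys \<and> (\<forall>a c. a \<in> C \<longrightarrow> pairs xs ys a c \<longrightarrow> c = (g(v := b)) a)"
    proof (cases "v \<in> C")
      case True
      from ex[OF \<open>TA \<noteq> {}\<close>] obtain xs0 ys0 where *: "scope xs0"
        "insert v N \<inter> (\<Union>x\<in>TA. set (ta x)) \<subseteq> cov xs0" "cand xs0 ys0" "\<not> bad xs0 ys0"
        "\<forall>a c. a \<in> insert v N \<longrightarrow> pairs xs0 ys0 a c \<longrightarrow> c = (g(v := b)) a" by blast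
      have CN: "C \<subseteq> insert v N" using sub[OF C True] .
      have "\<forall>a c. a \<in> C \<longrightarrow> pairs xs0 ys0 a c \<longrightarrow> c = (g(v := b)) a"
        using *(5) CN by (simp only: subset_iff) blast
      moreover have "C \<inter> (\<Union>x\<in>TA. set (ta x)) \<subseteq> cov xs0"
        using *(2) CN by (meson Int_mono order_refl subset_trans)
      ultimately show ?thesis by (rule spread[OF *(1,3,4) _ _ xs])
    next
      case False
      then have "C \<subseteq> ?D" using C by auto
      then obtain ys where "cand xs ys" "\<not> bad xs ys" "\<forall>a b. a \<in> C \<longrightarrow> pairs xs ys a b \<longrightarrow> b = g a"
        using g C(1) xs unfolding consistent_def by blast
      with False show ?thesis by (intro exI[of _ ys]) auto
    qed
  qed
  \<comment> \<open>The clique \<open>N\<close> is old, so consistency applies to it; the scope is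
    chosen to cover \<open>v\<close> too, whose value is still open.\<close>
  have start: "\<exists>xs ys. scope xs \<and> insert v N \<inter> (\<Union>x\<in>TA. set (ta x)) \<subseteq> cov xs \<and>
      cand xs ys \<and> \<not> bad xs ys \<and> (\<forall>a c. a \<in> N \<longrightarrow> pairs xs ys a c \<longrightarrow> c = g a)" if ne: "TA \<noteq> {}"
  proof -
    obtain xs where "scope xs" "insert v N \<inter> (\<Union>x\<in>TA. set (ta x)) \<subseteq> cov xs"
      using cover[OF cliqueC ne] by blast
    moreover have "N \<subseteq> ?D" by (auto simp: N_def)
    ultimately show ?thesis using g cliqueN unfolding consistent_def by blast
  qed
  show ?thesis
  proof (cases "(Forall, v) \<in> set p")
    case True
    have "consistent (insert v ?D) (g(v := h v))"
    proof (rule fin)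
      show "h v \<in> U" using h by (simp add: v_def)
      assume "TA \<noteq> {}"
      from start[OF this] obtain xs ys where *: "scope xs"
        "insert v N \<inter> (\<Union>x\<in>TA. set (ta x)) \<subseteq> cov xs" "cand xs ys" "\<not> bad xs ys"
        "\<forall>a c. a \<in> N \<longrightarrow> pairs xs ys a c \<longrightarrow> c = g a" by blast
      obtain ys' where ys': "cand xs ys'" "\<forall>b'. pairs xs ys' v b' \<longrightarrow> b' = h v"
        "agree {u. u \<noteq> v \<and> comes_after p v u} xs ys xs ys'" "\<not> bad xs ys'"
        using univ[OF True \<open>h v \<in> U\<close>] *(4) by blast
      have "c = g a" if ac: "a \<in> N" "pairs xs ys' a c" for a c
      proof -
        obtain b where b: "pairs xs ys a b" using cov_pairs[OF *(1,3) pairs_cov[OF *(1) ac(2)]] by blast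
        have "a \<noteq> v" "comes_after p v a" using ac(1) v N_after by (auto simp: N_def)
        then have "c = b" using agreeD[OF ys'(3) _ b ac(2)] by blast
        moreover have "b = g a" using *(5) ac(1) b by blast
        ultimately show ?thesis by simp
      qed
      with * ys' show "\<exists>xs ys. scope xs \<and> insert v N \<inter> (\<Union>x\<in>TA. set (ta x)) \<subseteq> cov xs \<and>
        cand xs ys \<and> \<not> bad xs ys \<and> (\<forall>a c. a \<in> insert v N \<longrightarrow> pairs xs ys a c \<longrightarrow> c = (g(v := h v)) a)"
        by (intro exI[of _ xs] exI[of _ ys']) auto
    qed
    then show ?thesis using D' v_def by auto
  next
    case False
    have "U \<noteq> {}" using h by auto
    then obtain u0 where u0: "u0 \<in> U" by blast
    have "\<exists>b. consistent (insert v ?D) (g(v := b))"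
    proof (cases "TA = {}")
      case True
      then show ?thesis using fin[OF u0] by blast
    next
      case TA: False
      from start[OF this] obtain xs ys where *: "scope xs"
        "insert v N \<inter> (\<Union>x\<in>TA. set (ta x)) \<subseteq> cov xs" "cand xs ys" "\<not> bad xs ys"
        "\<forall>a c. a \<in> N \<longrightarrow> pairs xs ys a c \<longrightarrow> c = g a" by blast
      \<comment> \<open>The value of the candidate at \<open>v\<close>, or any element of the
        universe if \<open>v\<close> is in no tuple of the scope.\<close>
      obtain b where b: "b \<in> U" "\<forall>c. pairs xs ys v c \<longrightarrow> c = b"
      proof (cases "v \<in> cov xs")
        case True
        then obtain b where b: "b \<in> U" "pairs xs ys v b" using cov_pairs[OF *(1,3)] by blast
        have "agree UNIV xs ys xs ys" using *(3) by (simp add: cand_def)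
        then have "\<forall>c. pairs xs ys v c \<longrightarrow> c = b" using agreeD[OF _ UNIV_I b(2)] by blast
        with b(1) show ?thesis by (rule that)
      next
        case False
        then show ?thesis using that[OF u0] pairs_cov[OF *(1)] by blast
      qed
      have "consistent (insert v ?D) (g(v := b))"
      proof (rule fin[OF b(1)])
        show "\<exists>xs ys. scope xs \<and> insert v N \<inter> (\<Union>x\<in>TA. set (ta x)) \<subseteq> cov xs \<and>
          cand xs ys \<and> \<not> bad xs ys \<and> (\<forall>a c. a \<in> insert v N \<longrightarrow> pairs xs ys a c \<longrightarrow> c = (g(v := b)) a)"
          using * b(2) v by (intro exI[of _ xs] exI[of _ ys]) (auto simp: N_def)
      qed
      then show ?thesis by blast
    qed
    then show ?thesis using False D' v_def by auto
  qed
qed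

text \<open>The function \<open>h\<close> plays the opponent: it prescribes the universal variables
  that are still to come.\<close>

lemma extend:
  assumes "consistent (set (take i vs)) g" "i \<le> length vs" "h ` set vs \<subseteq> U"
  shows "\<exists>g'. consistent (set vs) g' \<and> (\<forall>u\<in>set (take i vs). g' u = g u) \<and>
    (\<forall>u\<in>set vs - set (take i vs). (Forall, u) \<in> set p \<longrightarrow> g' u = h u)"
  using assms(2,1)
proof (induction i arbitrary: g rule: inc_induct)
  case base
  then show ?case by auto
next
  case (step i)
  have hU: "h (vs ! i) \<in> U" using assms(3) nth_mem[OF step.hyps(2)] by blast
  obtain b where b: "consistent (set (take (Suc i) vs)) (g(vs ! i := b))" "(Forall, vs ! i) \<in> set p \<longrightarrow> b = h (vs ! i)"
    using extend_step[OF step.prems step.hyps(2), of h] hU by blast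
  from step.IH[OF b(1)] obtain g' where g': "consistent (set vs) g'"
    "\<forall>u\<in>set (take (Suc i) vs). g' u = (g(vs ! i := b)) u"
    "\<forall>u\<in>set vs - set (take (Suc i) vs). (Forall, u) \<in> set p \<longrightarrow> g' u = h u" by blast
  have D': "set (take (Suc i) vs) = insert (vs ! i) (set (take i vs))"
    using step.hyps(2) by (simp add: take_Suc_conv_app_nth)
  have "vs ! i \<notin> set (take i vs)" using vs(1) step.hyps(2) by (auto simp: in_set_conv_nth nth_eq_iff_index_eq)
  then show ?case using g' b(2) unfolding D' by (intro exI[of _ g']) (auto split: if_splits)
qed

lemma consistent_mono: "consistent D g \<Longrightarrow> D' \<subseteq> D \<Longrightarrow> consistent D' g"
  unfolding consistent_def by (meson dual_order.trans image_mono)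

text \<open>The plays are all consistent assignments. To change the value of a universal
  \<open>v = vs ! i\<close>, the values on the first \<open>i\<close> vertices are kept and the rest
  is built anew. A vertex \<open>u\<close> behind \<open>v\<close> in \<open>vs\<close> with
  \<open>comes_after p v u\<close> also satisfies the converse relation, by the ordering, so it
  shares the block of \<open>v\<close>; hence it is universal, and its old value can be
  prescribed.\<close>

lemma not_bad_imp_sat: "sat U p sol f0"
proof (rule responsive_imp_sat[where P = "{g. consistent (set vs) g}", OF _ _ _ _ dist])
  obtain h :: "'a \<Rightarrow> 'b" where h: "h ` set vs \<subseteq> U"
    using nonempty vs(2) by (cases "p = []") (auto intro: that[of "\<lambda>_. SOME z. z \<in> U"] some_in_eq[THEN iffD2])
  \<comment> \<open>On the empty domain only the empty clique is left, and consistency reduces to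
    \<open>good\<close>.\<close>
  have "consistent (set (take 0 vs)) h"
    using good by (auto simp: consistent_def)
  from extend[OF this _ h] show "{g. consistent (set vs) g} \<noteq> {}" by auto
  show "f ` snd ` set p \<subseteq> U" if "f \<in> {g. consistent (set vs) g}" for f
    using that vs(2) by (auto simp: consistent_def)
  show "responsive U p (\<lambda>u v. comes_after p v u) {g. consistent (set vs) g}"
    unfolding responsive_def
  proof (intro ballI allI impI)
    fix f v b assume f: "f \<in> {g. consistent (set vs) g}" and v: "(Forall, v) \<in> set p" and b: "b \<in> U"
    have "v \<in> set vs" using v vs(2) by force
    then obtain i where i: "i < length vs" "vs ! i = v" by (auto simp: in_set_conv_nth)
    have "consistent (set (take i vs)) f"
      using f consistent_mono[OF _ set_take_subset] by blast
    moreover have "(f(v := b)) ` set vs \<subseteq> U" using f b by (auto simp: consistent_def)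
    ultimately obtain g where g: "consistent (set vs) g" "\<forall>u\<in>set (take i vs). g u = f u"
      "\<forall>u\<in>set vs - set (take i vs). (Forall, u) \<in> set p \<longrightarrow> g u = (f(v := b)) u"
      using extend[of i f "f(v := b)"] i(1) by auto
    have "v \<notin> set (take i vs)" using vs(1) i by (auto simp: in_set_conv_nth nth_eq_iff_index_eq)
    then have "g v = b" using g(3) v \<open>v \<in> set vs\<close> by auto
    moreover have "g u = f u" if u: "u \<noteq> v" "comes_after p v u" for u
    proof (cases "u \<in> set (take i vs)")
      case False
      obtain iu iv where iuv: "iu < length p" "iv < length p" "snd (p ! iu) = u" "snd (p ! iv) = v"
        using u(2) unfolding comes_after_def by blast
      then have "u \<in> set vs" using vs(2) nth_mem by blast
      then obtain j where j: "j < length vs" "vs ! j = u" by (auto simp: in_set_conv_nth)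
      have "\<not> j < i" using False i j by (auto simp: in_set_conv_nth)
      then have "i < j" using u i j by (cases i j rule: linorder_cases) auto
      then have "comes_after p u v" using order[of i j] i j by simp
      then have "(\<forall>m. iv \<le> m \<and> m \<le> iu \<longrightarrow> fst (p ! m) = fst (p ! iv)) \<or> (\<forall>m. iu \<le> m \<and> m \<le> iv \<longrightarrow> fst (p ! m) = fst (p ! iu))"
        using comes_after_iff[OF dist iuv(1,2)] comes_after_iff[OF dist iuv(2,1)] u(2) iuv(3,4)
        by (metis le_antisym)
      moreover have "iu \<le> iv \<or> iv \<le> iu" by auto
      ultimately have "fst (p ! iu) = fst (p ! iv)"
        using comes_after_iff[OF dist iuv(1,2)] comes_after_iff[OF dist iuv(2,1)] u(2) iuv(3,4) \<open>comes_after p u v\<close>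
        by (metis le_antisym order_refl)
      moreover have "p ! iv = (Forall, v)"
      proof -
        obtain jv where "jv < length p" "p ! jv = (Forall, v)" using v by (auto simp: in_set_conv_nth)
        moreover have "jv = iv" using dist iuv calculation nth_eq_iff_index_eq[of "map snd p" jv iv] by auto
        ultimately show ?thesis by simp
      qed
      ultimately have "p ! iu = (Forall, u)" using iuv(3) by (metis fst_conv prod.collapse)
      then have "(Forall, u) \<in> set p" using iuv(1) nth_mem by metis
      then show ?thesis using g(3) False \<open>u \<in> set vs\<close> u(1) by auto
    qed (use g(2) in blast)
    ultimately show "\<exists>g\<in>{g. consistent (set vs) g}. g v = b \<and> (\<forall>u. u \<noteq> v \<longrightarrow> comes_after p v u \<longrightarrow> g u = f u)"
      using g(1) by blast
  qed
  show "sol g" if fc: "f \<in> {g. consistent (set vs) g}" and gf: "\<forall>u\<in>snd ` set p. g u = f u" for f g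
    unfolding sol_def
  proof
    fix x assume x: "x \<in> TA"
    \<comment> \<open>A single tuple becomes a scope by repetition; its entries form a clique by
      \<open>edges\<close>.\<close>
    let ?xs = "replicate k x"
    have "is_clique (set vs) F (set (ta x))" "set (ta x) \<subseteq> set vs" "scope ?xs"
      using edges[OF x] ta_sub[OF x] vs(2) x by (auto simp: scope_def)
    then obtain ys where ys: "cand ?xs ys" "\<forall>a b. a \<in> set (ta x) \<longrightarrow> pairs ?xs ys a b \<longrightarrow> b = f a"
      using fc unfolding consistent_def by blast
    have y: "ys ! 0 \<in> TB x" using ys(1) k by (auto simp: cand_def)
    have "map g (ta x) = tb (ys ! 0)"
    proof (rule nth_equalityI)
      show "length (map g (ta x)) = length (tb (ys ! 0))" using tb_len[OF x y] by simp
      fix j assume "j < length (map g (ta x))"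
      then have j: "j < length (ta x)" by simp
      then have "pairs ?xs ys (ta x ! j) (tb (ys ! 0) ! j)"
        unfolding pairs_def maps_def using k tb_len[OF x y] by (intro exI[of _ 0] conjI exI[of _ j]) auto
      then have "tb (ys ! 0) ! j = f (ta x ! j)" using ys(2) j by auto
      moreover have "g (ta x ! j) = f (ta x ! j)" using gf ta_sub[OF x] j nth_mem by blast
      ultimately show "map g (ta x) ! j = tb (ys ! 0) ! j" using j by simp
    qed
    with y show "\<exists>y\<in>TB x. map g (ta x) = tb y" by blast
  qed
qed

end
end

section \<open>Least fixed points\<close>

definition assign :: "(nat \<Rightarrow> nat) \<Rightarrow> nat \<Rightarrow> nat list \<Rightarrow> nat \<Rightarrow> nat" where
  "assign xs d ys = (\<lambda>i. if d \<le> i \<and> i < d + length ys then ys ! (i - d) else xs i)"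

lemma assign_Nil [simp]: "assign xs d [] = xs"
  by (auto simp: assign_def)

lemma assign_Cons: "assign (xs(d := y)) (Suc d) ys = assign xs d (y # ys)"
  by (auto simp: assign_def fun_eq_iff nth_Cons')

definition tuples :: "nat \<Rightarrow> nat \<Rightarrow> nat list set" where
  "tuples N c = {ys. length ys = c \<and> set ys \<subseteq> {..N}}"

lemma tuples_0 [simp]: "tuples N 0 = {[]}"
  by (auto simp: tuples_def)

lemma tuples_Suc: "tuples N (Suc c) = {y # ys | y ys. y \<le> N \<and> ys \<in> tuples N c}"
  by (auto simp: tuples_def length_Suc_conv)

lemma card_tuples: "card (tuples N c) = Suc N ^ c" and finite_tuples: "finite (tuples N c)"
  using card_lists_length_eq[of "{..N}" c] finite_lists_length_eq[of "{..N}" c]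
  by (simp_all add: tuples_def conj_commute)

primrec tuple_list :: "nat \<Rightarrow> nat \<Rightarrow> nat list list" where
  "tuple_list N 0 = [[]]"
| "tuple_list N (Suc c) = concat (map (\<lambda>y. map ((#) y) (tuple_list N c)) [0..<Suc N])"

lemma set_tuple_list: "set (tuple_list N c) = tuples N c"
proof (induction c)
  case (Suc c)
  have "set (tuple_list N (Suc c)) = (\<Union>y\<in>{..N}. (#) y ` set (tuple_list N c))"
    by (simp add: atLeast0LessThan lessThan_Suc_atMost del: upt_Suc)
  then show ?case unfolding Suc tuples_Suc by auto
qed simp

lemma fold_concat: "fold f (concat xss) = fold (fold f) xss"
  by (induction xss) auto

lemma sem_Fors:
  "sem w d xs ((For ^^ c) p) = fold (\<lambda>ys. sem w (d + c) (assign xs d ys) p) (tuple_list (length w) c)"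
proof (induction c arbitrary: d xs)
  case (Suc c)
  show ?case
    by (rule ext) (simp add: Suc fold_concat fold_map o_def assign_Cons del: upt_Suc fun_upd_apply cong: fold_cong)
qed (auto simp: fun_eq_iff)

lemma sem_Reps: "sem w d xs ((Rep ^^ c) p) = sem w d xs p ^^ (Suc (length w) ^ c)"
proof (induction c)
  case (Suc c)
  have "sem w d xs ((Rep ^^ Suc c) p) = sem w d xs ((Rep ^^ c) p) ^^ Suc (length w)"
    by (rule ext) (simp del: funpow.simps(2) add: funpow.simps(2)[of c Rep])
  then show ?case by (simp only: Suc funpow_mult power_Suc mult.commute)
qed simp

lemma ev_Exs:
  "ev w ar d xs ((Ex ^^ c) \<phi>) \<longleftrightarrow> (\<exists>ys\<in>tuples (length w) c. ev w ar (d + c) (assign xs d ys) \<phi>)"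
proof (induction c arbitrary: d xs)
  case (Suc c)
  have "ev w ar d xs ((Ex ^^ Suc c) \<phi>) \<longleftrightarrow>
      (\<exists>y\<le>length w. \<exists>ys\<in>tuples (length w) c. ev w ar (d + Suc c) (assign xs d (y # ys)) \<phi>)"
    by (simp add: Suc assign_Cons del: fun_upd_apply)
  also have "\<dots> \<longleftrightarrow> (\<exists>ys\<in>tuples (length w) (Suc c). ev w ar (d + Suc c) (assign xs d ys) \<phi>)"
    unfolding tuples_Suc by blast
  finally show ?case .
qed simp

definition table :: "nat \<Rightarrow> nat list set \<Rightarrow> nat \<Rightarrow> bool" where
  "table N T n \<longleftrightarrow> (\<exists>ys\<in>T. addr N ys = n)"

lemma table_iff: "T \<subseteq> tuples N c \<Longrightarrow> zs \<in> tuples N c \<Longrightarrow> table N T (addr N zs) \<longleftrightarrow> zs \<in> T"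
  unfolding table_def tuples_def using addr_inj[of _ zs N] by fastforce

lemma table_insert: "(table N T)(addr N ys := True) = table N (insert ys T)"
  by (auto simp: table_def fun_eq_iff)

lemma table_empty: "table N {} = (\<lambda>_. False)"
  by (auto simp: table_def)

text \<open>\<open>c\<close> nested repetitions make \<open>Suc N ^ c\<close> rounds, which is the
  number of all \<open>c\<close>-tuples.\<close>

definition fix_stage :: "nat \<Rightarrow> nat \<Rightarrow> fm \<Rightarrow> prog" where
  "fix_stage a c \<phi> = (Rep ^^ c) ((For ^^ c) (When \<phi> (Mark a [0..<c] 0)))"

abbreviation val :: "nat list \<Rightarrow> nat \<Rightarrow> nat" where
  "val \<equiv> assign (\<lambda>_. 0) 0"

lemma map_val: "map (val ys) [0..<length ys] = ys"
  by (rule nth_equalityI) (auto simp: assign_def)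

text \<open>The relation is updated in place, so the rounds are not the stages of the usual fixed point
  iteration; but each round either enlarges the relation or leaves a closed one.\<close>

lemma sem_fix_stage:
  assumes ar0: "ar0 a = (\<lambda>_. False)"
    and \<Phi>: "\<And>T ys. T \<subseteq> tuples (length w) c \<Longrightarrow> ys \<in> tuples (length w) c \<Longrightarrow>
      ev w (ar0(a := table (length w) T)) c (val ys) \<phi> \<longleftrightarrow> \<Phi> T ys"
    and mono: "\<And>T T' ys. T \<subseteq> T' \<Longrightarrow> \<Phi> T ys \<Longrightarrow> \<Phi> T' ys"
    and M: "M \<subseteq> tuples (length w) c"
    and closed: "\<And>ys. ys \<in> tuples (length w) c \<Longrightarrow> \<Phi> M ys \<Longrightarrow> ys \<in> M"
    and least: "\<And>Z. Z \<subseteq> tuples (length w) c \<Longrightarrow> (\<And>ys. ys \<in> tuples (length w) c \<Longrightarrow> \<Phi> Z ys \<Longrightarrow> ys \<in> Z) \<Longrightarrow> M \<subseteq> Z"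
  shows "sem w 0 (\<lambda>_. 0) (fix_stage a c \<phi>) ar0 = ar0(a := table (length w) M)"
proof -
  let ?N = "length w"
  define D where "D = tuples ?N c"
  define arr where "arr T = ar0(a := table ?N T)" for T
  define upd where "upd ys T = (if \<Phi> T ys then insert ys T else T)" for ys T
  define pass where "pass T = fold upd (tuple_list ?N c) T" for T
  let ?body = "\<lambda>ys. sem w c (val ys) (When \<phi> (Mark a [0..<c] 0))"
  have fold_D: "fold upd zs T \<subseteq> D" if "T \<subseteq> D" "set zs \<subseteq> D" for zs T
    using that by (induction zs arbitrary: T) (auto simp: upd_def)
  have body: "?body ys (arr T) = arr (upd ys T)" if "T \<subseteq> D" "ys \<in> D" for ys T
  proof -
    have "length ys = c" using that by (simp add: D_def tuples_def)
    then have "map (val ys) [0..<c] = ys" using map_val[of ys] by simp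
    then show ?thesis
      using \<Phi>[of T ys] that by (simp add: D_def arr_def upd_def table_insert)
  qed
  have "fold ?body zs (arr T) = arr (fold upd zs T)" if "T \<subseteq> D" "set zs \<subseteq> D" for zs T
    using that
  proof (induction zs arbitrary: T)
    case (Cons z zs)
    have "upd z T \<subseteq> D" using Cons.prems by (auto simp: upd_def)
    with Cons show ?case by (simp add: body del: sem.simps)
  qed simp
  then have pass: "sem w 0 (\<lambda>_. 0) ((For ^^ c) (When \<phi> (Mark a [0..<c] 0))) (arr T) = arr (pass T)"
    if "T \<subseteq> D" for T
    using that unfolding sem_Fors pass_def by (simp add: set_tuple_list D_def del: sem.simps)
  have pass_D: "pass T \<subseteq> D" if "T \<subseteq> D" for T
    unfolding pass_def using fold_D that by (simp add: set_tuple_list D_def)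
  have iter_D: "(pass ^^ n) {} \<subseteq> D" for n
    by (induction n) (auto dest!: pass_D)
  have iter: "(sem w 0 (\<lambda>_. 0) ((For ^^ c) (When \<phi> (Mark a [0..<c] 0))) ^^ n) (arr {}) = arr ((pass ^^ n) {})" for n
    by (induction n) (simp_all add: pass[OF iter_D])
  have fold_incr: "T \<subseteq> fold upd zs T" for zs T
  proof (induction zs arbitrary: T)
    case (Cons z zs)
    have "T \<subseteq> upd z T" by (auto simp: upd_def)
    also have "\<dots> \<subseteq> fold upd zs (upd z T)" by (rule Cons)
    finally show ?case by simp
  qed simp
  have fold_hit: "ys \<in> fold upd zs T" if "ys \<in> set zs" "\<Phi> T ys" for ys zs T
    using that
  proof (induction zs arbitrary: T)
    case (Cons z zs)
    have T: "T \<subseteq> upd z T" by (auto simp: upd_def)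
    show ?case
    proof (cases "ys = z")
      case True
      then have "ys \<in> upd z T" using Cons.prems by (simp add: upd_def)
      then show ?thesis using fold_incr[of "upd z T" zs] by auto
    next
      case False
      then show ?thesis using Cons.IH[of "upd z T"] Cons.prems mono[OF T] by auto
    qed
  qed simp
  have fold_M: "fold upd zs T \<subseteq> M" if "T \<subseteq> M" "set zs \<subseteq> D" for zs T
    using that
  proof (induction zs arbitrary: T)
    case (Cons z zs)
    have "upd z T \<subseteq> M"
      using Cons.prems closed[of z] mono[OF Cons.prems(1)] by (auto simp: upd_def D_def)
    with Cons show ?case by simp
  qed simp
  have iter_M: "(pass ^^ n) {} \<subseteq> M" for n
  proof (induction n)
    case (Suc n)
    then have "pass ((pass ^^ n) {}) \<subseteq> M"
      unfolding pass_def by (intro fold_M) (simp_all add: set_tuple_list D_def)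
    then show ?case by simp
  qed simp
  have stable: "M \<subseteq> T" if T: "T \<subseteq> D" "pass T = T" for T
  proof (rule least)
    show "T \<subseteq> tuples ?N c" using T by (simp add: D_def)
    fix ys assume "ys \<in> tuples ?N c" "\<Phi> T ys"
    then have "ys \<in> pass T" unfolding pass_def by (intro fold_hit) (simp_all add: set_tuple_list)
    then show "ys \<in> T" using T by simp
  qed
  have fin: "finite D" by (simp add: D_def finite_tuples)
  \<comment> \<open>As long as the rounds are not stable, each adds a tuple. With \<open>n\<close>
    the number of all tuples, the second alternative makes the relation full, so it contains
    \<open>M\<close> in this case too.\<close>
  have "M \<subseteq> (pass ^^ n) {} \<or> card ((pass ^^ n) {}) \<ge> n" for n
  proof (induction n)
    case (Suc n)
    let ?T = "(pass ^^ n) {}"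
    have sub: "?T \<subseteq> pass ?T" unfolding pass_def by (rule fold_incr)
    show ?case
    proof (cases "pass ?T = ?T")
      case True
      then show ?thesis using stable[OF iter_D] by simp
    next
      case False
      then have "card ?T < card (pass ?T)"
        using sub by (intro psubset_card_mono finite_subset[OF pass_D[OF iter_D] fin]) auto
      then show ?thesis using Suc sub by auto
    qed
  qed simp
  from this[of "Suc ?N ^ c"] have "M \<subseteq> (pass ^^ (Suc ?N ^ c)) {}"
  proof
    assume "Suc ?N ^ c \<le> card ((pass ^^ (Suc ?N ^ c)) {})"
    then have "(pass ^^ (Suc ?N ^ c)) {} = D"
      by (intro card_seteq fin iter_D) (simp add: D_def card_tuples)
    then show ?thesis using M by (simp add: D_def)
  qed
  then have eq: "(pass ^^ (Suc ?N ^ c)) {} = M" using iter_M by blast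
  have "arr {} = ar0" using ar0 by (simp add: arr_def table_empty fun_upd_idem)
  then show ?thesis
    using iter[of "Suc ?N ^ c"] eq by (simp add: fix_stage_def sem_Reps arr_def)
qed

section \<open>Reading an instance off its encoding\<close>

text \<open>\<open>occ c w i c' u\<close>: the factor \<open>u\<close> occurs in \<open>w\<close> at position \<open>i\<close>, and reading \<open>w\<close> from context \<open>c\<close> up
  to there leads to context \<open>c'\<close>; likewise \<open>ltr\<close> for a letter.\<close>

definition occ :: "nat \<times> nat \<Rightarrow> input_word \<Rightarrow> nat \<Rightarrow> nat \<times> nat \<Rightarrow> input_word \<Rightarrow> bool" where
  "occ c w i c' u \<longleftrightarrow> (\<exists>pre post. w = pre @ u @ post \<and> length pre = i \<and> foldl advance c pre = c')"

definition ltr :: "nat \<times> nat \<Rightarrow> input_word \<Rightarrow> nat \<Rightarrow> input_symbol \<Rightarrow> nat \<times> nat \<Rightarrow> bool" where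
  "ltr c u i a c' \<longleftrightarrow> i < length u \<and> u ! i = a \<and> foldl advance c (take i u) = c'"

lemma label_eq_iff:
  assumes "d < 8" "d' < 8"
  shows "label a (d, s) = label a' (d', s') \<longleftrightarrow> a = a' \<and> d = d' \<and> s = s'"
proof
  assume eq: "label a (d, s) = label a' (d', s')"
  have "symbol_code b < 5" for b by (cases b) auto
  then have "label b c mod 5 = symbol_code b" for b c
    unfolding label_def by (simp only: mod_mult_self2 mod_less)
  then have "label a (d, s) mod 5 = symbol_code a" "label a' (d', s') mod 5 = symbol_code a'" by blast+
  then have "symbol_code a = symbol_code a'" using eq by simp
  moreover from this have "a = a'" by (cases a; cases a') simp_all
  ultimately have e: "d + 8 * s = d' + 8 * s'" using eq by (simp add: label_def)
  have "(d + 8 * s) mod 8 = d" "(d' + 8 * s') mod 8 = d'" using assms by simp_all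
  with e have "d = d'" by simp
  with e \<open>a = a'\<close> show "a = a' \<and> d = d' \<and> s = s'" by simp
qed simp

lemma lab_eq_label_iff: "d < 8 \<Longrightarrow> lab w i = label a (d, s) \<longleftrightarrow> ltr (0, 0) w i a (d, s)"
proof -
  assume d: "d < 8"
  obtain d' s' where c: "ctx w i = (d', s')" "d' < 8" using ctx_less[of w i] by (cases "ctx w i") auto
  have "label a (d, s) \<noteq> 0" by (cases a) (auto simp: label_def)
  then show ?thesis
    using label_eq_iff[OF c(2) d, of "w ! i" s' a s] c(1) by (auto simp: lab_def ltr_def ctx_def)
qed

section \<open>Letters and factors of composite words\<close>

lemma ltr_append:
  "ltr c (u @ v) i a c' \<longleftrightarrow> ltr c u i a c' \<or> (length u \<le> i \<and> ltr (foldl advance c u) v (i - length u) a c')"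
  by (auto simp: ltr_def nth_append)

lemma occ_trans:
  assumes "occ c w i c' v" "occ c' v j c'' u"
  shows "occ c w (i + j) c'' u"
proof -
  obtain a b where 1: "w = a @ v @ b" "length a = i" "foldl advance c a = c'" using assms(1) by (auto simp: occ_def)
  obtain a' b' where 2: "v = a' @ u @ b'" "length a' = j" "foldl advance c' a' = c''" using assms(2) by (auto simp: occ_def)
  show ?thesis
    unfolding occ_def using 1 2 by (intro exI[of _ "a @ a'"] exI[of _ "b' @ b"]) simp
qed

lemma occ_append1: "occ c (u @ v) 0 c u"
  by (auto simp: occ_def)

lemma occ_append2: "occ c (u @ v) (length u) (foldl advance c u) v"
  unfolding occ_def by (intro exI[of _ u] exI[of _ "[]"]) simp

lemma occ_nth: "occ c w i c' u \<Longrightarrow> j < length u \<Longrightarrow> i + j < length w \<and> w ! (i + j) = u ! j"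
  by (auto simp: occ_def nth_append)

lemma occ_ctx: "occ c w i c' u \<Longrightarrow> j \<le> length u \<Longrightarrow> foldl advance c (take (i + j) w) = foldl advance c' (take j u)"
  by (auto simp: occ_def)

lemma ltr_occ: "occ c w i c' u \<Longrightarrow> ltr c' u j a c'' \<Longrightarrow> ltr c w (i + j) a c''"
  using occ_nth[of c w i c' u j] occ_ctx[of c w i c' u j] by (auto simp: ltr_def)

text \<open>\<open>u\<close> is balanced with bracket depth at most \<open>h\<close>, expressed
  through its action on contexts. The bound \<open>d + h \<le> 7\<close> keeps the automaton clear
  of its cut-off, and \<open>1 \<le> d\<close> excludes depth 0, where a factor in brackets would
  raise the section number.\<close>

definition nested :: "nat \<Rightarrow> input_word \<Rightarrow> bool" where
  "nested h u \<longleftrightarrow> (\<forall>d s. 1 \<le> d \<longrightarrow> d + h \<le> 7 \<longrightarrow> foldl advance (d, s) u = (d, s) \<and>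
     (\<forall>i<length u. \<exists>d'\<ge>d. foldl advance (d, s) (take i u) = (d', s)))"

definition br :: "input_word \<Rightarrow> input_word" where
  "br u = Open # u @ [Close]"

lemma length_br [simp]: "length (br u) = Suc (Suc (length u))"
  by (simp add: br_def)

lemma nested_mono: "nested h u \<Longrightarrow> h \<le> h' \<Longrightarrow> nested h' u"
  by (simp add: nested_def)

lemma nestedD: "nested h u \<Longrightarrow> 1 \<le> d \<Longrightarrow> d + h \<le> 7 \<Longrightarrow> foldl advance (d, s) u = (d, s)"
  by (simp add: nested_def)

lemma nested_prefix:
  "nested h u \<Longrightarrow> 1 \<le> d \<Longrightarrow> d + h \<le> 7 \<Longrightarrow> i \<le> length u \<Longrightarrow> \<exists>d'\<ge>d. foldl advance (d, s) (take i u) = (d', s)"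
  by (cases "i < length u") (auto simp: nested_def)

lemma foldl_bits: "set u \<subseteq> {Zero, One} \<Longrightarrow> foldl advance c u = c"
proof (induction u arbitrary: c)
  case (Cons a u)
  then have "advance c a = c" by (cases c) auto
  with Cons show ?case by simp
qed simp

lemma nested_bits:
  assumes "set u \<subseteq> {Zero, One}"
  shows "nested h u"
proof -
  have "foldl advance c (take i u) = c" for c i
    using assms set_take_subset[of i u] by (intro foldl_bits) auto
  then show ?thesis using foldl_bits[OF assms] by (auto simp: nested_def)
qed

lemma nested_append:
  assumes "nested h u" "nested h v"
  shows "nested h (u @ v)"
  unfolding nested_def
proof (intro allI impI conjI)
  fix d s assume d: "1 \<le> d" "d + h \<le> 7"
  show "foldl advance (d, s) (u @ v) = (d, s)" using assms d by (simp add: nestedD)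
  fix i assume "i < length (u @ v)"
  show "\<exists>d'\<ge>d. foldl advance (d, s) (take i (u @ v)) = (d', s)"
  proof (cases "i \<le> length u")
    case True
    then show ?thesis using nested_prefix[OF assms(1) d, of i s] by simp
  next
    case False
    then have "foldl advance (d, s) (take i (u @ v)) = foldl advance (d, s) (take (i - length u) v)"
      using nestedD[OF assms(1) d] by simp
    then show ?thesis using nested_prefix[OF assms(2) d, of "i - length u" s] \<open>i < length (u @ v)\<close> by simp
  qed
qed

lemma nested_concat: "(\<And>u. u \<in> set us \<Longrightarrow> nested h u) \<Longrightarrow> nested h (concat us)"
  by (induction us) (auto intro: nested_append nested_bits)

lemma br_prefix:
  assumes "nested h u" "d + Suc h \<le> 7" "0 < i" "i < length (br u)"
  shows "\<exists>d'\<ge>Suc d. foldl advance (d, s) (take i (br u)) = (d', s)"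
proof -
  obtain j where j: "i = Suc j" "j \<le> length u" using assms(3,4) by (cases i) auto
  have "foldl advance (d, s) (take i (br u)) = foldl advance (Suc d, s) (take j u)"
    using j assms(2) by (simp add: br_def)
  then show ?thesis using nested_prefix[OF assms(1), of "Suc d" j s] assms(2) j by simp
qed

lemma foldl_br:
  assumes "nested h u" "d + Suc h \<le> 7"
  shows "foldl advance (d, s) (br u) = (d, if d = 0 then min 7 (Suc s) else s)"
proof -
  have "foldl advance (Suc d, s) u = (Suc d, s)" using assms by (intro nestedD) auto
  then show ?thesis using assms(2) by (auto simp: br_def)
qed

lemma nested_br: "nested h u \<Longrightarrow> nested (Suc h) (br u)"
  unfolding nested_def[of "Suc h"]
proof (intro allI impI conjI)
  fix d s assume u: "nested h u" and d: "1 \<le> d" "d + Suc h \<le> 7"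
  show "foldl advance (d, s) (br u) = (d, s)" using foldl_br[OF u d(2)] d(1) by simp
  fix i assume i: "i < length (br u)"
  show "\<exists>d'\<ge>d. foldl advance (d, s) (take i (br u)) = (d', s)"
  proof (cases "i = 0")
    case False
    then show ?thesis using br_prefix[OF u d(2) _ i, of s] by (auto dest: Suc_leD)
  qed auto
qed

lemma occ_br:
  assumes "d < 7"
  shows "occ (d, s) (br u) 1 (Suc d, s) u"
  using assms unfolding occ_def br_def by (intro exI[of _ "[Open]"] exI[of _ "[Close]"]) auto

lemma ltr_br:
  assumes "nested h u" "d + Suc h \<le> 7"
  shows "ltr (d, s) (br u) i a (d', s') \<longleftrightarrow> i = 0 \<and> a = Open \<and> d' = d \<and> s' = s \<or>
    (\<exists>j. i = Suc j \<and> ltr (Suc d, s) (u @ [Close]) j a (d', s'))"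
  using assms(2) by (cases i) (auto simp: ltr_def br_def)

text \<open>The context of a letter is the one before it is read. The closing bracket therefore
  belongs to the inner depth, and at depth \<open>d\<close> only the opening one is found.\<close>

lemma ltr_br_depth:
  assumes "nested h u" "d + Suc h \<le> 7"
  shows "ltr (d, s) (br u) i a (d, s') \<longleftrightarrow> i = 0 \<and> a = Open \<and> s' = s"
proof (cases "i = 0")
  case False
  then show ?thesis using br_prefix[OF assms, of i s] by (auto simp: ltr_def)
qed (auto simp: ltr_def br_def)

lemma ltr_concat:
  assumes "\<And>u. u \<in> set us \<Longrightarrow> nested h u" "1 \<le> d" "d + h \<le> 7"
  shows "ltr (d, s) (concat us) i a c' \<longleftrightarrow>
    (\<exists>m<length us. \<exists>j. i = length (concat (take m us)) + j \<and> ltr (d, s) (us ! m) j a c')"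
  using assms(1)
proof (induction us arbitrary: i)
  case Nil
  then show ?case by (simp add: ltr_def)
next
  case (Cons u us)
  have "foldl advance (d, s) u = (d, s)" using Cons.prems assms(2,3) by (intro nestedD) auto
  then have "ltr (d, s) (concat (u # us)) i a c' \<longleftrightarrow> ltr (d, s) u i a c' \<or>
    (length u \<le> i \<and> (\<exists>m<length us. \<exists>j. i - length u = length (concat (take m us)) + j \<and> ltr (d, s) (us ! m) j a c'))"
    using Cons by (simp add: ltr_append)
  also have "\<dots> \<longleftrightarrow> (\<exists>m<length (u # us). \<exists>j. i = length (concat (take m (u # us))) + j \<and> ltr (d, s) ((u # us) ! m) j a c')"
    (is "?l \<longleftrightarrow> ?r")
  proof
    assume ?l
    then show ?r
    proof (elim disjE conjE exE)
      assume "ltr (d, s) u i a c'"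
      then show ?r by (intro exI[of _ 0] conjI exI[of _ i]) auto
    next
      fix m j assume "length u \<le> i" "m < length us" "i - length u = length (concat (take m us)) + j" "ltr (d, s) (us ! m) j a c'"
      then show ?r by (intro exI[of _ "Suc m"] conjI exI[of _ j]) auto
    qed
  next
    assume ?r
    then obtain m j where m: "m < length (u # us)" "i = length (concat (take m (u # us))) + j" "ltr (d, s) ((u # us) ! m) j a c'" by blast
    show ?l
    proof (cases m)
      case (Suc m')
      then show ?thesis using m by (intro disjI2 conjI exI[of _ m'] exI[of _ j]) auto
    qed (use m in auto)
  qed
  finally show ?case .
qed

lemma occ_concat:
  assumes "\<And>u. u \<in> set us \<Longrightarrow> nested h u" "1 \<le> d" "d + h \<le> 7" "m < length us"
  shows "occ (d, s) (concat us) (length (concat (take m us))) (d, s) (us ! m)"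
proof -
  have "concat us = concat (take m us) @ us ! m @ concat (drop (Suc m) us)"
    using id_take_nth_drop[OF assms(4)] by (metis concat.simps(2) concat_append)
  moreover have "nested h (concat (take m us))" using assms(1) by (intro nested_concat) (auto dest: in_set_takeD)
  then have "foldl advance (d, s) (concat (take m us)) = (d, s)" using assms(2,3) by (rule nestedD)
  ultimately show ?thesis unfolding occ_def by blast
qed

lemma foldl_sections:
  assumes "\<And>u. u \<in> set us \<Longrightarrow> nested 6 u" "s + length us \<le> 7"
  shows "foldl advance (0, s) (concat (map br us)) = (0, s + length us)"
  using assms
proof (induction us arbitrary: s)
  case (Cons u us)
  then have "foldl advance (0, s) (br u) = (0, Suc s)" using foldl_br[of 6 u 0 s] by simp
  then show ?case using Cons by simp
qed simp

lemma occ_sections: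
  assumes "\<And>u. u \<in> set us \<Longrightarrow> nested 6 u" "length us \<le> 7" "m < length us"
  shows "occ (0, 0) (concat (map br us)) (Suc (length (concat (map br (take m us))))) (1, m) (us ! m)"
proof -
  have "concat (map br us) = concat (map br (take m us)) @ br (us ! m) @ concat (map br (drop (Suc m) us))"
    using id_take_nth_drop[OF assms(3)] by (metis concat.simps(2) concat_append list.simps(9) map_append)
  moreover have "foldl advance (0, 0) (concat (map br (take m us))) = (0, m)"
    using foldl_sections[of "take m us" 0] assms by (auto dest: in_set_takeD)
  ultimately have "occ (0, 0) (concat (map br us)) (length (concat (map br (take m us)))) (0, m) (br (us ! m))"
    unfolding occ_def by blast
  from occ_trans[OF this occ_br] show ?thesis by simp
qed

text \<open>The brackets around the sections belong to no \<open>us ! m\<close>. The opening ones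
  are read at depth 0 and excluded by \<open>1 \<le> d'\<close>, the closing ones at depth 1 and
  excluded by \<open>a \<noteq> Close\<close>.\<close>

lemma ltr_sections:
  assumes "\<And>u. u \<in> set us \<Longrightarrow> nested 6 u" "s + length us \<le> 7" "1 \<le> d'" "a \<noteq> Close"
  shows "ltr (0, s) (concat (map br us)) i a (d', s') \<longleftrightarrow> (\<exists>m<length us. s' = s + m \<and>
    (\<exists>j. i = Suc (length (concat (map br (take m us)))) + j \<and> ltr (1, s') (us ! m) j a (d', s')))"
  using assms(1,2)
proof (induction us arbitrary: i s)
  case Nil
  then show ?case by (simp add: ltr_def)
next
  case (Cons u us)
  have u: "nested 6 u" using Cons.prems by simp
  have fb: "foldl advance (0, s) (br u) = (0, Suc s)" using foldl_br[OF u, of 0 s] Cons.prems(2) by simp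
  have s': "s' = s" if "ltr (Suc 0, s) u j a (d', s')" for j
    using that nested_prefix[OF u, of 1 j s] by (auto simp: ltr_def)
  have ab: "ltr (0, s) (br u) i a (d', s') \<longleftrightarrow> (\<exists>j. i = Suc j \<and> s' = s \<and> ltr (1, s') u j a (d', s'))"
    using ltr_br[OF u, of 0 s i a d' s'] assms(3,4) s'
    by (auto simp: ltr_append) (auto simp: ltr_def nth_Cons split: nat.splits)
  have "ltr (0, s) (concat (map br (u # us))) i a (d', s') \<longleftrightarrow> (\<exists>j. i = Suc j \<and> s' = s \<and> ltr (1, s') u j a (d', s')) \<or>
    (length (br u) \<le> i \<and> (\<exists>m<length us. s' = Suc s + m \<and>
    (\<exists>j. i - length (br u) = Suc (length (concat (map br (take m us)))) + j \<and> ltr (1, s') (us ! m) j a (d', s'))))"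
    using Cons.IH[of "Suc s" "i - length (br u)"] Cons.prems by (simp add: ltr_append fb ab del: length_br)
  also have "\<dots> \<longleftrightarrow> (\<exists>m<length (u # us). s' = s + m \<and>
    (\<exists>j. i = Suc (length (concat (map br (take m (u # us))))) + j \<and> ltr (1, s') ((u # us) ! m) j a (d', s')))"
    (is "?l \<longleftrightarrow> ?r")
  proof
    assume ?l
    then show ?r
    proof (elim disjE conjE exE)
      fix j assume "i = Suc j" "s' = s" "ltr (1, s') u j a (d', s')"
      then show ?r by (intro exI[of _ 0] conjI exI[of _ j]) auto
    next
      fix m j assume "length (br u) \<le> i" "m < length us" "s' = Suc s + m"
        "i - length (br u) = Suc (length (concat (map br (take m us)))) + j" "ltr (1, s') (us ! m) j a (d', s')"
      then show ?r by (intro exI[of _ "Suc m"] conjI exI[of _ j]) auto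
    qed
  next
    assume ?r
    then obtain m j where m: "m < length (u # us)" "s' = s + m"
      "i = Suc (length (concat (map br (take m (u # us))))) + j" "ltr (1, s') ((u # us) ! m) j a (d', s')" by blast
    show ?l
    proof (cases m)
      case 0
      then show ?thesis using m by auto
    next
      case (Suc m')
      then show ?thesis using m by (intro disjI2 conjI exI[of _ m'] exI[of _ j]) auto
    qed
  qed
  finally show ?case .
qed

section \<open>Bracketing of numbers, lists and pairs\<close>

lemma set_bits: "set (bits n) \<subseteq> {Zero, One}"
proof (induction n rule: bits.induct)
  case (1 n)
  then show ?case by (subst bits.simps) (auto split: if_splits)
qed

lemma bits_inj: "bits n = bits m \<Longrightarrow> n = m"
proof (induction n arbitrary: m rule: bits.induct)
  case (1 n)
  show ?case
  proof (cases "n = 0 \<or> m = 0")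
    case True
    then show ?thesis using "1.prems" bits.simps[of n] bits.simps[of m] by (auto split: if_splits)
  next
    case False
    then have "even n = even m" "bits (n div 2) = bits (m div 2)"
      using "1.prems" bits.simps[of n] bits.simps[of m] by (auto split: if_splits)
    then have "n div 2 = m div 2" "n mod 2 = m mod 2" using "1.IH" False by (auto simp: even_iff_mod_2_eq_zero)
    then show ?thesis by (metis div_mult_mod_eq)
  qed
qed

lemma enc_nat_br: "enc_nat n = br (bits n)"
  by (simp add: enc_nat_def br_def)

lemma enc_list_br: "enc_list e xs = br (concat (map e xs))"
  by (simp add: enc_list_def br_def)

lemma nested_enc_nat: "nested 1 (enc_nat n)"
  using nested_br[OF nested_bits[OF set_bits], of 0 n] by (simp add: enc_nat_br)

lemma nested_enc_list:
  assumes "\<And>x. x \<in> set xs \<Longrightarrow> nested h (e x)"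
  shows "nested (Suc h) (enc_list e xs)" "nested h (concat (map e xs))"
  using assms by (auto simp: enc_list_br intro!: nested_br nested_concat)

lemma nested_pair: "nested h (e x) \<Longrightarrow> nested h (e' y) \<Longrightarrow> nested h (enc_pair e e' (x, y))"
  by (simp add: enc_pair_def nested_append)

lemma ltr_enc_nat_Open: "d < 7 \<Longrightarrow> 1 \<le> d \<Longrightarrow> ltr (d, s) (enc_nat n) i Open c' \<longleftrightarrow> i = 0 \<and> c' = (d, s)"
proof -
  have "enc_nat n ! i \<noteq> Open" if "0 < i" "i < length (enc_nat n)" for i
  proof -
    obtain j where j: "i = Suc j" "j \<le> length (bits n)" using \<open>0 < i\<close> \<open>i < length (enc_nat n)\<close> by (cases i) (auto simp: enc_nat_br)
    show ?thesis
    proof (cases "j < length (bits n)")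
      case True
      then have "bits n ! j \<in> {Zero, One}" using set_bits[of n] nth_mem by blast
      then show ?thesis using j True by (auto simp: enc_nat_def nth_append)
    qed (use j in \<open>auto simp: enc_nat_def nth_append\<close>)
  qed
  then show ?thesis by (cases "i = 0") (auto simp: ltr_def enc_nat_def)
qed

section \<open>Comparing numbers and traversing tuples by positions\<close>

definition natat :: "input_word \<Rightarrow> nat \<Rightarrow> nat \<Rightarrow> bool" where
  "natat w p n \<longleftrightarrow> (\<exists>c c'. occ c w p c' (enc_nat n))"

definition tupat :: "input_word \<Rightarrow> nat \<Rightarrow> nat list \<Rightarrow> bool" where
  "tupat w x t \<longleftrightarrow> (\<exists>c c'. occ c w x c' (enc_list enc_nat t))"

lemma natatI: "occ c w p c' (enc_nat n) \<Longrightarrow> natat w p n"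
  unfolding natat_def by blast

lemma tupatI: "occ c w x c' (enc_list enc_nat t) \<Longrightarrow> tupat w x t"
  unfolding tupat_def by blast

lemma occ_drop: "occ c w i c' u \<Longrightarrow> \<exists>r. drop i w = u @ r"
  by (auto simp: occ_def)

text \<open>Two numbers in the word are compared letter by letter up to the first closing bracket.
  Since \<open>bits\<close> is injective, equal words mean equal numbers, of whatever size.\<close>

inductive num :: "input_word \<Rightarrow> nat \<Rightarrow> nat \<Rightarrow> bool" for w where
  Close: "p < length w \<Longrightarrow> q < length w \<Longrightarrow> w ! p = Close \<Longrightarrow> w ! q = Close \<Longrightarrow> num w p q"
| step: "p < length w \<Longrightarrow> q < length w \<Longrightarrow> w ! p = w ! q \<Longrightarrow> w ! p \<noteq> Close \<Longrightarrow> num w (Suc p) (Suc q)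
    \<Longrightarrow> num w p q"

lemma drop_eq_Cons: "drop p w = a # u \<Longrightarrow> p < length w \<and> w ! p = a \<and> drop (Suc p) w = u"
  by (metis Cons_nth_drop_Suc drop_all list.distinct(1) list.inject not_less)

lemma num_bits:
  assumes "drop p w = u @ Close # r" "drop q w = v @ Close # r'"
    "set u \<subseteq> {Zero, One}" "set v \<subseteq> {Zero, One}"
  shows "num w p q \<longleftrightarrow> u = v"
  using assms
proof (induction u arbitrary: p q v)
  case Nil
  then have p: "p < length w" "w ! p = Close" by (auto dest: drop_eq_Cons)
  show ?case
  proof (cases v)
    case Nil
    then have "q < length w" "w ! q = Close" using Nil.prems by (auto dest: drop_eq_Cons)
    then show ?thesis using p Nil num.Close by auto
  next
    case (Cons b v')
    then have "w ! q \<noteq> Close" using Nil.prems by (auto dest!: drop_eq_Cons)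
    then show ?thesis using p Cons by (auto elim: num.cases)
  qed
next
  case (Cons a u)
  then have p: "p < length w" "w ! p = a" "drop (Suc p) w = u @ Close # r" "a \<noteq> Close"
    by (auto dest!: drop_eq_Cons)
  show ?case
  proof (cases v)
    case Nil
    then have "w ! q = Close" using Cons.prems by (auto dest!: drop_eq_Cons)
    then show ?thesis using p Nil by (auto elim: num.cases)
  next
    case (Cons b v')
    then have q: "q < length w" "w ! q = b" "drop (Suc q) w = v' @ Close # r'" "b \<noteq> Close"
      using Cons.prems by (auto dest!: drop_eq_Cons)
    have "num w (Suc p) (Suc q) \<longleftrightarrow> u = v'"
      using Cons.IH[OF p(3) q(3)] Cons.prems Cons by auto
    moreover have "num w p q \<longleftrightarrow> a = b \<and> num w (Suc p) (Suc q)"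
    proof
      assume "num w p q"
      then show "a = b \<and> num w (Suc p) (Suc q)" using p q by cases auto
    next
      assume "a = b \<and> num w (Suc p) (Suc q)"
      then show "num w p q" using p q num.step[of p w q] by auto
    qed
    ultimately show ?thesis using Cons by auto
  qed
qed

lemma num_natat:
  assumes "natat w p n" "natat w q m"
  shows "num w p q \<longleftrightarrow> n = m"
proof -
  obtain r where r: "drop p w = Open # bits n @ Close # r"
    using assms(1) by (auto simp: natat_def enc_nat_def dest!: occ_drop)
  obtain r' where r': "drop q w = Open # bits m @ Close # r'"
    using assms(2) by (auto simp: natat_def enc_nat_def dest!: occ_drop)
  have p: "p < length w" "w ! p = Open" "drop (Suc p) w = bits n @ Close # r" using drop_eq_Cons[OF r] by auto
  have q: "q < length w" "w ! q = Open" "drop (Suc q) w = bits m @ Close # r'" using drop_eq_Cons[OF r'] by auto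
  have "num w p q \<longleftrightarrow> num w (Suc p) (Suc q)"
  proof
    assume "num w p q"
    then show "num w (Suc p) (Suc q)" using p by cases auto
  next
    assume "num w (Suc p) (Suc q)"
    then show "num w p q" using p q num.step[of p w q] by auto
  qed
  also have "\<dots> \<longleftrightarrow> bits n = bits m" by (rule num_bits[OF p(3) q(3) set_bits set_bits])
  finally show ?thesis using bits_inj by auto
qed

lemma natat_unique: "natat w p n \<Longrightarrow> natat w p m \<Longrightarrow> n = m"
proof -
  assume a: "natat w p n" "natat w p m"
  have "num w p p" using num_natat[OF a(1) a(1)] by simp
  then show "n = m" using num_natat[OF a] by simp
qed

text \<open>A number contains no inner brackets, so the first closing bracket behind
  \<open>p'\<close> is its own. Behind the last entry of a tuple comes another closing bracket,
  which the condition on \<open>p\<close> rejects.\<close>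

definition next_item :: "input_word \<Rightarrow> nat \<Rightarrow> nat \<Rightarrow> bool" where
  "next_item w p' p \<longleftrightarrow> (\<exists>z<length w. w ! z = Close \<and> p = Suc z \<and> p' < z \<and>
     (\<forall>y. p' < y \<longrightarrow> y < z \<longrightarrow> w ! y \<noteq> Close) \<and> p < length w \<and> w ! p = Open)"

lemma next_item_natat:
  assumes "natat w p' n"
  shows "next_item w p' p \<longleftrightarrow> p = p' + length (enc_nat n) \<and> p < length w \<and> w ! p = Open"
proof -
  obtain c c' where o: "occ c w p' c' (enc_nat n)" using assms by (auto simp: natat_def)
  define z0 where "z0 = p' + Suc (length (bits n))"
  have z0: "z0 < length w" "w ! z0 = Close"
    using occ_nth[OF o, of "Suc (length (bits n))"] by (auto simp: z0_def enc_nat_def nth_append)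
  have before: "w ! y \<noteq> Close" if "p' < y" "y < z0" for y
  proof -
    obtain j where j: "y = p' + Suc j" using \<open>p' < y\<close> less_iff_Suc_add by auto
    then have "j < length (bits n)" using \<open>y < z0\<close> by (simp add: z0_def)
    then have "w ! y = bits n ! j" using occ_nth[OF o, of "Suc j"] j by (auto simp: enc_nat_def nth_append)
    moreover have "bits n ! j \<in> {Zero, One}" using set_bits[of n] \<open>j < length (bits n)\<close> nth_mem by blast
    ultimately show ?thesis by auto
  qed
  have "z = z0" if "p' < z" "w ! z = Close" "\<forall>y. p' < y \<longrightarrow> y < z \<longrightarrow> w ! y \<noteq> Close" for z
    using that before z0 by (cases z z0 rule: linorder_cases) (auto simp: z0_def)
  moreover have "Suc z0 = p' + length (enc_nat n)" by (simp add: z0_def enc_nat_br)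
  ultimately show ?thesis
    unfolding next_item_def using z0 before
    by (metis less_add_same_cancel1 z0_def zero_less_Suc)
qed

text \<open>The entries of the two tuples are visited in parallel, so corresponding ones are found
  without reference to an index.\<close>

inductive mapr :: "input_word \<Rightarrow> nat \<Rightarrow> nat \<Rightarrow> nat \<Rightarrow> nat \<Rightarrow> bool" for w x y where
  first: "Suc x < length w \<Longrightarrow> Suc y < length w \<Longrightarrow> w ! Suc x = Open \<Longrightarrow> w ! Suc y = Open \<Longrightarrow>
    mapr w x y (Suc x) (Suc y)"
| step: "mapr w x y p' q' \<Longrightarrow> next_item w p' p \<Longrightarrow> next_item w q' q \<Longrightarrow> mapr w x y p q"

definition entry :: "nat \<Rightarrow> nat list \<Rightarrow> nat \<Rightarrow> nat" where
  "entry x t j = Suc x + length (concat (map enc_nat (take j t)))"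

lemma entry_natat:
  assumes "tupat w x t" "j < length t"
  shows "natat w (entry x t j) (t ! j)"
proof -
  obtain c c' where "occ c w x c' (enc_list enc_nat t)" using assms by (auto simp: tupat_def)
  then obtain a b where ab: "w = a @ enc_list enc_nat t @ b" "length a = x" by (auto simp: occ_def)
  have "concat (map enc_nat t) = concat (map enc_nat (take j t)) @ enc_nat (t ! j) @ concat (map enc_nat (drop (Suc j) t))"
    using id_take_nth_drop[OF assms(2)] by (metis concat.simps(2) concat_append list.simps(9) map_append)
  then have "w = (a @ Open # concat (map enc_nat (take j t))) @ enc_nat (t ! j) @ (concat (map enc_nat (drop (Suc j) t)) @ Close # b)"
    using ab by (simp add: enc_list_def)
  moreover have "length (a @ Open # concat (map enc_nat (take j t))) = entry x t j"
    using ab by (simp add: entry_def)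
  ultimately show ?thesis unfolding natat_def occ_def by blast
qed

lemma natat_Open: "natat w p n \<Longrightarrow> p < length w \<and> w ! p = Open"
  by (auto simp: natat_def enc_nat_def dest!: occ_drop drop_eq_Cons)

lemma tupat_end:
  assumes "tupat w x t"
  shows "entry x t (length t) < length w \<and> w ! entry x t (length t) = Close"
proof -
  obtain c c' where o: "occ c w x c' (enc_list enc_nat t)" using assms by (auto simp: tupat_def)
  show ?thesis
    using occ_nth[OF o, of "Suc (length (concat (map enc_nat t)))"]
    by (simp add: entry_def enc_list_def nth_append)
qed

lemma entry_Open:
  assumes "tupat w x t" "j \<le> length t"
  shows "entry x t j < length w \<and> (w ! entry x t j = Open \<longleftrightarrow> j < length t)"
  using tupat_end[OF assms(1)] entry_natat[OF assms(1), of j, THEN natat_Open] assms(2)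
  by (cases "j = length t") auto

lemma entry_Suc: "j < length t \<Longrightarrow> entry x t (Suc j) = entry x t j + length (enc_nat (t ! j))"
  by (simp add: entry_def take_Suc_conv_app_nth)

lemma next_entry:
  assumes "tupat w x t" "j < length t"
  shows "next_item w (entry x t j) p \<longleftrightarrow> Suc j < length t \<and> p = entry x t (Suc j)"
  using next_item_natat[OF entry_natat[OF assms]] entry_Open[OF assms(1), of "Suc j"] assms(2)
  by (auto simp: entry_Suc)

lemma mapr_iff:
  assumes "tupat w x t" "tupat w y t'"
  shows "mapr w x y p q \<longleftrightarrow> (\<exists>j<length t. j < length t' \<and> p = entry x t j \<and> q = entry y t' j)"
proof
  assume "mapr w x y p q"
  then show "\<exists>j<length t. j < length t' \<and> p = entry x t j \<and> q = entry y t' j"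
  proof induction
    case first
    have "entry x t 0 = Suc x" "entry y t' 0 = Suc y" by (simp_all add: entry_def)
    then show ?case using entry_Open[OF assms(1), of 0] entry_Open[OF assms(2), of 0] first by auto
  next
    case (step p' q' p q)
    then show ?case using next_entry[OF assms(1)] next_entry[OF assms(2)] by blast
  qed
next
  assume "\<exists>j<length t. j < length t' \<and> p = entry x t j \<and> q = entry y t' j"
  then obtain j where "j < length t" "j < length t'" "p = entry x t j" "q = entry y t' j" by blast
  then show "mapr w x y p q"
  proof (induction j arbitrary: p q)
    case 0
    have "entry x t 0 = Suc x" "entry y t' 0 = Suc y" by (simp_all add: entry_def)
    then show ?case using entry_Open[OF assms(1), of 0] entry_Open[OF assms(2), of 0] 0 by (auto intro: mapr.first)
  next
    case (Suc j)
    have "mapr w x y (entry x t j) (entry y t' j)" using Suc by auto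
    then show ?case
      by (rule mapr.step) (use Suc.prems next_entry[OF assms(1), of j] next_entry[OF assms(2), of j] in auto)
  qed
qed

section \<open>The relation symbol of a tuple\<close>

definition open1 :: "input_word \<Rightarrow> nat \<Rightarrow> bool" where
  "open1 w z \<longleftrightarrow> (\<exists>s. ltr (0, 0) w z Open (1, s))"

definition last_open1 :: "input_word \<Rightarrow> nat \<Rightarrow> nat \<Rightarrow> bool" where
  "last_open1 w j x \<longleftrightarrow> j < x \<and> open1 w j \<and> (\<forall>z. j < z \<longrightarrow> z < x \<longrightarrow> \<not> open1 w z)"

text \<open>A relation is written as two items of depth 1, the symbol and the list of its tuples.
  From a tuple, two steps back over opening brackets of depth 1 lead to the list and then to the
  symbol.\<close>

definition relof :: "input_word \<Rightarrow> nat \<Rightarrow> nat \<Rightarrow> bool" where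
  "relof w r x \<longleftrightarrow> (\<exists>j. last_open1 w r j \<and> last_open1 w j x)"

lemma last_open1_unique: "last_open1 w j x \<Longrightarrow> last_open1 w j' x \<Longrightarrow> j = j'"
  unfolding last_open1_def by (meson linorder_neqE_nat)

lemma relof_unique: "relof w r x \<Longrightarrow> relof w r' x \<Longrightarrow> r = r'"
  unfolding relof_def using last_open1_unique by blast

lemma last_open1_br:
  assumes "occ (0, 0) w i (1, s) (br u)" "nested 5 u" "0 < k" "k < length (br u)"
  shows "last_open1 w i (i + k)"
  unfolding last_open1_def
proof (intro conjI allI impI)
  have "ltr (1, s) (br u) 0 Open (1, s)" by (simp add: ltr_def br_def)
  from ltr_occ[OF assms(1) this] show "open1 w i" by (auto simp: open1_def)
  fix z assume z: "i < z" "z < i + k"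
  define j where "j = z - i"
  have j: "z = i + j" "0 < j" "j < length (br u)" using z assms(4) by (auto simp: j_def)
  have "\<exists>d'\<ge>Suc 1. foldl advance (1, s) (take j (br u)) = (d', s)"
    by (rule br_prefix[OF assms(2) _ j(2,3)]) simp
  then show "\<not> open1 w z"
    using occ_ctx[OF assms(1), of j] j by (auto simp: open1_def ltr_def)
qed (use assms in simp)

abbreviation enc_rel :: "nat \<times> nat list list \<Rightarrow> input_word" where
  "enc_rel \<equiv> enc_pair enc_nat (enc_list (enc_list enc_nat))"

abbreviation enc_quant :: "quantifier \<times> nat \<Rightarrow> input_word" where
  "enc_quant \<equiv> enc_pair enc_quantifier enc_nat"

text \<open>With the bracket around the section the depth is at most 4, safely below the cut-off of
  the automaton.\<close>

lemma nested_items: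
  "nested 1 (enc_nat n)" "nested 2 (enc_list enc_nat t)" "nested 3 (enc_list (enc_list enc_nat) ts)"
  "nested 3 (enc_rel r)" "nested 1 (enc_quant qv)"
proof -
  show n: "nested 1 (enc_nat n)" for n by (rule nested_enc_nat)
  show t: "nested 2 (enc_list enc_nat t)" for t
    using nested_enc_list(1)[of t 1 enc_nat] n by (simp add: numeral_2_eq_2)
  show ts: "nested 3 (enc_list (enc_list enc_nat) ts)" for ts
    using nested_enc_list(1)[of ts 2 "enc_list enc_nat"] t by (simp add: numeral_3_eq_3)
  show "nested 3 (enc_rel r)"
    using nested_mono[OF n, of 3] ts by (cases r) (simp add: enc_pair_def nested_append)
  have "nested 1 (enc_quantifier q)" for q by (cases q) (auto intro: nested_bits)
  then show "nested 1 (enc_quant qv)"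
    using n by (cases qv) (simp add: enc_pair_def nested_append)
qed

section \<open>The six sections of an encoded instance\<close>

locale encoded =
  fixes w :: input_word and ss :: "(nat \<times> nat) list" and p :: "nat quant_prefix"
    and us :: "nat list" and rs :: "(nat \<times> nat list list) list"
    and us' :: "nat list" and rs' :: "(nat \<times> nat list list) list"
  assumes w: "w = enc_list (enc_pair enc_nat enc_nat) ss @ enc_list enc_quant p @
    (enc_list enc_nat us @ enc_list enc_rel rs) @ (enc_list enc_nat us' @ enc_list enc_rel rs')"
begin

definition secs :: "input_word list" where
  "secs = [concat (map (enc_pair enc_nat enc_nat) ss), concat (map enc_quant p),
     concat (map enc_nat us), concat (map enc_rel rs), concat (map enc_nat us'), concat (map enc_rel rs')]"

definition start :: "nat \<Rightarrow> nat" where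
  "start m = Suc (length (concat (map br (take m secs))))"

lemma length_secs: "length secs = 6"
  by (simp add: secs_def)

lemma w_secs: "w = concat (map br secs)"
  by (simp add: w secs_def enc_list_br)

lemma nested_secs: "u \<in> set secs \<Longrightarrow> nested 6 u"
proof -
  have "nested 1 (enc_pair enc_nat enc_nat x)" for x
    by (cases x) (simp only: nested_pair nested_items)
  then have "nested 6 (enc_pair enc_nat enc_nat x)" for x by (rule nested_mono) simp
  moreover have "nested 6 (enc_quant x)" "nested 6 (enc_nat n)" "nested 6 (enc_rel r)" for x n r
    by (rule nested_mono[OF nested_items(5)] nested_mono[OF nested_items(1)] nested_mono[OF nested_items(4)]; simp)+
  ultimately show "u \<in> set secs \<Longrightarrow> nested 6 u"
    by (auto simp: secs_def intro!: nested_concat)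
qed

lemma occ_sec: "m < 6 \<Longrightarrow> occ (0, 0) w (start m) (1, m) (secs ! m)"
  unfolding w_secs start_def by (rule occ_sections) (auto simp: length_secs nested_secs)

lemma ltr_sec: "1 \<le> d \<Longrightarrow> a \<noteq> Close \<Longrightarrow> ltr (0, 0) w i a (d, s) \<longleftrightarrow>
    s < 6 \<and> (\<exists>j. i = start s + j \<and> ltr (1, s) (secs ! s) j a (d, s))"
  unfolding w_secs start_def by (subst ltr_sections) (auto simp: length_secs nested_secs)

lemma ltr_sec_concat:
  assumes "secs ! s = concat (map e xs)" "\<And>x. nested h (e x)" "h \<le> 6" "s < 6" "1 \<le> d" "a \<noteq> Close"
  shows "ltr (0, 0) w i a (d, s) \<longleftrightarrow> (\<exists>m<length xs. \<exists>j.
    i = start s + length (concat (map e (take m xs))) + j \<and> ltr (1, s) (e (xs ! m)) j a (d, s))"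
proof -
  have iff: "ltr (1, s) (concat (map e xs)) k a (d, s) \<longleftrightarrow> (\<exists>m<length xs. \<exists>j.
     k = length (concat (map e (take m xs))) + j \<and> ltr (1, s) (e (xs ! m)) j a (d, s))" for k
    using ltr_concat[of "map e xs" h 1 s k a "(d, s)"] assms(2,3)
    by (force simp: take_map cong: conj_cong)
  show ?thesis
    unfolding ltr_sec[OF assms(5,6)] assms(1) iff using assms(4) by (auto simp: add.assoc)
qed

lemma occ_sec_concat:
  assumes "secs ! s = concat (map e xs)" "\<And>x. nested h (e x)" "h \<le> 6" "s < 6" "m < length xs"
  shows "occ (0, 0) w (start s + length (concat (map e (take m xs)))) (1, s) (e (xs ! m))"
proof -
  have "occ (1, s) (concat (map e xs)) (length (concat (take m (map e xs)))) (1, s) (map e xs ! m)"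
    by (rule occ_concat[where h = h]) (use assms in auto)
  with occ_trans[OF occ_sec[OF assms(4), unfolded assms(1)]] show ?thesis
    using assms(5) by (simp add: take_map)
qed

definition elem_pos :: "nat \<Rightarrow> bool" where
  "elem_pos b \<longleftrightarrow> ltr (0, 0) w b Open (1, 4)"

lemma elem_pos:
  "elem_pos b \<Longrightarrow> \<exists>n\<in>set us'. natat w b n" "n \<in> set us' \<Longrightarrow> \<exists>b. elem_pos b \<and> natat w b n"
proof -
  have sec: "secs ! 4 = concat (map enc_nat us')" by (simp add: secs_def)
  let ?pos = "\<lambda>m. start 4 + length (concat (map enc_nat (take m us')))"
  have iff: "elem_pos b \<longleftrightarrow> (\<exists>m<length us'. b = ?pos m)" for b
    unfolding elem_pos_def using ltr_sec_concat[OF sec nested_items(1), of 1 Open b]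
    by (auto simp: ltr_enc_nat_Open)
  have nat: "natat w (?pos m) (us' ! m)" if "m < length us'" for m
    using natatI[OF occ_sec_concat[OF sec nested_items(1) _ _ that]] by simp
  show "elem_pos b \<Longrightarrow> \<exists>n\<in>set us'. natat w b n" using iff nat by fastforce
  show "n \<in> set us' \<Longrightarrow> \<exists>b. elem_pos b \<and> natat w b n" using iff nat by (metis in_set_conv_nth)
qed

text \<open>The successor skips the letter of the quantifier, which directly precedes the
  number.\<close>

definition var_pos :: "nat \<Rightarrow> nat" where
  "var_pos j = Suc (start 1 + length (concat (map enc_quant (take j p))))"

lemma var_pos_mono: "i < j \<Longrightarrow> j \<le> length p \<Longrightarrow> Suc (var_pos i) < var_pos j"
proof (induction j)
  case (Suc j)
  have "Suc (var_pos j) < var_pos (Suc j)"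
    using Suc.prems by (cases "p ! j") (simp add: var_pos_def take_Suc_conv_app_nth enc_pair_def enc_nat_br)
  then show ?case using Suc by (cases "i = j") auto
qed simp

lemma var_pos_natat: "j < length p \<Longrightarrow> natat w (var_pos j) (snd (p ! j))"
proof -
  assume j: "j < length p"
  have sec: "secs ! 1 = concat (map enc_quant p)" by (simp add: secs_def)
  have o: "occ (0, 0) w (start 1 + length (concat (map enc_quant (take j p)))) (1, 1) (enc_quant (p ! j))"
    by (rule occ_sec_concat[OF sec nested_items(5) _ _ j]) auto
  have "occ (1, 1) (enc_quant (p ! j)) 1 (foldl advance (1, 1) (enc_quantifier (fst (p ! j)))) (enc_nat (snd (p ! j)))"
    using occ_append2[of "(1, 1)" "enc_quantifier (fst (p ! j))" "enc_nat (snd (p ! j))"]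
    by (cases "fst (p ! j)") (simp_all add: enc_pair_def)
  from natatI[OF occ_trans[OF o this]] show ?thesis by (simp add: var_pos_def)
qed

text \<open>The digits of a variable are read at depth 2, so a \<open>Zero\<close> or
  \<open>One\<close> at depth 1 is always a quantifier.\<close>

lemma ltr_quant:
  "ltr (1, s) (enc_quant qv) j Open (1, s') \<longleftrightarrow> j = 1 \<and> s' = s"
  "ltr (1, s) (enc_quant qv) j Zero (1, s') \<longleftrightarrow> j = 0 \<and> fst qv = Exists \<and> s' = s"
  "ltr (1, s) (enc_quant qv) j One (1, s') \<longleftrightarrow> j = 0 \<and> fst qv = Forall \<and> s' = s"
proof -
  have bit: "\<not> ltr (1, s) (enc_nat n) i Zero (1, s')" "\<not> ltr (1, s) (enc_nat n) i One (1, s')" for n i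
    using ltr_br_depth[OF nested_bits[OF set_bits], of 1 0 s n i] by (auto simp: enc_nat_br)
  have f: "foldl advance (1, s) (enc_quantifier q) = (1, s)" "length (enc_quantifier q) = 1" for q
    by (cases q; simp)+
  have q: "ltr (1, s) (enc_quantifier q) j a (1, s') \<longleftrightarrow> j = 0 \<and> s' = s \<and> [a] = enc_quantifier q" for q a
    by (cases q; cases j) (auto simp: ltr_def)
  show "ltr (1, s) (enc_quant qv) j Open (1, s') \<longleftrightarrow> j = 1 \<and> s' = s"
    "ltr (1, s) (enc_quant qv) j Zero (1, s') \<longleftrightarrow> j = 0 \<and> fst qv = Exists \<and> s' = s"
    "ltr (1, s) (enc_quant qv) j One (1, s') \<longleftrightarrow> j = 0 \<and> fst qv = Forall \<and> s' = s"
    unfolding enc_pair_def ltr_append f q using bit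
    by (cases "fst qv"; auto simp: ltr_enc_nat_Open)+
qed

lemma prefix_pos:
  "ltr (0, 0) w v Open (1, 1) \<longleftrightarrow> (\<exists>j<length p. v = var_pos j)"
  "ltr (0, 0) w z Zero (1, 1) \<longleftrightarrow> (\<exists>j<length p. fst (p ! j) = Exists \<and> Suc z = var_pos j)"
  "ltr (0, 0) w z One (1, 1) \<longleftrightarrow> (\<exists>j<length p. fst (p ! j) = Forall \<and> Suc z = var_pos j)"
proof -
  have sec: "secs ! 1 = concat (map enc_quant p)" by (simp add: secs_def)
  have *: "ltr (0, 0) w v a (1, 1) \<longleftrightarrow> (\<exists>m<length p. \<exists>j.
      v = start 1 + length (concat (map enc_quant (take m p))) + j \<and> ltr (1, 1) (enc_quant (p ! m)) j a (1, 1))"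
    if "a \<noteq> Close" for v a
    by (rule ltr_sec_concat[OF sec nested_items(5)]) (use that in auto)
  show "ltr (0, 0) w v Open (1, 1) \<longleftrightarrow> (\<exists>j<length p. v = var_pos j)"
    unfolding *[of Open, OF input_symbol.distinct(11)] ltr_quant var_pos_def by auto
  show "ltr (0, 0) w z Zero (1, 1) \<longleftrightarrow> (\<exists>j<length p. fst (p ! j) = Exists \<and> Suc z = var_pos j)"
    unfolding *[of Zero, OF input_symbol.distinct(5)] ltr_quant var_pos_def by auto
  show "ltr (0, 0) w z One (1, 1) \<longleftrightarrow> (\<exists>j<length p. fst (p ! j) = Forall \<and> Suc z = var_pos j)"
    unfolding *[of One, OF input_symbol.distinct(9)] ltr_quant var_pos_def by auto
qed

lemma ltr_rel:
  assumes "s < 6"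
  shows "ltr (1, s) (enc_rel (R, ts)) i Open (2, s) \<longleftrightarrow> (\<exists>l<length ts.
    i = Suc (length (enc_nat R)) + length (concat (map (enc_list enc_nat) (take l ts))))"
proof -
  let ?n = "length (enc_nat R)"
  have f: "foldl advance (1, s) (enc_nat R) = (1, s)" using nestedD[OF nested_items(1)] by simp
  have nc: "nested 2 (concat (map (enc_list enc_nat) ts))"
    by (rule nested_enc_list(2)) (rule nested_items)
  have nt: "nested 1 (concat (map enc_nat t))" for t
    by (rule nested_enc_list(2)) (rule nested_items)
  have "ltr (1, s) (enc_rel (R, ts)) i Open (2, s) \<longleftrightarrow>
      ?n \<le> i \<and> ltr (1, s) (enc_list (enc_list enc_nat) ts) (i - ?n) Open (2, s)"
    unfolding enc_pair_def fst_conv snd_conv ltr_append f using ltr_enc_nat_Open[of 1 s R i "(2, s)"] by auto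
  also have "\<dots> \<longleftrightarrow> ?n \<le> i \<and> (\<exists>j. i - ?n = Suc j \<and> ltr (2, s) (concat (map (enc_list enc_nat) ts)) j Open (2, s))"
    unfolding enc_list_br[of "enc_list enc_nat" ts]
    using ltr_br[OF nc, where d = 1 and s = s and i = "i - ?n" and a = Open and d' = 2 and s' = s]
    by (auto simp: ltr_append ltr_def[of _ "[Close]"] numeral_2_eq_2)
  also have "\<dots> \<longleftrightarrow> ?n \<le> i \<and> (\<exists>l<length ts. i - ?n = Suc (length (concat (map (enc_list enc_nat) (take l ts)))))"
  proof -
    have tup: "ltr (2, s) (enc_list enc_nat t) k Open (2, s) \<longleftrightarrow> k = 0" for t k
      using ltr_br_depth[OF nt, where d = 2 and s = s and i = k and a = Open and s' = s] by (simp add: enc_list_br)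
    have "ltr (2, s) (concat (map (enc_list enc_nat) ts)) j Open (2, s) \<longleftrightarrow> (\<exists>l<length (map (enc_list enc_nat) ts). \<exists>k.
       j = length (concat (take l (map (enc_list enc_nat) ts))) + k \<and> ltr (2, s) (map (enc_list enc_nat) ts ! l) k Open (2, s))" for j
      by (rule ltr_concat[where h = 2]) (auto simp: nested_items)
    then have "ltr (2, s) (concat (map (enc_list enc_nat) ts)) j Open (2, s) \<longleftrightarrow>
       (\<exists>l<length ts. j = length (concat (map (enc_list enc_nat) (take l ts))))" for j
      by (simp add: tup take_map cong: conj_cong)
    then show ?thesis by auto
  qed
  finally show ?thesis by auto
qed

definition rel_list :: "nat \<Rightarrow> (nat \<times> nat list list) list" where
  "rel_list s = (if s = 3 then rs else rs')"

definition tup_pos :: "nat \<Rightarrow> nat \<Rightarrow> nat \<Rightarrow> nat" where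
  "tup_pos s m l = start s + length (concat (map enc_rel (take m (rel_list s)))) +
     Suc (length (enc_nat (fst (rel_list s ! m)))) + length (concat (map (enc_list enc_nat) (take l (snd (rel_list s ! m)))))"

lemma tup_pos_iff:
  assumes "s = 3 \<or> s = 5"
  shows "ltr (0, 0) w x Open (2, s) \<longleftrightarrow>
    (\<exists>m<length (rel_list s). \<exists>l<length (snd (rel_list s ! m)). x = tup_pos s m l)"
proof -
  have sec: "secs ! s = concat (map enc_rel (rel_list s))" using assms by (auto simp: secs_def rel_list_def)
  have a: "ltr (0, 0) w x Open (2, s) \<longleftrightarrow> (\<exists>m<length (rel_list s). \<exists>j.
    x = start s + length (concat (map enc_rel (take m (rel_list s)))) + j \<and> ltr (1, s) (enc_rel (rel_list s ! m)) j Open (2, s))"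
    by (rule ltr_sec_concat[OF sec nested_items(4)]) (use assms in auto)
  have "s < 6" using assms by auto
  have c: "ltr (1, s) (enc_rel (rel_list s ! m)) j Open (2, s) \<longleftrightarrow> (\<exists>l<length (snd (rel_list s ! m)).
    j = Suc (length (enc_nat (fst (rel_list s ! m)))) + length (concat (map (enc_list enc_nat) (take l (snd (rel_list s ! m))))))" for m j
    using ltr_rel[OF \<open>s < 6\<close>, of "fst (rel_list s ! m)" "snd (rel_list s ! m)" j] by simp
  show ?thesis unfolding a c tup_pos_def add.assoc by blast
qed

lemma tup_pos:
  assumes s: "s = 3 \<or> s = 5" and m: "m < length (rel_list s)" and l: "l < length (snd (rel_list s ! m))"
  shows "tupat w (tup_pos s m l) (snd (rel_list s ! m) ! l)"
    and "\<exists>r. relof w r (tup_pos s m l) \<and> natat w r (fst (rel_list s ! m))"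
proof -
  obtain R ts where R: "rel_list s ! m = (R, ts)" by fastforce
  let ?r = "start s + length (concat (map enc_rel (take m (rel_list s))))"
  let ?n = "length (enc_nat R)"
  let ?k = "length (concat (map (enc_list enc_nat) (take l ts)))"
  have sec: "secs ! s = concat (map enc_rel (rel_list s))" using s by (auto simp: secs_def rel_list_def)
  have pos: "tup_pos s m l = ?r + ?n + Suc ?k" using R by (simp add: tup_pos_def)
  have l': "l < length ts" using l R by simp
  have f: "foldl advance (1, s) (enc_nat R) = (1, s)" using nestedD[OF nested_items(1)] by simp
  have item: "occ (0, 0) w ?r (1, s) (enc_nat R @ enc_list (enc_list enc_nat) ts)"
  proof -
    have e: "enc_nat R @ enc_list (enc_list enc_nat) ts = enc_rel (rel_list s ! m)"
      by (simp add: R enc_pair_def)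
    show ?thesis unfolding e by (rule occ_sec_concat[OF sec nested_items(4) _ _ m]) (use s in auto)
  qed
  have nat: "occ (0, 0) w ?r (1, s) (enc_nat R)"
    using occ_trans[OF item occ_append1] by simp
  have lst: "occ (0, 0) w (?r + ?n) (1, s) (br (concat (map (enc_list enc_nat) ts)))"
    using occ_trans[OF item occ_append2] f by (simp add: enc_list_br)
  have inner: "occ (0, 0) w (?r + ?n + 1) (2, s) (concat (map (enc_list enc_nat) ts))"
    using occ_trans[OF lst occ_br[of 1]] by (simp add: numeral_2_eq_2)
  have "occ (2, s) (concat (map (enc_list enc_nat) ts)) ?k (2, s) (enc_list enc_nat (ts ! l))"
  proof -
    have "occ (2, s) (concat (map (enc_list enc_nat) ts)) (length (concat (take l (map (enc_list enc_nat) ts))))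
      (2, s) (map (enc_list enc_nat) ts ! l)"
      by (rule occ_concat[where h = 2]) (use l' in \<open>auto simp: nested_items\<close>)
    then show ?thesis using l' by (simp add: take_map)
  qed
  from tupatI[OF occ_trans[OF inner this]] show "tupat w (tup_pos s m l) (snd (rel_list s ! m) ! l)"
    unfolding pos using R by simp
  have "nested 5 (concat (map (enc_list enc_nat) ts))"
    by (rule nested_mono[of 2], rule nested_enc_list(2), rule nested_items) simp
  moreover have "?k \<le> length (concat (map (enc_list enc_nat) ts))"
    by (metis append_take_drop_id concat_append le_add1 length_append map_append)
  ultimately have "last_open1 w (?r + ?n) (?r + ?n + Suc ?k)"
    by (intro last_open1_br[OF lst]) auto
  moreover have "last_open1 w ?r (?r + ?n)"
  proof -
    \<comment> \<open>\<open>last_open1_br\<close> reaches only to the closing bracket of the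
      number; the list starts one position later, so this bracket is treated separately in
      \<open>B\<close>.\<close>
    have A: "last_open1 w ?r (?r + (?n - 1))" and B: "\<not> open1 w (?r + (?n - 1))"
    proof -
      have e: "enc_nat R = br (bits R)" by (rule enc_nat_br)
      have n: "nested 5 (bits R)" by (rule nested_bits[OF set_bits])
      show "last_open1 w ?r (?r + (?n - 1))"
        using last_open1_br[OF nat[unfolded e] n, of "?n - 1"] by (simp add: e)
      have "\<exists>d'\<ge>Suc 1. foldl advance (1, s) (take (?n - 1) (br (bits R))) = (d', s)"
        by (rule br_prefix[OF n]) (auto simp: e)
      then show "\<not> open1 w (?r + (?n - 1))"
        using occ_ctx[OF nat, of "?n - 1"] by (auto simp: e open1_def ltr_def)
    qed
    have n: "0 < ?n" by (simp add: enc_nat_br)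
    show ?thesis
      unfolding last_open1_def
    proof (intro conjI allI impI)
      show "?r < ?r + ?n" using n by simp
      show "open1 w ?r" using A by (simp add: last_open1_def)
      fix z assume "?r < z" "z < ?r + ?n"
      moreover from this have "z < ?r + (?n - 1) \<or> z = ?r + (?n - 1)" by linarith
      ultimately show "\<not> open1 w z" using A B by (auto simp: last_open1_def)
    qed
  qed
  ultimately have "relof w ?r (tup_pos s m l)" unfolding relof_def pos by blast
  then show "\<exists>r. relof w r (tup_pos s m l) \<and> natat w r (fst (rel_list s ! m))"
    using natatI[OF nat] R by auto
qed

lemma tuple_positions:
  assumes s: "s = 3 \<or> s = 5"
  shows "ltr (0, 0) w x Open (2, s) \<Longrightarrow> \<exists>R ts t r. (R, ts) \<in> set (rel_list s) \<and> t \<in> set ts \<and>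
      tupat w x t \<and> relof w r x \<and> natat w r R" (is "_ \<Longrightarrow> ?thesis1")
    and "(R, ts) \<in> set (rel_list s) \<Longrightarrow> t \<in> set ts \<Longrightarrow> \<exists>x r. ltr (0, 0) w x Open (2, s) \<and>
      tupat w x t \<and> relof w r x \<and> natat w r R" (is "_ \<Longrightarrow> _ \<Longrightarrow> ?thesis2")
proof -
  assume "ltr (0, 0) w x Open (2, s)"
  then obtain m l where ml: "m < length (rel_list s)" "l < length (snd (rel_list s ! m))" "x = tup_pos s m l"
    using tup_pos_iff[OF s] by blast
  have "(fst (rel_list s ! m), snd (rel_list s ! m)) \<in> set (rel_list s)" "snd (rel_list s ! m) ! l \<in> set (snd (rel_list s ! m))"
    using ml by auto
  then show ?thesis1 using tup_pos[OF s ml(1,2)] ml(3) by blast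
next
  assume "(R, ts) \<in> set (rel_list s)" "t \<in> set ts"
  then obtain m l where ml: "m < length (rel_list s)" "rel_list s ! m = (R, ts)" "l < length ts" "ts ! l = t"
    by (metis in_set_conv_nth)
  then have l: "l < length (snd (rel_list s ! m))" by simp
  have "ltr (0, 0) w (tup_pos s m l) Open (2, s)"
    using tup_pos_iff[OF s] ml(1) l by blast
  then show ?thesis2
    using tup_pos[OF s ml(1) l] ml(2,4) by auto
qed

end

section \<open>The game in first-order logic\<close>

declare addr.simps [simp del]

abbreviation Disj :: "fm \<Rightarrow> fm \<Rightarrow> fm" where
  "Disj \<phi> \<psi> \<equiv> Neg (Conj (Neg \<phi>) (Neg \<psi>))"

definition Lab :: "input_symbol \<Rightarrow> nat \<Rightarrow> nat \<Rightarrow> nat \<Rightarrow> fm" where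
  "Lab a d s i = Letter i (\<lambda>n. n = label a (d, s))"

definition Sym :: "input_symbol \<Rightarrow> nat \<Rightarrow> fm" where
  "Sym a i = Letter i (\<lambda>n. n mod 5 = symbol_code a)"

definition Open1 :: "nat \<Rightarrow> fm" where
  "Open1 i = Letter i (\<lambda>n. \<exists>s. n = label Open (1, s))"

lemma ev_Lab: "d < 8 \<Longrightarrow> ev w ar e xs (Lab a d s i) \<longleftrightarrow> ltr (0, 0) w (xs i) a (d, s)"
  by (simp add: Lab_def lab_eq_label_iff)

lemma ev_Open1: "ev w ar e xs (Open1 i) \<longleftrightarrow> open1 w (xs i)"
  by (simp add: Open1_def lab_eq_label_iff open1_def)

lemma ev_Sym: "ev w ar e xs (Sym a i) \<longleftrightarrow> xs i < length w \<and> w ! xs i = a"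
proof -
  have "symbol_code b < 5" for b by (cases b) auto
  then have m: "label b c mod 5 = symbol_code b" for b c
    unfolding label_def by (simp only: mod_mult_self2 mod_less)
  have "symbol_code b \<noteq> 0" for b by (cases b) auto
  moreover have "symbol_code b = symbol_code a \<longleftrightarrow> b = a" for b by (cases a; cases b) auto
  ultimately show ?thesis by (auto simp: Sym_def lab_def m)
qed

text \<open>The sections 0 to 5 of the input are the signature, the prefix, and the universe and the
  relations of each of the two structures.\<close>

definition tupA :: "input_word \<Rightarrow> nat \<Rightarrow> bool" where "tupA w x \<longleftrightarrow> ltr (0, 0) w x Open (2, 3)"
definition tupB :: "input_word \<Rightarrow> nat \<Rightarrow> bool" where "tupB w x \<longleftrightarrow> ltr (0, 0) w x Open (2, 5)"

text \<open>\<open>comes_after\<close> for a universal \<open>v\<close>, read off the word: a later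
  variable shares the block of \<open>v\<close> iff no existential quantifier letter stands between
  them. \<open>a\<close> is any occurrence of the variable, \<open>u\<close> the one in the
  prefix.\<close>

definition bef :: "input_word \<Rightarrow> nat \<Rightarrow> nat \<Rightarrow> bool" where
  "bef w v a \<longleftrightarrow> (\<exists>u\<le>length w. ltr (0, 0) w u Open (1, 1) \<and> num w a u \<and> u \<noteq> v \<and>
     (u < v \<or> \<not> (\<exists>z\<le>length w. v < z \<and> z < u \<and> ltr (0, 0) w z Zero (1, 1))))"

definition same_rel :: "input_word \<Rightarrow> nat \<Rightarrow> nat \<Rightarrow> bool" where
  "same_rel w x y \<longleftrightarrow> tupA w x \<and> tupB w y \<and>
     (\<exists>r\<le>length w. \<exists>s\<le>length w. relof w r x \<and> relof w s y \<and> num w r s)"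

text \<open>Agreement of two positions of the game is a condition on pairs of single tuples. Tables
  of arity at most 5 therefore suffice for every \<open>k\<close>.\<close>

definition ag :: "input_word \<Rightarrow> nat \<Rightarrow> nat \<Rightarrow> nat \<Rightarrow> nat \<Rightarrow> bool" where
  "ag w x y x' y' \<longleftrightarrow> \<not> (\<exists>p\<le>length w. \<exists>q\<le>length w. \<exists>p'\<le>length w. \<exists>q'\<le>length w.
     mapr w x y p q \<and> mapr w x' y' p' q' \<and> num w p p' \<and> \<not> num w q q')"

definition agv :: "input_word \<Rightarrow> nat \<Rightarrow> nat \<Rightarrow> nat \<Rightarrow> nat \<Rightarrow> nat \<Rightarrow> bool" where
  "agv w v x y x' y' \<longleftrightarrow> \<not> (\<exists>p\<le>length w. \<exists>q\<le>length w. \<exists>p'\<le>length w. \<exists>q'\<le>length w.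
     mapr w x y p q \<and> mapr w x' y' p' q' \<and> num w p p' \<and> bef w v p \<and> \<not> num w q q')"

definition vl :: "input_word \<Rightarrow> nat \<Rightarrow> nat \<Rightarrow> nat \<Rightarrow> nat \<Rightarrow> bool" where
  "vl w v b x y \<longleftrightarrow> \<not> (\<exists>p\<le>length w. \<exists>q\<le>length w. mapr w x y p q \<and> num w p v \<and> \<not> num w q b)"

text \<open>The place in the list is the number of the array. Each table is defined from earlier
  ones and, where it is a proper least fixed point, from itself; array 12 is left for the bad
  positions.\<close>

definition specs :: "input_word \<Rightarrow> (nat \<times> (nat list \<Rightarrow> bool)) list" where
  "specs w = [
    (2, \<lambda>z. z ! 0 = z ! 1),
    (2, \<lambda>z. z ! 1 = Suc (z ! 0)),
    (2, \<lambda>z. z ! 0 < z ! 1),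
    (2, \<lambda>z. num w (z ! 0) (z ! 1)),
    (2, \<lambda>z. next_item w (z ! 0) (z ! 1)),
    (4, \<lambda>z. mapr w (z ! 0) (z ! 1) (z ! 2) (z ! 3)),
    (2, \<lambda>z. relof w (z ! 0) (z ! 1)),
    (2, \<lambda>z. same_rel w (z ! 0) (z ! 1)),
    (4, \<lambda>z. ag w (z ! 0) (z ! 1) (z ! 2) (z ! 3)),
    (2, \<lambda>z. bef w (z ! 0) (z ! 1)),
    (5, \<lambda>z. agv w (z ! 0) (z ! 1) (z ! 2) (z ! 3) (z ! 4)),
    (4, \<lambda>z. vl w (z ! 0) (z ! 1) (z ! 2) (z ! 3))]"

definition readable :: "input_word \<Rightarrow> nat \<Rightarrow> (nat \<Rightarrow> nat \<Rightarrow> bool) \<Rightarrow> bool" where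
  "readable w n ar \<longleftrightarrow> (\<forall>b<n. \<forall>z\<in>tuples (length w) (fst (specs w ! b)).
     ar b (addr (length w) z) \<longleftrightarrow> snd (specs w ! b) z)"

text \<open>Later arrays are still empty, which is where the next fixed point iteration has to
  start.\<close>

definition computed :: "input_word \<Rightarrow> nat \<Rightarrow> (nat \<Rightarrow> nat \<Rightarrow> bool) \<Rightarrow> bool" where
  "computed w n ar \<longleftrightarrow> readable w n ar \<and> (\<forall>b\<ge>n. ar b = (\<lambda>_. False))"

section \<open>Tables and the stages that compute them\<close>

lemma tuples_iff:
  "[x0, x1] \<in> tuples N 2 \<longleftrightarrow> x0 \<le> N \<and> x1 \<le> N"
  "[x0, x1, x2, x3] \<in> tuples N 4 \<longleftrightarrow> x0 \<le> N \<and> x1 \<le> N \<and> x2 \<le> N \<and> x3 \<le> N"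
  "[x0, x1, x2, x3, x4] \<in> tuples N 5 \<longleftrightarrow> x0 \<le> N \<and> x1 \<le> N \<and> x2 \<le> N \<and> x3 \<le> N \<and> x4 \<le> N"
  by (auto simp: tuples_def)

lemma addr_eq_iff:
  assumes "zs \<in> tuples N c" "ys \<in> tuples N c"
  shows "addr N zs = addr N ys \<longleftrightarrow> zs = ys"
  using assms addr_inj[of zs ys N] unfolding tuples_def by auto

lemma tuplesE:
  "zs \<in> tuples N 2 \<Longrightarrow> (\<And>x0 x1. zs = [x0, x1] \<Longrightarrow> x0 \<le> N \<Longrightarrow> x1 \<le> N \<Longrightarrow> thesis) \<Longrightarrow> thesis"
  "zs \<in> tuples N 4 \<Longrightarrow> (\<And>x0 x1 x2 x3. zs = [x0, x1, x2, x3] \<Longrightarrow> x0 \<le> N \<Longrightarrow> x1 \<le> N \<Longrightarrow>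
     x2 \<le> N \<Longrightarrow> x3 \<le> N \<Longrightarrow> thesis) \<Longrightarrow> thesis"
  "zs \<in> tuples N 5 \<Longrightarrow> (\<And>x0 x1 x2 x3 x4. zs = [x0, x1, x2, x3, x4] \<Longrightarrow> x0 \<le> N \<Longrightarrow> x1 \<le> N \<Longrightarrow>
     x2 \<le> N \<Longrightarrow> x3 \<le> N \<Longrightarrow> x4 \<le> N \<Longrightarrow> thesis) \<Longrightarrow> thesis"
  by (auto simp: tuples_def length_Suc_conv eval_nat_numeral)

lemma readable_iff:
  assumes "readable w n ar"
  shows "0 < n \<Longrightarrow> x \<le> length w \<Longrightarrow> y \<le> length w \<Longrightarrow> ar 0 (addr (length w) [x, y]) \<longleftrightarrow> x = y"
    "1 < n \<Longrightarrow> x \<le> length w \<Longrightarrow> y \<le> length w \<Longrightarrow> ar 1 (addr (length w) [x, y]) \<longleftrightarrow> y = Suc x"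
    "2 < n \<Longrightarrow> x \<le> length w \<Longrightarrow> y \<le> length w \<Longrightarrow> ar 2 (addr (length w) [x, y]) \<longleftrightarrow> x < y"
    "3 < n \<Longrightarrow> x \<le> length w \<Longrightarrow> y \<le> length w \<Longrightarrow> ar 3 (addr (length w) [x, y]) \<longleftrightarrow> num w x y"
    "4 < n \<Longrightarrow> x \<le> length w \<Longrightarrow> y \<le> length w \<Longrightarrow> ar 4 (addr (length w) [x, y]) \<longleftrightarrow> next_item w x y"
    "5 < n \<Longrightarrow> x \<le> length w \<Longrightarrow> y \<le> length w \<Longrightarrow> p \<le> length w \<Longrightarrow> q \<le> length w \<Longrightarrow>
      ar 5 (addr (length w) [x, y, p, q]) \<longleftrightarrow> mapr w x y p q"
    "6 < n \<Longrightarrow> x \<le> length w \<Longrightarrow> y \<le> length w \<Longrightarrow> ar 6 (addr (length w) [x, y]) \<longleftrightarrow> relof w x y"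
    "7 < n \<Longrightarrow> x \<le> length w \<Longrightarrow> y \<le> length w \<Longrightarrow> ar 7 (addr (length w) [x, y]) \<longleftrightarrow> same_rel w x y"
    "8 < n \<Longrightarrow> x \<le> length w \<Longrightarrow> y \<le> length w \<Longrightarrow> p \<le> length w \<Longrightarrow> q \<le> length w \<Longrightarrow>
      ar 8 (addr (length w) [x, y, p, q]) \<longleftrightarrow> ag w x y p q"
    "9 < n \<Longrightarrow> x \<le> length w \<Longrightarrow> y \<le> length w \<Longrightarrow> ar 9 (addr (length w) [x, y]) \<longleftrightarrow> bef w x y"
    "10 < n \<Longrightarrow> v \<le> length w \<Longrightarrow> x \<le> length w \<Longrightarrow> y \<le> length w \<Longrightarrow> p \<le> length w \<Longrightarrow> q \<le> length w \<Longrightarrow>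
      ar 10 (addr (length w) [v, x, y, p, q]) \<longleftrightarrow> agv w v x y p q"
    "11 < n \<Longrightarrow> x \<le> length w \<Longrightarrow> y \<le> length w \<Longrightarrow> p \<le> length w \<Longrightarrow> q \<le> length w \<Longrightarrow>
      ar 11 (addr (length w) [x, y, p, q]) \<longleftrightarrow> vl w x y p q"
  using assms[unfolded readable_def, rule_format, of 0 "[x, y]"]
    assms[unfolded readable_def, rule_format, of 1 "[x, y]"]
    assms[unfolded readable_def, rule_format, of 2 "[x, y]"]
    assms[unfolded readable_def, rule_format, of 3 "[x, y]"]
    assms[unfolded readable_def, rule_format, of 4 "[x, y]"]
    assms[unfolded readable_def, rule_format, of 5 "[x, y, p, q]"]
    assms[unfolded readable_def, rule_format, of 6 "[x, y]"]
    assms[unfolded readable_def, rule_format, of 7 "[x, y]"]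
    assms[unfolded readable_def, rule_format, of 8 "[x, y, p, q]"]
    assms[unfolded readable_def, rule_format, of 9 "[x, y]"]
    assms[unfolded readable_def, rule_format, of 10 "[v, x, y, p, q]"]
    assms[unfolded readable_def, rule_format, of 11 "[x, y, p, q]"]
  by (simp_all add: specs_def tuples_iff)

lemma readable_upd: "readable w a ar \<Longrightarrow> readable w a (ar(a := t))"
  by (auto simp: readable_def)

text \<open>Of the arrays below \<open>m\<close> the formula may use only that they are
  \<open>readable\<close>; then it depends on the current contents through \<open>Z\<close> alone.
  Closure and minimality identify the relation \<open>Q\<close> with the least fixed point.\<close>

lemma fix_stage_lfp:
  assumes ar0: "readable w m ar0" "m \<le> a" "ar0 a = (\<lambda>_. False)"
    and ev: "\<And>ar Z zs. readable w m ar \<Longrightarrow> Z \<subseteq> tuples (length w) c \<Longrightarrow>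
      (\<And>ys. ys \<in> tuples (length w) c \<Longrightarrow> ar a (addr (length w) ys) \<longleftrightarrow> ys \<in> Z) \<Longrightarrow>
      zs \<in> tuples (length w) c \<Longrightarrow> ev w ar c (val zs) \<phi> \<longleftrightarrow> \<Phi> Z zs"
    and mono: "\<And>Z Z' zs. Z \<subseteq> Z' \<Longrightarrow> \<Phi> Z zs \<Longrightarrow> \<Phi> Z' zs"
    and closed: "\<And>zs. zs \<in> tuples (length w) c \<Longrightarrow> \<Phi> {zs \<in> tuples (length w) c. Q zs} zs \<Longrightarrow> Q zs"
    and least: "\<And>Z zs. (\<And>zs. zs \<in> tuples (length w) c \<Longrightarrow> \<Phi> Z zs \<Longrightarrow> zs \<in> Z) \<Longrightarrow>
      zs \<in> tuples (length w) c \<Longrightarrow> Q zs \<Longrightarrow> zs \<in> Z"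
  shows "sem w 0 (\<lambda>_. 0) (fix_stage a c \<phi>) ar0 = ar0(a := table (length w) {zs \<in> tuples (length w) c. Q zs})"
proof (rule sem_fix_stage[where \<Phi> = \<Phi>])
  fix T ys assume T: "T \<subseteq> tuples (length w) c" "ys \<in> tuples (length w) c"
  show "ev w (ar0(a := table (length w) T)) c (val ys) \<phi> \<longleftrightarrow> \<Phi> T ys"
  proof (rule ev[OF _ T(1) _ T(2)])
    show "readable w m (ar0(a := table (length w) T))"
      using ar0(1,2) by (auto simp: readable_def)
  qed (simp add: table_iff[OF T(1)])
next
  show "\<Phi> T' ys" if "T \<subseteq> T'" "\<Phi> T ys" for T T' ys using mono that by blast
next
  show "ys \<in> {zs \<in> tuples (length w) c. Q zs}"
    if "ys \<in> tuples (length w) c" "\<Phi> {zs \<in> tuples (length w) c. Q zs} ys" for ys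
    using closed that by blast
next
  show "{zs \<in> tuples (length w) c. Q zs} \<subseteq> Z"
    if "\<And>ys. ys \<in> tuples (length w) c \<Longrightarrow> \<Phi> Z ys \<Longrightarrow> ys \<in> Z" for Z
    using least[of Z] that by blast
qed (use ar0 in auto)

lemma computed_Suc:
  assumes "computed w a ar0" "specs w ! a = (c, Q)"
  shows "computed w (Suc a) (ar0(a := table (length w) {zs \<in> tuples (length w) c. Q zs}))"
proof -
  have "table (length w) {zs \<in> tuples (length w) c. Q zs} (addr (length w) z) = Q z"
    if "z \<in> tuples (length w) c" for z
    using table_iff[of "{zs \<in> tuples (length w) c. Q zs}" "length w" c z] that by auto
  then show ?thesis
    using assms by (auto simp: computed_def readable_def less_Suc_eq)
qed

text \<open>An explicit definition is the least fixed point of a constant operator, so the same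
  program form serves for it.\<close>

lemma computed_stage:
  assumes "computed w a ar0" "specs w ! a = (c, Q)"
    and "\<And>ar zs. readable w a ar \<Longrightarrow> zs \<in> tuples (length w) c \<Longrightarrow> ev w ar c (val zs) \<phi> \<longleftrightarrow> Q zs"
  shows "computed w (Suc a) (sem w 0 (\<lambda>_. 0) (fix_stage a c \<phi>) ar0)"
proof -
  have "sem w 0 (\<lambda>_. 0) (fix_stage a c \<phi>) ar0 = ar0(a := table (length w) {zs \<in> tuples (length w) c. Q zs})"
    by (rule fix_stage_lfp[where \<Phi> = "\<lambda>_. Q" and m = a]) (use assms in \<open>auto simp: computed_def\<close>)
  then show ?thesis using computed_Suc[OF assms(1,2)] by simp
qed

lemma computed_stage_lfp:
  assumes "computed w a ar0" "specs w ! a = (c, Q)"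
    and "\<And>ar Z zs. readable w a ar \<Longrightarrow> Z \<subseteq> tuples (length w) c \<Longrightarrow>
      (\<And>ys. ys \<in> tuples (length w) c \<Longrightarrow> ar a (addr (length w) ys) \<longleftrightarrow> ys \<in> Z) \<Longrightarrow>
      zs \<in> tuples (length w) c \<Longrightarrow> ev w ar c (val zs) \<phi> \<longleftrightarrow> \<Phi> Z zs"
    and "\<And>Z Z' zs. Z \<subseteq> Z' \<Longrightarrow> \<Phi> Z zs \<Longrightarrow> \<Phi> Z' zs"
    and "\<And>zs. zs \<in> tuples (length w) c \<Longrightarrow> \<Phi> {zs \<in> tuples (length w) c. Q zs} zs \<Longrightarrow> Q zs"
    and "\<And>Z zs. (\<And>zs. zs \<in> tuples (length w) c \<Longrightarrow> \<Phi> Z zs \<Longrightarrow> zs \<in> Z) \<Longrightarrow>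
      zs \<in> tuples (length w) c \<Longrightarrow> Q zs \<Longrightarrow> zs \<in> Z"
  shows "computed w (Suc a) (sem w 0 (\<lambda>_. 0) (fix_stage a c \<phi>) ar0)"
proof -
  have "sem w 0 (\<lambda>_. 0) (fix_stage a c \<phi>) ar0 = ar0(a := table (length w) {zs \<in> tuples (length w) c. Q zs})"
    by (rule fix_stage_lfp[where \<Phi> = \<Phi> and m = a]) (use assms in \<open>auto simp: computed_def\<close>)
  then show ?thesis using computed_Suc[OF assms(1,2)] by simp
qed

lemma addr2: "addr N [x, y] = x * Suc N + y"
  by (simp add: addr.simps)

lemma computed_eq:
  "computed w 1 (sem w 0 (\<lambda>_. 0) (For (Mark 0 [0, 0] 0)) (\<lambda>_ _. False))"
proof -
  let ?N = "length w"
  have "fold (\<lambda>y ar. ar(0 := (ar 0)(addr ?N [y, y] := True))) ys (\<lambda>_ _. False) =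
    (\<lambda>b n. b = (0::nat) \<and> (\<exists>y\<in>set ys. n = addr ?N [y, y]))" for ys
    by (induction ys rule: rev_induct) (auto simp: fun_eq_iff)
  moreover have "sem w (Suc 0) ((\<lambda>_. 0)(0 := y)) (Mark 0 [0, 0] 0) = (\<lambda>ar. ar(0 := (ar 0)(addr ?N [y, y] := True)))" for y
    by (rule ext) simp
  ultimately have s: "sem w 0 (\<lambda>_. 0) (For (Mark 0 [0, 0] 0)) (\<lambda>_ _. False) =
    (\<lambda>b n. b = 0 \<and> (\<exists>y\<in>{..?N}. n = addr ?N [y, y]))"
    by (simp add: atLeast0LessThan lessThan_Suc_atMost del: upt_Suc)
  have "(\<exists>y\<in>{..?N}. addr ?N z = addr ?N [y, y]) \<longleftrightarrow> z ! 0 = z ! 1" if zt: "z \<in> tuples ?N 2" for z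
  proof -
    obtain x0 x1 where z: "z = [x0, x1]" "x0 \<le> ?N" "x1 \<le> ?N" by (rule tuplesE(1)[OF zt])
    have "addr ?N [x0, x1] = addr ?N [y, y] \<longleftrightarrow> [x0, x1] = [y, y]" if "y \<le> ?N" for y
      using addr_eq_iff[of "[x0, x1]" ?N 2 "[y, y]"] that z by (simp add: tuples_iff)
    then show ?thesis using z by auto
  qed
  then show ?thesis unfolding s by (simp add: computed_def readable_def specs_def)
qed

text \<open>The marks go one cell to the right of the diagonal. For \<open>y = length w\<close> that
  cell lies behind the addresses of all pairs, so no wrong pair is added.\<close>

lemma computed_succ:
  assumes "computed w 1 ar0"
  shows "computed w 2 (sem w 0 (\<lambda>_. 0) (For (Mark 1 [0, 0] 1)) ar0)"
proof -
  let ?N = "length w"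
  have "fold (\<lambda>y ar. ar(1 := (ar 1)(Suc (addr ?N [y, y]) := True))) ys ar0 =
    ar0(1 := \<lambda>n. ar0 1 n \<or> (\<exists>y\<in>set ys. n = Suc (addr ?N [y, y])))" for ys
    by (induction ys rule: rev_induct) (auto simp: fun_eq_iff)
  moreover have "sem w (Suc 0) ((\<lambda>_. 0)(0 := y)) (Mark 1 [0, 0] 1) = (\<lambda>ar. ar(1 := (ar 1)(Suc (addr ?N [y, y]) := True)))" for y
    by (rule ext) simp
  ultimately have s: "sem w 0 (\<lambda>_. 0) (For (Mark 1 [0, 0] 1)) ar0 =
    ar0(1 := \<lambda>n. (\<exists>y\<in>{..?N}. n = Suc (addr ?N [y, y])))"
    using assms by (simp add: computed_def atLeast0LessThan lessThan_Suc_atMost del: upt_Suc)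
  have "(\<exists>y\<in>{..?N}. addr ?N z = Suc (addr ?N [y, y])) \<longleftrightarrow> z ! 1 = Suc (z ! 0)" if zt: "z \<in> tuples ?N 2" for z
  proof -
    obtain x0 x1 where z: "z = [x0, x1]" "x0 \<le> ?N" "x1 \<le> ?N" by (rule tuplesE(1)[OF zt])
    have "addr ?N [x0, x1] = Suc (addr ?N [y, y]) \<longleftrightarrow> x0 = y \<and> x1 = Suc y" if "y \<le> ?N" for y
    proof (cases "y = ?N")
      case True
      have "addr ?N [x0, x1] < Suc ?N ^ length [x0, x1]" by (rule addr_less) (use z in auto)
      also have "Suc ?N ^ length [x0, x1] = Suc (addr ?N [y, y])" using True by (simp add: addr2 power2_eq_square)
      finally show ?thesis using True z by simp
    next
      case False
      then have "Suc (addr ?N [y, y]) = addr ?N [y, Suc y]" by (simp add: addr2)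
      then show ?thesis using addr_eq_iff[of "[x0, x1]" ?N 2 "[y, Suc y]"] that False z
        by (simp add: tuples_iff)
    qed
    then show ?thesis using z by auto
  qed
  then show ?thesis using assms unfolding s
    by (auto simp: computed_def readable_def specs_def less_2_cases_iff)
qed

section \<open>The formulas of the tables\<close>

definition less_fm :: fm where
  "less_fm = Disj (Rel 1 [0, 1]) (Ex (Conj (Rel 2 [0, 2]) (Rel 1 [2, 1])))"

definition num_fm :: fm where
  "num_fm = Disj (Conj (Sym Close 0) (Sym Close 1))
     (Conj (Disj (Conj (Sym Zero 0) (Sym Zero 1)) (Disj (Conj (Sym One 0) (Sym One 1)) (Conj (Sym Open 0) (Sym Open 1))))
       (Ex (Ex (Conj (Rel 1 [0, 2]) (Conj (Rel 1 [1, 3]) (Rel 3 [2, 3]))))))"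

definition next_fm :: fm where
  "next_fm = Ex (Conj (Sym Close 2) (Conj (Rel 1 [2, 1]) (Conj (Rel 2 [0, 2]) (Conj (Sym Open 1)
     (Neg (Ex (Conj (Rel 2 [0, 3]) (Conj (Rel 2 [3, 2]) (Sym Close 3)))))))))"

definition mapr_fm :: fm where
  "mapr_fm = Disj (Conj (Rel 1 [0, 2]) (Conj (Rel 1 [1, 3]) (Conj (Sym Open 2) (Sym Open 3))))
     (Ex (Ex (Conj (Rel 5 [0, 1, 4, 5]) (Conj (Rel 4 [4, 2]) (Rel 4 [5, 3])))))"

text \<open>The bound variable has number 3, so the formula is made for a place below exactly three
  variables, as in \<open>relof_fm\<close>.\<close>

definition last_fm :: "nat \<Rightarrow> nat \<Rightarrow> fm" where
  "last_fm i j = Conj (Rel 2 [i, j]) (Conj (Open1 i)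
     (Neg (Ex (Conj (Rel 2 [i, 3]) (Conj (Rel 2 [3, j]) (Open1 3))))))"

definition relof_fm :: fm where
  "relof_fm = Ex (Conj (last_fm 0 2) (last_fm 2 1))"

definition same_rel_fm :: fm where
  "same_rel_fm = Conj (Lab Open 2 3 0) (Conj (Lab Open 2 5 1)
     (Ex (Ex (Conj (Rel 6 [2, 0]) (Conj (Rel 6 [3, 1]) (Rel 3 [2, 3]))))))"

definition ag_fm :: fm where
  "ag_fm = Neg (Ex (Ex (Ex (Ex (Conj (Rel 5 [0, 1, 4, 5]) (Conj (Rel 5 [2, 3, 6, 7])
     (Conj (Rel 3 [4, 6]) (Neg (Rel 3 [5, 7])))))))))"

definition bef_fm :: fm where
  "bef_fm = Ex (Conj (Lab Open 1 1 2) (Conj (Rel 3 [1, 2]) (Conj (Neg (Rel 0 [2, 0]))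
     (Disj (Rel 2 [2, 0]) (Neg (Ex (Conj (Rel 2 [0, 3]) (Conj (Rel 2 [3, 2]) (Lab Zero 1 1 3)))))))))"

definition agv_fm :: fm where
  "agv_fm = Neg (Ex (Ex (Ex (Ex (Conj (Rel 5 [1, 2, 5, 6]) (Conj (Rel 5 [3, 4, 7, 8])
     (Conj (Rel 3 [5, 7]) (Conj (Rel 9 [0, 5]) (Neg (Rel 3 [6, 8]))))))))))"

definition vl_fm :: fm where
  "vl_fm = Neg (Ex (Ex (Conj (Rel 5 [2, 3, 4, 5]) (Conj (Rel 3 [4, 0]) (Neg (Rel 3 [5, 1]))))))"

section \<open>Correctness of the tables\<close>

lemmas ev_simps = ev_Lab ev_Open1 ev_Sym assign_def

lemma computed_less:
  assumes "computed w 2 ar0"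
  shows "computed w 3 (sem w 0 (\<lambda>_. 0) (fix_stage 2 2 less_fm) ar0)"
proof -
  let ?N = "length w"
  let ?\<Phi> = "\<lambda>Z z. z ! 1 = Suc (z ! 0) \<or> (\<exists>y\<le>?N. [z ! 0, y] \<in> Z \<and> z ! 1 = Suc y)"
  have "computed w (Suc 2) (sem w 0 (\<lambda>_. 0) (fix_stage 2 2 less_fm) ar0)"
  proof (rule computed_stage_lfp[OF assms, where \<Phi> = ?\<Phi>])
    show "specs w ! 2 = (2, \<lambda>z. z ! 0 < z ! 1)" by (simp add: specs_def)
  next
    fix ar Z zs assume r: "readable w 2 ar" and Z: "\<And>ys. ys \<in> tuples ?N 2 \<Longrightarrow> ar 2 (addr ?N ys) \<longleftrightarrow> ys \<in> Z"
      and zs: "zs \<in> tuples ?N 2"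
    obtain x y where z: "zs = [x, y]" "x \<le> ?N" "y \<le> ?N"
      using zs by (rule tuplesE(1))
    show "ev w ar 2 (val zs) less_fm \<longleftrightarrow> ?\<Phi> Z zs"
      using z(2,3) unfolding z(1)
      by (simp add: less_fm_def ev_simps readable_iff[OF r] readable_iff(2)[OF r, unfolded One_nat_def] Z tuples_iff cong: conj_cong; (blast | auto simp: less_le)?)
  next
    fix Z zs assume Z: "\<And>zs. zs \<in> tuples ?N 2 \<Longrightarrow> ?\<Phi> Z zs \<Longrightarrow> zs \<in> Z" and zs: "zs \<in> tuples ?N 2" "zs ! 0 < zs ! 1"
    obtain x y where xy: "zs = [x, y]" "x \<le> ?N" "y \<le> ?N" using zs(1) by (rule tuplesE(1))
    then have z: "zs = [x, y]" "x \<le> ?N" "y \<le> ?N" "x < y" using zs(2) by auto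
    have "[x, Suc (x + i)] \<in> Z" if "Suc (x + i) \<le> ?N" for i
      using that
    proof (induction i)
      case 0
      then show ?case using Z[of "[x, Suc x]"] by (simp add: tuples_iff)
    next
      case (Suc i)
      then have "[x, Suc (x + i)] \<in> Z" by simp
      then show ?case using Z[of "[x, Suc (x + Suc i)]"] Suc.prems by (auto simp: tuples_iff)
    qed
    from this[of "y - x - 1"] show "zs \<in> Z" using z by simp
  qed auto
  then show ?thesis by (simp add: numeral_3_eq_3 numeral_2_eq_2)
qed

lemma computed_num:
  assumes "computed w 3 ar0"
  shows "computed w 4 (sem w 0 (\<lambda>_. 0) (fix_stage 3 2 num_fm) ar0)"
proof -
  let ?N = "length w"
  let ?\<Phi> = "\<lambda>Z z. z ! 0 < ?N \<and> z ! 1 < ?N \<and> (w ! (z ! 0) = Close \<and> w ! (z ! 1) = Close \<or>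
    w ! (z ! 0) = w ! (z ! 1) \<and> w ! (z ! 0) \<noteq> Close \<and> [Suc (z ! 0), Suc (z ! 1)] \<in> Z)"
  have sym: "a = Zero \<or> a = One \<or> a = Open \<longleftrightarrow> a \<noteq> Close" for a by (cases a) auto
  have "computed w (Suc 3) (sem w 0 (\<lambda>_. 0) (fix_stage 3 2 num_fm) ar0)"
  proof (rule computed_stage_lfp[OF assms, where \<Phi> = ?\<Phi>])
    show "specs w ! 3 = (2, \<lambda>z. num w (z ! 0) (z ! 1))" by (simp add: specs_def)
  next
    fix ar Z zs assume r: "readable w 3 ar" and Z: "\<And>ys. ys \<in> tuples ?N 2 \<Longrightarrow> ar 3 (addr ?N ys) \<longleftrightarrow> ys \<in> Z"
      and zs: "zs \<in> tuples ?N 2"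
    obtain x y where z: "zs = [x, y]" "x \<le> ?N" "y \<le> ?N"
      using zs by (rule tuplesE(1))
    have "ev w ar 2 (val zs) num_fm \<longleftrightarrow> (x < ?N \<and> w ! x = Close) \<and> y < ?N \<and> w ! y = Close \<or>
      ((x < ?N \<and> w ! x = Zero) \<and> y < ?N \<and> w ! y = Zero \<or> (x < ?N \<and> w ! x = One) \<and> y < ?N \<and> w ! y = One \<or>
       (x < ?N \<and> w ! x = Open) \<and> y < ?N \<and> w ! y = Open) \<and> (\<exists>p\<le>?N. \<exists>q\<le>?N. p = Suc x \<and> q = Suc y \<and> [p, q] \<in> Z)"
      using z(2,3) unfolding z(1)
      by (simp add: num_fm_def ev_simps readable_iff[OF r] readable_iff(2)[OF r, unfolded One_nat_def] Z tuples_iff cong: conj_cong; (blast | auto simp: less_le)?)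
    also have "\<dots> \<longleftrightarrow> ?\<Phi> Z zs"
      unfolding z(1) sym[symmetric] by auto
    finally show "ev w ar 2 (val zs) num_fm \<longleftrightarrow> ?\<Phi> Z zs" .
  next
    fix zs assume "zs \<in> tuples ?N 2" "?\<Phi> {zs \<in> tuples ?N 2. num w (zs ! 0) (zs ! 1)} zs"
    then show "num w (zs ! 0) (zs ! 1)" by (auto intro: num.Close num.step)
  next
    fix Z zs assume Z: "\<And>zs. zs \<in> tuples ?N 2 \<Longrightarrow> ?\<Phi> Z zs \<Longrightarrow> zs \<in> Z" and zs: "zs \<in> tuples ?N 2" "num w (zs ! 0) (zs ! 1)"
    have "[x, y] \<in> Z" if "num w x y" for x y
      using that
    proof induction
      case (Close p q)
      then show ?case using Z[of "[p, q]"] by (simp add: tuples_iff)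
    next
      case (step p q)
      then show ?case using Z[of "[p, q]"] by (simp add: tuples_iff)
    qed
    then show "zs \<in> Z" using zs(2) by (rule_tac tuplesE(1)[OF zs(1)]) auto
  qed blast
  then show ?thesis by (simp add: eval_nat_numeral)
qed

lemma computed_next:
  assumes "computed w 4 ar0"
  shows "computed w 5 (sem w 0 (\<lambda>_. 0) (fix_stage 4 2 next_fm) ar0)"
proof -
  let ?N = "length w"
  have "computed w (Suc 4) (sem w 0 (\<lambda>_. 0) (fix_stage 4 2 next_fm) ar0)"
  proof (rule computed_stage[OF assms])
    show "specs w ! 4 = (2, \<lambda>z. next_item w (z ! 0) (z ! 1))" by (simp add: specs_def)
  next
    fix ar zs assume r: "readable w 4 ar" and zs: "zs \<in> tuples ?N 2"
    obtain x y where z: "zs = [x, y]" "x \<le> ?N" "y \<le> ?N"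
      using zs by (rule tuplesE(1))
    have "ev w ar 2 (val zs) next_fm \<longleftrightarrow> (\<exists>z\<le>?N. (z < ?N \<and> w ! z = Close) \<and> y = Suc z \<and> x < z \<and>
      (y < ?N \<and> w ! y = Open) \<and> \<not> (\<exists>u\<le>?N. x < u \<and> u < z \<and> u < ?N \<and> w ! u = Close))"
      using z(2,3) unfolding z(1)
      by (simp add: next_fm_def ev_simps readable_iff[OF r] readable_iff(2)[OF r, unfolded One_nat_def] cong: conj_cong; (blast | auto simp: less_le)?)
    also have "\<dots> \<longleftrightarrow> next_item w x y"
    proof -
      have "(\<exists>u\<le>?N. x < u \<and> u < z \<and> u < ?N \<and> w ! u = Close) \<longleftrightarrow> (\<exists>u. x < u \<and> u < z \<and> w ! u = Close)" if "z < ?N" for z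
        using that by (meson dual_order.strict_trans less_imp_le)
      then show ?thesis unfolding next_item_def by (auto cong: conj_cong)
    qed
    finally show "ev w ar 2 (val zs) next_fm \<longleftrightarrow> next_item w (zs ! 0) (zs ! 1)" using z(1) by simp
  qed
  then show ?thesis by (simp add: eval_nat_numeral)
qed

lemma mapr_less: "mapr w x y p q \<Longrightarrow> p < length w \<and> q < length w"
  by (induction rule: mapr.induct) (auto simp: next_item_def)

lemma computed_mapr:
  assumes "computed w 5 ar0"
  shows "computed w 6 (sem w 0 (\<lambda>_. 0) (fix_stage 5 4 mapr_fm) ar0)"
proof -
  let ?N = "length w"
  let ?\<Phi> = "\<lambda>Z z. z ! 2 = Suc (z ! 0) \<and> z ! 3 = Suc (z ! 1) \<and> z ! 2 < ?N \<and> z ! 3 < ?N \<and> w ! (z ! 2) = Open \<and> w ! (z ! 3) = Open \<or>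
    (\<exists>p\<le>?N. \<exists>q\<le>?N. [z ! 0, z ! 1, p, q] \<in> Z \<and> next_item w p (z ! 2) \<and> next_item w q (z ! 3))"
  have "computed w (Suc 5) (sem w 0 (\<lambda>_. 0) (fix_stage 5 4 mapr_fm) ar0)"
  proof (rule computed_stage_lfp[OF assms, where \<Phi> = ?\<Phi>])
    show "specs w ! 5 = (4, \<lambda>z. mapr w (z ! 0) (z ! 1) (z ! 2) (z ! 3))" by (simp add: specs_def)
  next
    fix ar Z zs assume r: "readable w 5 ar" and Z: "\<And>ys. ys \<in> tuples ?N 4 \<Longrightarrow> ar 5 (addr ?N ys) \<longleftrightarrow> ys \<in> Z"
      and zs: "zs \<in> tuples ?N 4"
    obtain x y p q where z: "zs = [x, y, p, q]" "x \<le> ?N" "y \<le> ?N" "p \<le> ?N" "q \<le> ?N"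
      using zs by (rule tuplesE(2))
    have "ev w ar 4 (val zs) mapr_fm \<longleftrightarrow> p = Suc x \<and> q = Suc y \<and> (p < ?N \<and> w ! p = Open) \<and> (q < ?N \<and> w ! q = Open) \<or>
      (\<exists>p'\<le>?N. \<exists>q'\<le>?N. [x, y, p', q'] \<in> Z \<and> next_item w p' p \<and> next_item w q' q)"
      using z(2-) unfolding z(1)
      by (simp add: mapr_fm_def ev_simps readable_iff[OF r] readable_iff(2)[OF r, unfolded One_nat_def] Z tuples_iff cong: conj_cong; (blast | auto simp: less_le)?)
    also have "\<dots> \<longleftrightarrow> ?\<Phi> Z zs" unfolding z(1) by auto
    finally show "ev w ar 4 (val zs) mapr_fm \<longleftrightarrow> ?\<Phi> Z zs" .
  next
    fix zs assume "zs \<in> tuples ?N 4" "?\<Phi> {zs \<in> tuples ?N 4. mapr w (zs ! 0) (zs ! 1) (zs ! 2) (zs ! 3)} zs"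
    then show "mapr w (zs ! 0) (zs ! 1) (zs ! 2) (zs ! 3)" using mapr.first[of "zs ! 0" w "zs ! 1"]
      by (auto intro: mapr.step)
  next
    fix Z zs assume Z: "\<And>zs. zs \<in> tuples ?N 4 \<Longrightarrow> ?\<Phi> Z zs \<Longrightarrow> zs \<in> Z"
      and zs: "zs \<in> tuples ?N 4" "mapr w (zs ! 0) (zs ! 1) (zs ! 2) (zs ! 3)"
    obtain x y p q where xy: "zs = [x, y, p, q]" "x \<le> ?N" "y \<le> ?N"
      using zs(1) by (rule tuplesE(2))
    then have z: "zs = [x, y, p, q]" "x \<le> ?N" "y \<le> ?N" "mapr w x y p q" using zs(2) by auto
    have "[x, y, p, q] \<in> Z" using z(4)
    proof induction
      case first
      then show ?case using Z[of "[x, y, Suc x, Suc y]"] z(2,3) by (simp add: tuples_iff)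
    next
      case (step p' q' p q)
      have "p' < ?N" "q' < ?N" "p < ?N" "q < ?N"
        using mapr_less[OF step.hyps(1)] step.hyps by (auto simp: next_item_def)
      then show ?case using Z[of "[x, y, p, q]"] z(2,3) step by (auto simp: tuples_iff intro: less_imp_le)
    qed
    then show "zs \<in> Z" using z by simp
  qed blast
  then show ?thesis by (simp add: eval_nat_numeral)
qed

lemma computed_relof:
  assumes "computed w 6 ar0"
  shows "computed w 7 (sem w 0 (\<lambda>_. 0) (fix_stage 6 2 relof_fm) ar0)"
proof -
  let ?N = "length w"
  have "computed w (Suc 6) (sem w 0 (\<lambda>_. 0) (fix_stage 6 2 relof_fm) ar0)"
  proof (rule computed_stage[OF assms])
    show "specs w ! 6 = (2, \<lambda>z. relof w (z ! 0) (z ! 1))" by (simp add: specs_def)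
  next
    fix ar zs assume r: "readable w 6 ar" and zs: "zs \<in> tuples ?N 2"
    obtain x y where z: "zs = [x, y]" "x \<le> ?N" "y \<le> ?N"
      using zs by (rule tuplesE(1))
    let ?last = "\<lambda>i j. i < j \<and> open1 w i \<and> \<not> (\<exists>u\<le>?N. i < u \<and> u < j \<and> open1 w u)"
    have last: "?last i j \<longleftrightarrow> last_open1 w i j" if "j \<le> ?N" for i j
      unfolding last_open1_def using that by (meson le_trans less_imp_le)
    have "ev w ar 2 (val zs) relof_fm \<longleftrightarrow> (\<exists>j\<le>?N. ?last x j \<and> ?last j y)"
      using z(2,3) unfolding z(1)
      by (simp add: relof_fm_def last_fm_def ev_simps readable_iff[OF r] readable_iff(2)[OF r, unfolded One_nat_def] cong: conj_cong; (blast | auto simp: less_le)?)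
    also have "\<dots> \<longleftrightarrow> (\<exists>j\<le>?N. last_open1 w x j \<and> last_open1 w j y)"
      using last z(3) by blast
    also have "\<dots> \<longleftrightarrow> relof w x y"
      unfolding relof_def using z(3) by (meson last_open1_def le_trans less_imp_le)
    finally show "ev w ar 2 (val zs) relof_fm \<longleftrightarrow> relof w (zs ! 0) (zs ! 1)" using z(1) by simp
  qed
  then show ?thesis by (simp add: eval_nat_numeral)
qed

lemma computed_same_rel:
  assumes "computed w 7 ar0"
  shows "computed w 8 (sem w 0 (\<lambda>_. 0) (fix_stage 7 2 same_rel_fm) ar0)"
proof -
  have "computed w (Suc 7) (sem w 0 (\<lambda>_. 0) (fix_stage 7 2 same_rel_fm) ar0)"
  proof (rule computed_stage[OF assms])
    show "specs w ! 7 = (2, \<lambda>z. same_rel w (z ! 0) (z ! 1))" by (simp add: specs_def)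
  next
    fix ar zs assume r: "readable w 7 ar" and zs: "zs \<in> tuples (length w) 2"
    obtain x y where z: "zs = [x, y]" "x \<le> length w" "y \<le> length w"
      using zs by (rule tuplesE(1))
    show "ev w ar 2 (val zs) same_rel_fm \<longleftrightarrow> same_rel w (zs ! 0) (zs ! 1)"
      using z(2,3) unfolding z(1)
      by (simp add: same_rel_fm_def same_rel_def tupA_def tupB_def ev_simps readable_iff[OF r] readable_iff(2)[OF r, unfolded One_nat_def] cong: conj_cong; (blast | auto simp: less_le)?)
  qed
  then show ?thesis by (simp add: eval_nat_numeral)
qed

lemma computed_ag:
  assumes "computed w 8 ar0"
  shows "computed w 9 (sem w 0 (\<lambda>_. 0) (fix_stage 8 4 ag_fm) ar0)"
proof -
  have "computed w (Suc 8) (sem w 0 (\<lambda>_. 0) (fix_stage 8 4 ag_fm) ar0)"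
  proof (rule computed_stage[OF assms])
    show "specs w ! 8 = (4, \<lambda>z. ag w (z ! 0) (z ! 1) (z ! 2) (z ! 3))" by (simp add: specs_def)
  next
    fix ar zs assume r: "readable w 8 ar" and zs: "zs \<in> tuples (length w) 4"
    obtain x y x' y' where z: "zs = [x, y, x', y']" "x \<le> length w" "y \<le> length w" "x' \<le> length w" "y' \<le> length w"
      using zs by (rule tuplesE(2))
    show "ev w ar 4 (val zs) ag_fm \<longleftrightarrow> ag w (zs ! 0) (zs ! 1) (zs ! 2) (zs ! 3)"
      using z(2-) unfolding z(1)
      by (simp add: ag_fm_def ag_def ev_simps readable_iff[OF r] readable_iff(2)[OF r, unfolded One_nat_def] cong: conj_cong; (blast | auto simp: less_le)?)
  qed
  then show ?thesis by (simp add: eval_nat_numeral)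
qed

lemma computed_bef:
  assumes "computed w 9 ar0"
  shows "computed w 10 (sem w 0 (\<lambda>_. 0) (fix_stage 9 2 bef_fm) ar0)"
proof -
  have "computed w (Suc 9) (sem w 0 (\<lambda>_. 0) (fix_stage 9 2 bef_fm) ar0)"
  proof (rule computed_stage[OF assms])
    show "specs w ! 9 = (2, \<lambda>z. bef w (z ! 0) (z ! 1))" by (simp add: specs_def)
  next
    fix ar zs assume r: "readable w 9 ar" and zs: "zs \<in> tuples (length w) 2"
    obtain x y where z: "zs = [x, y]" "x \<le> length w" "y \<le> length w"
      using zs by (rule tuplesE(1))
    show "ev w ar 2 (val zs) bef_fm \<longleftrightarrow> bef w (zs ! 0) (zs ! 1)"
      using z(2-) unfolding z(1)
      by (simp add: bef_fm_def bef_def ev_simps readable_iff[OF r] readable_iff(2)[OF r, unfolded One_nat_def] cong: conj_cong; (blast | auto simp: less_le)?)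
  qed
  then show ?thesis by (simp add: eval_nat_numeral)
qed

lemma computed_agv:
  assumes "computed w 10 ar0"
  shows "computed w 11 (sem w 0 (\<lambda>_. 0) (fix_stage 10 5 agv_fm) ar0)"
proof -
  have "computed w (Suc 10) (sem w 0 (\<lambda>_. 0) (fix_stage 10 5 agv_fm) ar0)"
  proof (rule computed_stage[OF assms])
    show "specs w ! 10 = (5, \<lambda>z. agv w (z ! 0) (z ! 1) (z ! 2) (z ! 3) (z ! 4))" by (simp add: specs_def)
  next
    fix ar zs assume r: "readable w 10 ar" and zs: "zs \<in> tuples (length w) 5"
    obtain v x y x' y' where z: "zs = [v, x, y, x', y']" "v \<le> length w" "x \<le> length w" "y \<le> length w" "x' \<le> length w" "y' \<le> length w"
      using zs by (rule tuplesE(3))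
    show "ev w ar 5 (val zs) agv_fm \<longleftrightarrow> agv w (zs ! 0) (zs ! 1) (zs ! 2) (zs ! 3) (zs ! 4)"
      using z(2-) unfolding z(1)
      by (simp add: agv_fm_def agv_def ev_simps readable_iff[OF r] readable_iff(2)[OF r, unfolded One_nat_def] cong: conj_cong; (blast | auto simp: less_le)?)
  qed
  then show ?thesis by (simp add: eval_nat_numeral)
qed

lemma computed_vl:
  assumes "computed w 11 ar0"
  shows "computed w 12 (sem w 0 (\<lambda>_. 0) (fix_stage 11 4 vl_fm) ar0)"
proof -
  have "computed w (Suc 11) (sem w 0 (\<lambda>_. 0) (fix_stage 11 4 vl_fm) ar0)"
  proof (rule computed_stage[OF assms])
    show "specs w ! 11 = (4, \<lambda>z. vl w (z ! 0) (z ! 1) (z ! 2) (z ! 3))" by (simp add: specs_def)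
  next
    fix ar zs assume r: "readable w 11 ar" and zs: "zs \<in> tuples (length w) 4"
    obtain x y x' y' where z: "zs = [x, y, x', y']" "x \<le> length w" "y \<le> length w" "x' \<le> length w" "y' \<le> length w"
      using zs by (rule tuplesE(2))
    show "ev w ar 4 (val zs) vl_fm \<longleftrightarrow> vl w (zs ! 0) (zs ! 1) (zs ! 2) (zs ! 3)"
      using z(2-) unfolding z(1)
      by (simp add: vl_fm_def vl_def ev_simps readable_iff[OF r] readable_iff(2)[OF r, unfolded One_nat_def] cong: conj_cong; (blast | auto simp: less_le)?)
  qed
  then show ?thesis by (simp add: eval_nat_numeral)
qed

definition prepare :: prog where
  "prepare = Then (For (Mark 0 [0, 0] 0)) (Then (For (Mark 1 [0, 0] 1))
    (Then (fix_stage 2 2 less_fm) (Then (fix_stage 3 2 num_fm) (Then (fix_stage 4 2 next_fm)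
    (Then (fix_stage 5 4 mapr_fm) (Then (fix_stage 6 2 relof_fm) (Then (fix_stage 7 2 same_rel_fm)
    (Then (fix_stage 8 4 ag_fm) (Then (fix_stage 9 2 bef_fm) (Then (fix_stage 10 5 agv_fm)
    (fix_stage 11 4 vl_fm)))))))))))"

lemma computed_prepare: "computed w 12 (sem w 0 (\<lambda>_. 0) prepare (\<lambda>_ _. False))"
  unfolding prepare_def sem.simps(4)
  by (intro computed_vl computed_agv computed_bef computed_ag computed_same_rel computed_relof
    computed_mapr computed_next computed_num computed_less computed_succ computed_eq)

section \<open>The formulas of the game\<close>

definition conjs :: "fm list \<Rightarrow> fm" where
  "conjs fs = foldr Conj fs (Letter 0 (\<lambda>_. True))"

lemma ev_conjs: "ev w ar d xs (conjs fs) \<longleftrightarrow> (\<forall>f\<in>set fs. ev w ar d xs f)"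
  by (induction fs) (auto simp: conjs_def)

abbreviation Imp :: "fm \<Rightarrow> fm \<Rightarrow> fm" where
  "Imp \<phi> \<psi> \<equiv> Neg (Conj \<phi> (Neg \<psi>))"

definition Alls :: "nat \<Rightarrow> fm \<Rightarrow> fm" where
  "Alls k \<phi> = Neg ((Ex ^^ k) (Neg \<phi>))"

lemma ev_Alls:
  "ev w ar d xs (Alls k \<phi>) \<longleftrightarrow> (\<forall>ys\<in>tuples (length w) k. ev w ar (d + k) (assign xs d ys) \<phi>)"
  by (simp add: Alls_def ev_Exs)

definition scope_fm :: "nat list \<Rightarrow> fm" where
  "scope_fm is = conjs (map (Lab Open 2 3) is)"

definition agree_fm :: "nat list \<Rightarrow> nat list \<Rightarrow> nat list \<Rightarrow> nat list \<Rightarrow> fm" where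
  "agree_fm is js is' js' = conjs (map (\<lambda>((i, j), (i', j')). Rel 8 [i, j, i', j'])
     (List.product (zip is js) (zip is' js')))"

definition agreev_fm :: "nat \<Rightarrow> nat list \<Rightarrow> nat list \<Rightarrow> nat list \<Rightarrow> nat list \<Rightarrow> fm" where
  "agreev_fm v is js is' js' = conjs (map (\<lambda>((i, j), (i', j')). Rel 10 [v, i, j, i', j'])
     (List.product (zip is js) (zip is' js')))"

definition value_fm :: "nat \<Rightarrow> nat \<Rightarrow> nat list \<Rightarrow> nat list \<Rightarrow> fm" where
  "value_fm v b is js = conjs (map (\<lambda>(i, j). Rel 11 [v, b, i, j]) (zip is js))"

definition cand_fm :: "nat list \<Rightarrow> nat list \<Rightarrow> fm" where
  "cand_fm is js = Conj (conjs (map (\<lambda>(i, j). Rel 7 [i, j]) (zip is js))) (agree_fm is js is js)"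

definition univ_fm :: "nat \<Rightarrow> nat \<Rightarrow> fm" where
  "univ_fm d v = Conj (Lab Open 1 1 v) (Ex (Conj (Rel 1 [d, v]) (Lab One 1 1 d)))"

definition wscope :: "input_word \<Rightarrow> nat list \<Rightarrow> bool" where
  "wscope w xs \<longleftrightarrow> (\<forall>x\<in>set xs. tupA w x)"

definition wagree :: "input_word \<Rightarrow> nat list \<Rightarrow> nat list \<Rightarrow> nat list \<Rightarrow> nat list \<Rightarrow> bool" where
  "wagree w xs ys xs' ys' \<longleftrightarrow> (\<forall>(x, y)\<in>set (zip xs ys). \<forall>(x', y')\<in>set (zip xs' ys'). ag w x y x' y')"

definition wagreev :: "input_word \<Rightarrow> nat \<Rightarrow> nat list \<Rightarrow> nat list \<Rightarrow> nat list \<Rightarrow> nat list \<Rightarrow> bool" where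
  "wagreev w v xs ys xs' ys' \<longleftrightarrow> (\<forall>(x, y)\<in>set (zip xs ys). \<forall>(x', y')\<in>set (zip xs' ys'). agv w v x y x' y')"

definition wvalue :: "input_word \<Rightarrow> nat \<Rightarrow> nat \<Rightarrow> nat list \<Rightarrow> nat list \<Rightarrow> bool" where
  "wvalue w v b xs ys \<longleftrightarrow> (\<forall>(x, y)\<in>set (zip xs ys). vl w v b x y)"

definition wcand :: "input_word \<Rightarrow> nat list \<Rightarrow> nat list \<Rightarrow> bool" where
  "wcand w xs ys \<longleftrightarrow> (\<forall>(x, y)\<in>set (zip xs ys). same_rel w x y) \<and> wagree w xs ys xs ys"

definition wuniv :: "input_word \<Rightarrow> nat \<Rightarrow> bool" where
  "wuniv w v \<longleftrightarrow> ltr (0, 0) w v Open (1, 1) \<and> (\<exists>z\<le>length w. v = Suc z \<and> ltr (0, 0) w z One (1, 1))"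

lemma ev_scope_fm: "ev w ar d xs (scope_fm is) \<longleftrightarrow> wscope w (map xs is)"
  by (auto simp: scope_fm_def ev_conjs ev_Lab wscope_def tupA_def)

context
  fixes w ar and xs :: "nat \<Rightarrow> nat"
  assumes r: "readable w 12 ar" and b: "\<And>i. xs i \<le> length w"
begin

lemma ev_agree_fm:
  "ev w ar d xs (agree_fm is js is' js') \<longleftrightarrow> wagree w (map xs is) (map xs js) (map xs is') (map xs js')"
  by (fastforce simp: agree_fm_def ev_conjs wagree_def zip_map_map readable_iff[OF r] b)

lemma ev_agreev_fm:
  "ev w ar d xs (agreev_fm v is js is' js') \<longleftrightarrow> wagreev w (xs v) (map xs is) (map xs js) (map xs is') (map xs js')"
  by (fastforce simp: agreev_fm_def ev_conjs wagreev_def zip_map_map readable_iff[OF r] b)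

lemma ev_value_fm: "ev w ar d xs (value_fm v c is js) \<longleftrightarrow> wvalue w (xs v) (xs c) (map xs is) (map xs js)"
  by (fastforce simp: value_fm_def ev_conjs wvalue_def zip_map_map readable_iff[OF r] b)

lemma ev_cand_fm: "ev w ar d xs (cand_fm is js) \<longleftrightarrow> wcand w (map xs is) (map xs js)"
  by (fastforce simp: cand_fm_def ev_conjs wcand_def zip_map_map readable_iff[OF r] b ev_agree_fm)

lemma ev_univ_fm: "v < d \<Longrightarrow> ev w ar d xs (univ_fm d v) \<longleftrightarrow> wuniv w (xs v)"
  using b[of v] by (simp add: univ_fm_def wuniv_def ev_Lab readable_iff[OF r] readable_iff(2)[OF r, unfolded One_nat_def] cong: conj_cong)

end

lemma map_assign_same: "length ys = n \<Longrightarrow> e = d + n \<Longrightarrow> map (assign xs d ys) [d..<e] = ys"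
  by (rule nth_equalityI) (auto simp: assign_def)

lemma map_assign_less: "\<forall>i\<in>set is. i < d \<Longrightarrow> map (assign xs d ys) is = map xs is"
  by (auto simp: assign_def)

lemma map_upd_less: "\<forall>i\<in>set is. i < (d::nat) \<Longrightarrow> map (xs(d := y)) is = map xs is"
  by auto

lemma assign_bounded:
  assumes "\<And>i. xs i \<le> N" "ys \<in> tuples N k"
  shows "assign xs d ys i \<le> N"
proof (cases "d \<le> i \<and> i < d + length ys")
  case True
  then have "ys ! (i - d) \<in> set ys" by (intro nth_mem) auto
  with True assms(2) show ?thesis by (auto simp: assign_def tuples_def)
qed (use assms(1) in \<open>auto simp: assign_def\<close>)

lemma tuples_append:
  "xs \<in> tuples N k \<Longrightarrow> ys \<in> tuples N l \<Longrightarrow> xs @ ys \<in> tuples N (k + l)"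
  by (auto simp: tuples_def)

text \<open>Variables \<open>0..<k\<close> and \<open>k..<2*k\<close> hold the current position of
  the game, \<open>2*k..<3*k\<close> the new scope and \<open>3*k..<4*k\<close> an answer on
  it.\<close>

definition forth_fm :: "nat \<Rightarrow> fm" where
  "forth_fm k = (Ex ^^ k) (Conj (scope_fm [2*k..<3*k])
     (Alls k (Imp (Conj (cand_fm [2*k..<3*k] [3*k..<4*k]) (agree_fm [0..<k] [k..<2*k] [2*k..<3*k] [3*k..<4*k]))
       (Rel 12 ([2*k..<3*k] @ [3*k..<4*k])))))"

text \<open>Variable \<open>2*k\<close> is a universal variable of the prefix, \<open>2*k+1\<close>
  an element of the right universe, both given by positions of the word; the answer on the old scope
  starts at \<open>2*k+2\<close>.\<close>

definition forall_fm :: "nat \<Rightarrow> fm" where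
  "forall_fm k = Ex (Ex (Conj (univ_fm (2*k+2) (2*k)) (Conj (Lab Open 1 4 (2*k+1))
     (Alls k (Imp (Conj (cand_fm [0..<k] [2*k+2..<3*k+2])
         (Conj (value_fm (2*k) (2*k+1) [0..<k] [2*k+2..<3*k+2])
           (agreev_fm (2*k) [0..<k] [k..<2*k] [0..<k] [2*k+2..<3*k+2])))
       (Rel 12 ([0..<k] @ [2*k+2..<3*k+2])))))))"

definition bad_fm :: "nat \<Rightarrow> fm" where
  "bad_fm k = Conj (scope_fm [0..<k]) (Conj (cand_fm [0..<k] [k..<2*k]) (Disj (forth_fm k) (forall_fm k)))"

text \<open>Without elements in the right universe and with a nonempty prefix, the game is bypassed:
  that some \<open>One\<close> has no \<open>Zero\<close> to its left means that the prefix starts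
  with a universal quantifier.\<close>

definition accept_fm :: "nat \<Rightarrow> fm" where
  "accept_fm k = (let no_b = Neg (Ex (Lab Open 1 4 0)); has_var = Ex (Lab Open 1 1 0) in
     Disj (Conj no_b (Conj has_var (Ex (Conj (Lab One 1 1 0) (Neg (Ex (Conj (Rel 2 [1, 0]) (Lab Zero 1 1 1))))))))
       (Conj (Neg (Conj no_b has_var))
         (Alls k (Imp (scope_fm [0..<k]) (Neg (Alls k (Imp (cand_fm [0..<k] [k..<2*k]) (Rel 12 ([0..<k] @ [k..<2*k])))))))))"

text \<open>This and \<open>wforall\<close> are the two rules of \<open>bad\<close> as an operator
  on \<open>Z\<close>, with all quantifiers confined to positions of the word.\<close>

definition wforth :: "input_word \<Rightarrow> nat \<Rightarrow> nat list set \<Rightarrow> nat list \<Rightarrow> nat list \<Rightarrow> bool" where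
  "wforth w k Z xs ys \<longleftrightarrow> (\<exists>xs'\<in>tuples (length w) k. wscope w xs' \<and>
     (\<forall>ys'\<in>tuples (length w) k. wcand w xs' ys' \<longrightarrow> wagree w xs ys xs' ys' \<longrightarrow> xs' @ ys' \<in> Z))"

definition wforall :: "input_word \<Rightarrow> nat \<Rightarrow> nat list set \<Rightarrow> nat list \<Rightarrow> nat list \<Rightarrow> bool" where
  "wforall w k Z xs ys \<longleftrightarrow> (\<exists>v\<le>length w. \<exists>b\<le>length w. wuniv w v \<and> ltr (0, 0) w b Open (1, 4) \<and>
     (\<forall>ys'\<in>tuples (length w) k. wcand w xs ys' \<longrightarrow> wvalue w v b xs ys' \<longrightarrow> wagreev w v xs ys xs ys' \<longrightarrow> xs @ ys' \<in> Z))"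

context
  fixes w ar k Z
  assumes r: "readable w 12 ar"
    and Z: "\<And>zs. zs \<in> tuples (length w) (2 * k) \<Longrightarrow> ar 12 (addr (length w) zs) \<longleftrightarrow> zs \<in> Z"
begin

context
  fixes xs ys
  assumes xs: "xs \<in> tuples (length w) k" and ys: "ys \<in> tuples (length w) k"
begin

lemma val_bounded: "val (xs @ ys) i \<le> length w"
  by (rule assign_bounded[OF _ tuples_append[OF xs ys]]) simp

lemma val_maps:
  "map (val (xs @ ys)) [0..<k] = xs" "map (val (xs @ ys)) [k..<2*k] = ys"
  using xs ys by (auto simp: tuples_def assign_def nth_append intro!: nth_equalityI)

lemma ev_forth_fm: "ev w ar (2 * k) (val (xs @ ys)) (forth_fm k) \<longleftrightarrow> wforth w k Z xs ys"
proof -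
  have "ev w ar (2 * k + k) (assign (val (xs @ ys)) (2 * k) xs') (Conj (scope_fm [2*k..<3*k])
     (Alls k (Imp (Conj (cand_fm [2*k..<3*k] [3*k..<4*k]) (agree_fm [0..<k] [k..<2*k] [2*k..<3*k] [3*k..<4*k]))
       (Rel 12 ([2*k..<3*k] @ [3*k..<4*k]))))) \<longleftrightarrow> wscope w xs' \<and>
     (\<forall>ys'\<in>tuples (length w) k. wcand w xs' ys' \<longrightarrow> wagree w xs ys xs' ys' \<longrightarrow> xs' @ ys' \<in> Z)"
    if xs': "xs' \<in> tuples (length w) k" for xs'
  proof -
    let ?v = "assign (val (xs @ ys)) (2 * k) xs'"
    have bv: "?v i \<le> length w" for i by (rule assign_bounded[OF val_bounded xs'])
    have len: "length xs' = k" using xs' by (simp add: tuples_def)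
    have m1: "map ?v [2*k..<3*k] = xs'" by (rule map_assign_same[OF len]) simp
    have m2: "map ?v [0..<k] = xs" "map ?v [k..<2*k] = ys"
      using val_maps by (auto simp: map_assign_less)
    have inner: "ev w ar (2 * k + k + k) (assign ?v (2 * k + k) ys')
      (Imp (Conj (cand_fm [2*k..<3*k] [3*k..<4*k]) (agree_fm [0..<k] [k..<2*k] [2*k..<3*k] [3*k..<4*k]))
       (Rel 12 ([2*k..<3*k] @ [3*k..<4*k]))) \<longleftrightarrow> (wcand w xs' ys' \<longrightarrow> wagree w xs ys xs' ys' \<longrightarrow> xs' @ ys' \<in> Z)"
      if ys': "ys' \<in> tuples (length w) k" for ys'
    proof -
      let ?u = "assign ?v (2 * k + k) ys'"
      have bu: "?u i \<le> length w" for i by (rule assign_bounded[OF bv ys'])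
      have n0: "length ys' = k" using ys' by (simp add: tuples_def)
      have n1: "map ?u [3*k..<4*k] = ys'"
        using map_assign_same[OF n0, of "4 * k" "2 * k + k" ?v] by simp
      have n2: "map ?u [2*k..<3*k] = xs'" "map ?u [0..<k] = xs" "map ?u [k..<2*k] = ys"
        by (rule trans[OF map_assign_less m1] trans[OF map_assign_less m2(1)] trans[OF map_assign_less m2(2)]; simp)+
      show ?thesis
        using Z[of "xs' @ ys'"] tuples_append[OF xs' ys']
        unfolding ev.simps ev_cand_fm[OF r bu] ev_agree_fm[OF r bu] map_append n1 n2
        by (auto simp: mult_2)
    qed
    show ?thesis by (simp only: ev.simps(4) ev_scope_fm m1 ev_Alls inner cong: ball_cong)
  qed
  then show ?thesis unfolding forth_fm_def ev_Exs wforth_def by blast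
qed

lemma ev_forall_fm: "ev w ar (2 * k) (val (xs @ ys)) (forall_fm k) \<longleftrightarrow> wforall w k Z xs ys"
proof -
  have "ev w ar (Suc (Suc (2 * k))) ((val (xs @ ys))(2 * k := v, Suc (2 * k) := b)) (Conj (univ_fm (2*k+2) (2*k)) (Conj (Lab Open 1 4 (2*k+1))
     (Alls k (Imp (Conj (cand_fm [0..<k] [2*k+2..<3*k+2])
         (Conj (value_fm (2*k) (2*k+1) [0..<k] [2*k+2..<3*k+2])
           (agreev_fm (2*k) [0..<k] [k..<2*k] [0..<k] [2*k+2..<3*k+2])))
       (Rel 12 ([0..<k] @ [2*k+2..<3*k+2])))))) \<longleftrightarrow> wuniv w v \<and> ltr (0, 0) w b Open (1, 4) \<and>
     (\<forall>ys'\<in>tuples (length w) k. wcand w xs ys' \<longrightarrow> wvalue w v b xs ys' \<longrightarrow> wagreev w v xs ys xs ys' \<longrightarrow> xs @ ys' \<in> Z)"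
    if vb: "v \<le> length w" "b \<le> length w" for v b
  proof -
    let ?v = "(val (xs @ ys))(2 * k := v, Suc (2 * k) := b)"
    have bv: "?v i \<le> length w" for i using vb val_bounded by simp
    have m2: "map ?v [0..<k] = xs" "map ?v [k..<2*k] = ys"
      using val_maps by (auto simp: map_upd_less simp del: fun_upd_apply)
    have inner: "ev w ar (2 * k + 2 + k) (assign ?v (2 * k + 2) ys')
      (Imp (Conj (cand_fm [0..<k] [2*k+2..<3*k+2])
         (Conj (value_fm (2*k) (2*k+1) [0..<k] [2*k+2..<3*k+2])
           (agreev_fm (2*k) [0..<k] [k..<2*k] [0..<k] [2*k+2..<3*k+2])))
       (Rel 12 ([0..<k] @ [2*k+2..<3*k+2]))) \<longleftrightarrow>
      (wcand w xs ys' \<longrightarrow> wvalue w v b xs ys' \<longrightarrow> wagreev w v xs ys xs ys' \<longrightarrow> xs @ ys' \<in> Z)"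
      if ys': "ys' \<in> tuples (length w) k" for ys'
    proof -
      let ?u = "assign ?v (2 * k + 2) ys'"
      have bu: "?u i \<le> length w" for i by (rule assign_bounded[OF bv ys'])
      have n0: "length ys' = k" using ys' by (simp add: tuples_def)
      have n1: "map ?u [2*k+2..<3*k+2] = ys'" by (rule map_assign_same[OF n0]) simp
      have n2: "map ?u [0..<k] = xs" "map ?u [k..<2*k] = ys"
        by (rule trans[OF map_assign_less m2(1)] trans[OF map_assign_less m2(2)]; simp)+
      have n3: "?u (2 * k) = v" "?u (2 * k + 1) = b" by (simp_all add: assign_def)
      show ?thesis
        using Z[of "xs @ ys'"] tuples_append[OF xs ys']
        unfolding ev.simps ev_cand_fm[OF r bu] ev_value_fm[OF r bu] ev_agreev_fm[OF r bu] map_append n1 n2 n3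
        by (auto simp: mult_2)
    qed
    have "ev w ar (2 * k + 2) ?v (Alls k (Imp (Conj (cand_fm [0..<k] [2*k+2..<3*k+2])
         (Conj (value_fm (2*k) (2*k+1) [0..<k] [2*k+2..<3*k+2])
           (agreev_fm (2*k) [0..<k] [k..<2*k] [0..<k] [2*k+2..<3*k+2])))
       (Rel 12 ([0..<k] @ [2*k+2..<3*k+2])))) \<longleftrightarrow> (\<forall>ys'\<in>tuples (length w) k.
         wcand w xs ys' \<longrightarrow> wvalue w v b xs ys' \<longrightarrow> wagreev w v xs ys xs ys' \<longrightarrow> xs @ ys' \<in> Z)"
      by (simp only: ev_Alls inner cong: ball_cong)
    moreover have "ev w ar (2 * k + 2) ?v (univ_fm (2*k+2) (2*k)) \<longleftrightarrow> wuniv w v"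
      using ev_univ_fm[OF r, where xs = ?v, OF bv, of "2 * k" "2 * k + 2"] by simp
    moreover have "ev w ar (2 * k + 2) ?v (Lab Open 1 4 (2*k+1)) \<longleftrightarrow> ltr (0, 0) w b Open (1, 4)"
      by (simp add: ev_Lab)
    moreover have "Suc (Suc (2 * k)) = 2 * k + 2" by simp
    ultimately show ?thesis by (simp only: ev.simps)
  qed
  then show ?thesis unfolding forall_fm_def wforall_def ev.simps by blast
qed

lemma ev_bad_fm: "ev w ar (2 * k) (val (xs @ ys)) (bad_fm k) \<longleftrightarrow>
    wscope w xs \<and> wcand w xs ys \<and> (wforth w k Z xs ys \<or> wforall w k Z xs ys)"
  by (simp add: bad_fm_def ev_scope_fm ev_cand_fm[OF r val_bounded] val_maps ev_forth_fm ev_forall_fm)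

end

lemma ev_accept_fm:
  "ev w ar 0 (\<lambda>_. 0) (accept_fm k) \<longleftrightarrow>
    (if (\<exists>b\<le>length w. ltr (0, 0) w b Open (1, 4)) \<or> \<not> (\<exists>v\<le>length w. ltr (0, 0) w v Open (1, 1))
     then \<forall>xs\<in>tuples (length w) k. wscope w xs \<longrightarrow> (\<exists>ys\<in>tuples (length w) k. wcand w xs ys \<and> xs @ ys \<notin> Z)
     else \<exists>z\<le>length w. ltr (0, 0) w z One (1, 1) \<and> \<not> (\<exists>u\<le>length w. u < z \<and> ltr (0, 0) w u Zero (1, 1)))"
proof -
  have inner: "ev w ar 0 (\<lambda>_. 0) (Alls k (Imp (scope_fm [0..<k]) (Neg (Alls k (Imp (cand_fm [0..<k] [k..<2*k]) (Rel 12 ([0..<k] @ [k..<2*k]))))))) \<longleftrightarrow>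
    (\<forall>xs\<in>tuples (length w) k. wscope w xs \<longrightarrow> (\<exists>ys\<in>tuples (length w) k. wcand w xs ys \<and> xs @ ys \<notin> Z))"
  proof -
    have "ev w ar (k + k) (assign (val xs) k ys) (Imp (cand_fm [0..<k] [k..<2*k]) (Rel 12 ([0..<k] @ [k..<2*k]))) \<longleftrightarrow>
       (wcand w xs ys \<longrightarrow> xs @ ys \<in> Z)" if "xs \<in> tuples (length w) k" "ys \<in> tuples (length w) k" for xs ys
    proof -
      have l: "length xs = k" "length ys = k" using that by (auto simp: tuples_def)
      have e: "assign (val xs) k ys = val (xs @ ys)"
        using l by (auto simp: assign_def fun_eq_iff nth_append)
      show ?thesis
        using Z[of "xs @ ys"] tuples_append[OF that]
        unfolding e ev.simps ev_cand_fm[OF r val_bounded[OF that]] map_append val_maps[OF that]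
        by (auto simp: mult_2)
    qed
    moreover have "map (val xs) [0..<k] = xs" if "xs \<in> tuples (length w) k" for xs
      using that map_val[of xs] by (auto simp: tuples_def)
    ultimately show ?thesis by (simp add: ev_Alls ev_scope_fm)
  qed
  have first: "ev w ar 0 (\<lambda>_. 0) (Ex (Conj (Lab One 1 1 0) (Neg (Ex (Conj (Rel 2 [1, 0]) (Lab Zero 1 1 1)))))) \<longleftrightarrow>
    (\<exists>z\<le>length w. ltr (0, 0) w z One (1, 1) \<and> \<not> (\<exists>u\<le>length w. u < z \<and> ltr (0, 0) w u Zero (1, 1)))"
    by (simp add: ev_Lab readable_iff[OF r] cong: conj_cong)
  have e: "ev w ar 0 (\<lambda>_. 0) (Ex (Lab Open 1 4 0)) \<longleftrightarrow> (\<exists>b\<le>length w. ltr (0, 0) w b Open (1, 4))"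
    "ev w ar 0 (\<lambda>_. 0) (Ex (Lab Open 1 1 0)) \<longleftrightarrow> (\<exists>v\<le>length w. ltr (0, 0) w v Open (1, 1))"
    by (simp_all add: ev_Lab)
  show ?thesis
    unfolding accept_fm_def Let_def ev.simps(3,4) inner first e by auto
qed

end

lemma tupat_unique:
  assumes "tupat w x t" "tupat w x t'"
  shows "t = t'"
proof -
  have "j \<le> length t \<Longrightarrow> j \<le> length t' \<and> take j t = take j t'" for j
  proof (induction j)
    case (Suc j)
    then have IH: "j \<le> length t'" "take j t = take j t'" by auto
    have "entry x t j = entry x t' j" by (simp add: entry_def IH)
    then have j: "j < length t'"
      using entry_Open[OF assms(1), of j] entry_Open[OF assms(2), of j] IH Suc.prems by auto
    moreover have "t ! j = t' ! j"
      using entry_natat[OF assms(1), of j] entry_natat[OF assms(2) j] Suc.prems \<open>entry x t j = entry x t' j\<close>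
        natat_unique by auto
    ultimately show ?case using IH Suc.prems by (simp add: take_Suc_conv_app_nth)
  qed simp
  from this[of "length t"] have *: "length t \<le> length t'" "t = take (length t) t'" by auto
  have "entry x t (length t) = entry x t' (length t)" using * by (simp add: entry_def)
  then have "\<not> length t < length t'"
    using entry_Open[OF assms(1), of "length t"] entry_Open[OF assms(2), of "length t"] * by auto
  with * show ?thesis by simp
qed

section \<open>The game on the positions of an encoded instance\<close>

locale qcsp_word = encoded +
  fixes k :: nat and \<sigma> :: "nat signature" and A B :: "(nat, nat) rel_structure"
  assumes k: "k \<ge> 1"
    and A: "is_quant_structure \<sigma> (p, A)" and B: "is_structure \<sigma> B"
    and rs: "set (map fst rs) = dom \<sigma>" "\<forall>(R, ts)\<in>set rs. set ts = interp A R"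
    and us': "set us' = universe B"
    and rs': "set (map fst rs') = dom \<sigma>" "\<forall>(R, ts)\<in>set rs'. set ts = interp B R"
begin

text \<open>\<open>cover_game\<close> expects functions; at the positions of tuples the choice is
  unique.\<close>

definition tup :: "nat \<Rightarrow> nat list" where
  "tup x = (SOME t. tupat w x t)"

definition rel :: "nat \<Rightarrow> nat" where
  "rel x = (SOME R. \<exists>r. relof w r x \<and> natat w r R)"

lemma tup_eq: "tupat w x t \<Longrightarrow> tup x = t"
  unfolding tup_def by (rule some_equality) (auto intro: tupat_unique)

lemma rel_eq: "relof w r x \<Longrightarrow> natat w r R \<Longrightarrow> rel x = R"
  unfolding rel_def by (rule some_equality) (auto dest: relof_unique natat_unique)

abbreviation struct :: "nat \<Rightarrow> (nat, nat) rel_structure" where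
  "struct s \<equiv> (if s = 3 then A else B)"

lemma rel_list:
  assumes "s = 3 \<or> s = 5"
  shows "set (map fst (rel_list s)) = dom \<sigma>" "(R, ts) \<in> set (rel_list s) \<Longrightarrow> set ts = interp (struct s) R"
proof -
  show "set (map fst (rel_list s)) = dom \<sigma>" using assms rs rs' by (auto simp: rel_list_def)
  show "set ts = interp (struct s) R" if "(R, ts) \<in> set (rel_list s)"
    using assms that bspec[OF rs(2), of "(R, ts)"] bspec[OF rs'(2), of "(R, ts)"] by (auto simp: rel_list_def)
qed

lemma tup_props:
  assumes "s = 3 \<or> s = 5" "ltr (0, 0) w x Open (2, s)"
  shows "tupat w x (tup x)" "rel x \<in> dom \<sigma>" "tup x \<in> interp (struct s) (rel x)"
    "\<exists>r. relof w r x \<and> natat w r (rel x)"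
proof -
  obtain R ts t r where *: "(R, ts) \<in> set (rel_list s)" "t \<in> set ts" "tupat w x t" "relof w r x" "natat w r R"
    using tuple_positions(1)[OF assms] by blast
  have e: "tup x = t" "rel x = R" using tup_eq rel_eq * by blast+
  show "tupat w x (tup x)" "\<exists>r. relof w r x \<and> natat w r (rel x)" using * e by auto
  show "tup x \<in> interp (struct s) (rel x)" using * e rel_list(2)[OF assms(1) *(1)] by simp
  have "R \<in> set (map fst (rel_list s))" using *(1) by force
  then show "rel x \<in> dom \<sigma>" using rel_list(1)[OF assms(1)] e by simp
qed

lemma tup_surj:
  assumes "s = 3 \<or> s = 5" "R \<in> dom \<sigma>" "t \<in> interp (struct s) R"
  shows "\<exists>x. ltr (0, 0) w x Open (2, s) \<and> tup x = t \<and> rel x = R"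
proof -
  have "R \<in> set (map fst (rel_list s))" using assms rel_list(1) by simp
  then obtain ts where ts: "(R, ts) \<in> set (rel_list s)" by auto
  then have "t \<in> set ts" using rel_list(2)[OF assms(1)] assms(3) by simp
  from tuple_positions(2)[OF assms(1) ts this] show ?thesis using tup_eq rel_eq by blast
qed

definition TA :: "nat set" where "TA = {x. tupA w x}"

lemma TA_iff: "x \<in> TA \<longleftrightarrow> tupA w x"
  by (simp add: TA_def)

definition TB :: "nat \<Rightarrow> nat set" where "TB x = {y. tupB w y \<and> rel y = rel x}"

lemma TA_props: "x \<in> TA \<Longrightarrow> tupat w x (tup x) \<and> rel x \<in> dom \<sigma> \<and> tup x \<in> interp A (rel x)"
  using tup_props[of 3 x] by (auto simp: TA_def tupA_def)

lemma TB_props: "y \<in> TB x \<Longrightarrow> tupat w y (tup y) \<and> rel y \<in> dom \<sigma> \<and> tup y \<in> interp B (rel x) \<and> rel y = rel x"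
  using tup_props[of 5 y] by (auto simp: TB_def tupB_def)

lemma A': "is_structure \<sigma> A" "distinct (map snd p)" "set (map snd p) = universe A"
  using A by auto

lemma interp_tuple:
  "R \<in> dom \<sigma> \<Longrightarrow> t \<in> interp A R \<Longrightarrow> length t = the (\<sigma> R) \<and> set t \<subseteq> universe A"
  "R \<in> dom \<sigma> \<Longrightarrow> t \<in> interp B R \<Longrightarrow> length t = the (\<sigma> R) \<and> set t \<subseteq> universe B"
  using A'(1) B by (fastforce simp: is_structure_def)+

sublocale cover_game k "universe B" p TA tup TB tup
proof
  show "k \<ge> 1" by (rule k)
  show "distinct (map snd p)" by (rule A'(2))
  show "set (tup x) \<subseteq> snd ` set p" if "x \<in> TA" for x
    using interp_tuple(1) TA_props[OF that] A'(3) by auto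
  show "length (tup y) = length (tup x)" "set (tup y) \<subseteq> universe B" if "x \<in> TA" "y \<in> TB x" for x y
    using interp_tuple(1)[of "rel x" "tup x"] interp_tuple(2)[of "rel x" "tup y"]
      TA_props[OF that(1)] TB_props[OF that(2)] by simp_all
qed

lemma sol_iff: "sol f \<longleftrightarrow> (\<forall>R\<in>dom \<sigma>. \<forall>t\<in>interp A R. map f t \<in> interp B R)"
proof
  assume s: "sol f"
  show "\<forall>R\<in>dom \<sigma>. \<forall>t\<in>interp A R. map f t \<in> interp B R"
  proof (intro ballI)
    fix R t assume "R \<in> dom \<sigma>" "t \<in> interp A R"
    then obtain x where x: "x \<in> TA" "tup x = t" "rel x = R" using tup_surj[of 3 R t] by (auto simp: TA_def tupA_def)
    then obtain y where "y \<in> TB x" "map f t = tup y" using s by (auto simp: sol_def)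
    then show "map f t \<in> interp B R" using TB_props[of y x] x by simp
  qed
next
  assume h: "\<forall>R\<in>dom \<sigma>. \<forall>t\<in>interp A R. map f t \<in> interp B R"
  show "sol f"
    unfolding sol_def
  proof
    fix x assume x: "x \<in> TA"
    then have "map f (tup x) \<in> interp B (rel x)" "rel x \<in> dom \<sigma>" using h TA_props by auto
    then obtain y where "ltr (0, 0) w y Open (2, 5)" "tup y = map f (tup x)" "rel y = rel x"
      using tup_surj[of 5 "rel x"] by auto
    then show "\<exists>y\<in>TB x. map f (tup x) = tup y" by (auto simp: TB_def tupB_def)
  qed
qed

lemma natat_less: "natat w i n \<Longrightarrow> i \<le> length w"
  using natat_Open by fastforce

lemma same_rel_iff: "same_rel w x y \<longleftrightarrow> x \<in> TA \<and> y \<in> TB x"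
proof (cases "tupA w x \<and> tupB w y")
  case True
  obtain r where r: "relof w r x" "natat w r (rel x)" using tup_props(4)[of 3 x] True by (auto simp: tupA_def)
  obtain s where s: "relof w s y" "natat w s (rel y)" using tup_props(4)[of 5 y] True by (auto simp: tupB_def)
  have "same_rel w x y \<longleftrightarrow> num w r s"
    unfolding same_rel_def using True r s natat_less relof_unique by metis
  also have "\<dots> \<longleftrightarrow> rel x = rel y" by (rule num_natat[OF r(2) s(2)])
  finally show ?thesis using True by (auto simp: TA_def TB_def)
qed (auto simp: same_rel_def TA_def TB_def)

lemma mapr_natat:
  assumes "tupat w x (tup x)" "tupat w y (tup y)" "mapr w x y i j"
  shows "\<exists>a b. natat w i a \<and> natat w j b \<and> maps x y a b \<and> i \<le> length w \<and> j \<le> length w"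
proof -
  obtain l where l: "l < length (tup x)" "l < length (tup y)" "i = entry x (tup x) l" "j = entry y (tup y) l"
    using mapr_iff[OF assms(1,2)] assms(3) by blast
  then have n: "natat w i (tup x ! l)" "natat w j (tup y ! l)" using entry_natat assms by auto
  have "maps x y (tup x ! l) (tup y ! l)" unfolding maps_def using l by blast
  with n show ?thesis using natat_less by blast
qed

lemma maps_mapr:
  assumes "tupat w x (tup x)" "tupat w y (tup y)" "maps x y a b"
  shows "\<exists>i j. mapr w x y i j \<and> natat w i a \<and> natat w j b \<and> i \<le> length w \<and> j \<le> length w"
proof -
  obtain l where l: "l < length (tup x)" "l < length (tup y)" "tup x ! l = a" "tup y ! l = b"
    using assms(3) by (auto simp: maps_def)
  then have "mapr w x y (entry x (tup x) l) (entry y (tup y) l)" using mapr_iff[OF assms(1,2)] by blast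
  moreover have "natat w (entry x (tup x) l) a" "natat w (entry y (tup y) l) b"
    using entry_natat assms(1,2) l by blast+
  ultimately show ?thesis using natat_less by blast
qed

definition is_tup :: "nat \<Rightarrow> bool" where "is_tup x \<longleftrightarrow> tupat w x (tup x)"

text \<open>The common core of \<open>ag\<close> and \<open>agv\<close>, which differ in the side
  condition: \<open>P\<close> tests the position of an entry, \<open>P'\<close> the element found
  there.\<close>

lemma agree_pos:
  assumes "is_tup x" "is_tup y" "is_tup x'" "is_tup y'"
    and P: "\<And>i a. natat w i a \<Longrightarrow> (\<exists>j b. mapr w x y i j) \<Longrightarrow> P i \<longleftrightarrow> P' a"
  shows "\<not> (\<exists>i\<le>length w. \<exists>j\<le>length w. \<exists>i'\<le>length w. \<exists>j'\<le>length w.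
      mapr w x y i j \<and> mapr w x' y' i' j' \<and> num w i i' \<and> P i \<and> \<not> num w j j') \<longleftrightarrow>
    (\<forall>a b b'. P' a \<longrightarrow> maps x y a b \<longrightarrow> maps x' y' a b' \<longrightarrow> b = b')" (is "\<not> ?L \<longleftrightarrow> ?R")
proof -
  note t = assms(1-4)[unfolded is_tup_def]
  have "?L \<longleftrightarrow> \<not> ?R"
  proof
    assume ?L
    then obtain i j i' j' where *: "mapr w x y i j" "mapr w x' y' i' j'" "num w i i'" "P i" "\<not> num w j j'" by blast
    obtain a b where ab: "natat w i a" "natat w j b" "maps x y a b" using mapr_natat[OF t(1,2) *(1)] by blast
    obtain a' b' where ab': "natat w i' a'" "natat w j' b'" "maps x' y' a' b'" using mapr_natat[OF t(3,4) *(2)] by blast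
    have "a = a'" "b \<noteq> b'" using num_natat[OF ab(1) ab'(1)] num_natat[OF ab(2) ab'(2)] * by auto
    moreover have "P' a" using P[OF ab(1)] *(1,4) by blast
    ultimately show "\<not> ?R" using ab(3) ab'(3) by blast
  next
    assume "\<not> ?R"
    then obtain a b b' where *: "P' a" "maps x y a b" "maps x' y' a b'" "b \<noteq> b'" by blast
    obtain i j where ij: "mapr w x y i j" "natat w i a" "natat w j b" "i \<le> length w" "j \<le> length w"
      using maps_mapr[OF t(1,2) *(2)] by blast
    obtain i' j' where ij': "mapr w x' y' i' j'" "natat w i' a" "natat w j' b'" "i' \<le> length w" "j' \<le> length w"
      using maps_mapr[OF t(3,4) *(3)] by blast
    have "num w i i'" "\<not> num w j j'" using num_natat ij ij' *(4) by blast+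
    moreover have "P i" using P[OF ij(2)] ij(1) *(1) by blast
    ultimately show ?L using ij ij' by blast
  qed
  then show ?thesis by blast
qed

lemma ag_iff:
  assumes "is_tup x" "is_tup y" "is_tup x'" "is_tup y'"
  shows "ag w x y x' y' \<longleftrightarrow> (\<forall>a b b'. maps x y a b \<longrightarrow> maps x' y' a b' \<longrightarrow> b = b')"
  using agree_pos[OF assms, of "\<lambda>_. True" "\<lambda>_. True"] by (simp add: ag_def)

lemma var_pos_eq_iff: "i < length p \<Longrightarrow> j < length p \<Longrightarrow> var_pos i = var_pos j \<longleftrightarrow> i = j"
  using var_pos_mono[of i j] var_pos_mono[of j i] by (cases i j rule: linorder_cases) auto

lemma var_pos_less_iff: "i < length p \<Longrightarrow> j < length p \<Longrightarrow> var_pos i < var_pos j \<longleftrightarrow> i < j"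
  using var_pos_mono[of i j] var_pos_mono[of j i] by (cases i j rule: linorder_cases) auto

lemma bef_iff:
  assumes i: "i < length p" "fst (p ! i) = Forall" and a: "natat w j a" "a \<in> snd ` set p"
  shows "bef w (var_pos i) j \<longleftrightarrow> a \<noteq> snd (p ! i) \<and> comes_after p (snd (p ! i)) a"
proof -
  obtain m where m: "m < length p" "a = snd (p ! m)" using a(2) by (auto simp: in_set_conv_nth)
  have num: "num w j (var_pos n) \<longleftrightarrow> n = m" if "n < length p" for n
    using num_natat[OF a(1) var_pos_natat[OF that]] m that A'(2) nth_eq_iff_index_eq[of "map snd p" m n] by auto
  \<comment> \<open>The letter of a quantifier directly precedes its variable, so a
    \<open>Zero\<close> strictly between the two positions belongs to an index in
    \<open>i<..m\<close>, where \<open>m\<close> itself is included and \<open>i\<close> is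
    not.\<close>
  have between: "(\<exists>z\<le>length w. var_pos i < z \<and> z < var_pos m \<and> ltr (0, 0) w z Zero (1, 1)) \<longleftrightarrow>
      (\<exists>n. i < n \<and> n \<le> m \<and> fst (p ! n) = Exists)"
  proof
    assume "\<exists>z\<le>length w. var_pos i < z \<and> z < var_pos m \<and> ltr (0, 0) w z Zero (1, 1)"
    then obtain z n where n: "var_pos i < z" "z < var_pos m" "n < length p" "fst (p ! n) = Exists" "Suc z = var_pos n"
      using prefix_pos(2) by blast
    have "var_pos i < var_pos n" "\<not> var_pos m < var_pos n" using n by auto
    then have "i < n" "n \<le> m" using var_pos_less_iff i(1) m(1) n(3) by auto
    with n show "\<exists>n. i < n \<and> n \<le> m \<and> fst (p ! n) = Exists" by blast
  next
    assume "\<exists>n. i < n \<and> n \<le> m \<and> fst (p ! n) = Exists"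
    then obtain n where n: "i < n" "n \<le> m" "fst (p ! n) = Exists" by blast
    define z where "z = var_pos n - 1"
    have z: "Suc z = var_pos n" "var_pos i < z" using var_pos_mono[of i n] n m(1) by (auto simp: z_def)
    have "n < length p" using n(2) m(1) by simp
    then have "ltr (0, 0) w z Zero (1, 1)" unfolding prefix_pos(2) using n(3) z(1) by blast
    moreover have "z < var_pos m" using z(1) var_pos_less_iff[of n m] n(2) m(1) by (cases "n = m") auto
    moreover have "z \<le> length w" using calculation(1) by (simp add: ltr_def)
    ultimately show "\<exists>z\<le>length w. var_pos i < z \<and> z < var_pos m \<and> ltr (0, 0) w z Zero (1, 1)" using z(2) by blast
  qed
  have bm: "var_pos m \<le> length w" using var_pos_natat[OF m(1)] natat_less by blast
  have "bef w (var_pos i) j \<longleftrightarrow> var_pos m \<noteq> var_pos i \<and>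
      (var_pos m < var_pos i \<or> \<not> (\<exists>z\<le>length w. var_pos i < z \<and> z < var_pos m \<and> ltr (0, 0) w z Zero (1, 1)))"
    unfolding bef_def prefix_pos(1) using num m(1) bm by blast
  also have "\<dots> \<longleftrightarrow> m \<noteq> i \<and> (m < i \<or> (\<forall>n. i < n \<and> n \<le> m \<longrightarrow> fst (p ! n) \<noteq> Exists))"
    unfolding between var_pos_eq_iff[OF m(1) i(1)] var_pos_less_iff[OF m(1) i(1)] by blast
  also have "\<dots> \<longleftrightarrow> m \<noteq> i \<and> comes_after p (snd (p ! i)) (snd (p ! m))"
  proof -
    have E: "(fst (p ! n) \<noteq> Exists) = (fst (p ! n) = fst (p ! i))" for n
      using i(2) by (cases "fst (p ! n)") auto
    have "(\<forall>n. i < n \<and> n \<le> m \<longrightarrow> fst (p ! n) \<noteq> Exists) \<longleftrightarrow> (\<forall>n. i \<le> n \<and> n \<le> m \<longrightarrow> fst (p ! n) = fst (p ! i))"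
    proof (intro iffI allI impI)
      fix n assume *: "\<forall>n. i < n \<and> n \<le> m \<longrightarrow> fst (p ! n) \<noteq> Exists" and n: "i \<le> n \<and> n \<le> m"
      show "fst (p ! n) = fst (p ! i)"
      proof (cases "n = i")
        case False
        then have "fst (p ! n) \<noteq> Exists" using *[rule_format, of n] n by simp
        then show ?thesis using E by blast
      qed simp
    next
      fix n assume *: "\<forall>n. i \<le> n \<and> n \<le> m \<longrightarrow> fst (p ! n) = fst (p ! i)" and n: "i < n \<and> n \<le> m"
      then have "fst (p ! n) = fst (p ! i)" by (intro *[rule_format]) simp
      then show "fst (p ! n) \<noteq> Exists" using E by blast
    qed
    then show ?thesis unfolding comes_after_iff[OF A'(2) m(1) i(1)] by auto
  qed
  also have "\<dots> \<longleftrightarrow> a \<noteq> snd (p ! i) \<and> comes_after p (snd (p ! i)) a"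
    using m i(1) A'(2) nth_eq_iff_index_eq[of "map snd p" m i] by auto
  finally show ?thesis .
qed

lemma wuniv_iff: "wuniv w v \<longleftrightarrow> (\<exists>i<length p. fst (p ! i) = Forall \<and> v = var_pos i)"
proof
  assume "wuniv w v"
  then show "\<exists>i<length p. fst (p ! i) = Forall \<and> v = var_pos i"
    unfolding wuniv_def prefix_pos by auto
next
  assume "\<exists>i<length p. fst (p ! i) = Forall \<and> v = var_pos i"
  then obtain i where i: "i < length p" "fst (p ! i) = Forall" "v = var_pos i" by blast
  have "v = Suc (v - 1)" using i by (simp add: var_pos_def)
  moreover have "v - 1 \<le> length w" using natat_less[OF var_pos_natat[OF i(1)]] i by simp
  ultimately show "wuniv w v" unfolding wuniv_def prefix_pos using i by metis
qed

text \<open>\<open>x\<close> has to be a tuple of the left structure because \<open>bef\<close>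
  looks up its entries in the prefix.\<close>

lemma agv_iff:
  assumes "x \<in> TA" "is_tup y" "is_tup x'" "is_tup y'" and i: "i < length p" "fst (p ! i) = Forall"
  shows "agv w (var_pos i) x y x' y' \<longleftrightarrow>
    (\<forall>a b b'. a \<noteq> snd (p ! i) \<and> comes_after p (snd (p ! i)) a \<longrightarrow> maps x y a b \<longrightarrow> maps x' y' a b' \<longrightarrow> b = b')"
proof -
  have x: "is_tup x" using TA_props[OF assms(1)] by (simp add: is_tup_def)
  have "bef w (var_pos i) j \<longleftrightarrow> a \<noteq> snd (p ! i) \<and> comes_after p (snd (p ! i)) a"
    if "natat w j a" "\<exists>l b. mapr w x y j l" for j a
  proof (rule bef_iff[OF i that(1)])
    from that(2) obtain l where "mapr w x y j l" by blast
    then obtain a' b where "natat w j a'" "maps x y a' b" using mapr_natat x assms(2) unfolding is_tup_def by blast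
    then have "maps x y a b" using natat_unique[OF that(1)] by auto
    then have "a \<in> set (tup x)" by (auto simp: maps_def)
    then show "a \<in> snd ` set p" using ta_sub[OF assms(1)] by auto
  qed
  from agree_pos[OF x assms(2-4), of "bef w (var_pos i)", OF this] show ?thesis
    by (simp only: agv_def)
qed

lemma vl_iff:
  assumes "is_tup x" "is_tup y" "natat w v c" "natat w b d"
  shows "vl w v b x y \<longleftrightarrow> (\<forall>b'. maps x y c b' \<longrightarrow> b' = d)"
proof -
  note t = assms(1,2)[unfolded is_tup_def]
  have "(\<exists>i\<le>length w. \<exists>j\<le>length w. mapr w x y i j \<and> num w i v \<and> \<not> num w j b) \<longleftrightarrow> (\<exists>b'. maps x y c b' \<and> b' \<noteq> d)"
  proof
    assume "\<exists>i\<le>length w. \<exists>j\<le>length w. mapr w x y i j \<and> num w i v \<and> \<not> num w j b"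
    then obtain i j where *: "mapr w x y i j" "num w i v" "\<not> num w j b" by blast
    obtain a b' where ab: "natat w i a" "natat w j b'" "maps x y a b'" using mapr_natat[OF t *(1)] by blast
    then have "a = c" "b' \<noteq> d" using num_natat[OF ab(1) assms(3)] num_natat[OF ab(2) assms(4)] * by auto
    with ab show "\<exists>b'. maps x y c b' \<and> b' \<noteq> d" by blast
  next
    assume "\<exists>b'. maps x y c b' \<and> b' \<noteq> d"
    then obtain b' where b': "maps x y c b'" "b' \<noteq> d" by blast
    obtain i j where ij: "mapr w x y i j" "natat w i c" "natat w j b'" "i \<le> length w" "j \<le> length w"
      using maps_mapr[OF t b'(1)] by blast
    then show "\<exists>i\<le>length w. \<exists>j\<le>length w. mapr w x y i j \<and> num w i v \<and> \<not> num w j b"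
      using num_natat[OF ij(2) assms(3)] num_natat[OF ij(3) assms(4)] b'(2) by blast
  qed
  then show ?thesis unfolding vl_def by blast
qed

lemma tuples_k: "xs \<in> tuples (length w) k \<Longrightarrow> length xs = k"
  by (simp add: tuples_def)

lemma scope_iff: "xs \<in> tuples (length w) k \<Longrightarrow> wscope w xs \<longleftrightarrow> scope xs"
  by (auto simp: wscope_def scope_def TA_iff tuples_def)

lemma pairs_zip:
  assumes "length xs = k" "length ys = k"
  shows "pairs xs ys a b \<longleftrightarrow> (\<exists>(x, y)\<in>set (zip xs ys). maps x y a b)"
  using assms by (auto simp: pairs_def set_zip)

lemma zip_agree:
  assumes "length xs = k" "length ys = k" "length xs' = k" "length ys' = k"
  shows "agree {a. D a} xs ys xs' ys' \<longleftrightarrow> (\<forall>(x, y)\<in>set (zip xs ys). \<forall>(x', y')\<in>set (zip xs' ys').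
    \<forall>a b b'. D a \<longrightarrow> maps x y a b \<longrightarrow> maps x' y' a b' \<longrightarrow> b = b')"
  unfolding agree_def pairs_zip[OF assms(1,2)] pairs_zip[OF assms(3,4)] by blast

lemma ball_pairs_cong:
  assumes "\<And>x y x' y'. (x, y) \<in> S \<Longrightarrow> (x', y') \<in> T \<Longrightarrow> P x y x' y' \<longleftrightarrow> Q x y x' y'"
  shows "(\<forall>(x, y)\<in>S. \<forall>(x', y')\<in>T. P x y x' y') \<longleftrightarrow> (\<forall>(x, y)\<in>S. \<forall>(x', y')\<in>T. Q x y x' y')"
  by (intro ball_cong refl) (auto simp: assms)

lemma zip_is_tup:
  assumes "scope xs" "\<forall>(x, y)\<in>set (zip xs ys). same_rel w x y" "(x, y) \<in> set (zip xs ys)"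
  shows "x \<in> TA" "is_tup x" "is_tup y"
  using assms TA_props TB_props by (auto simp: same_rel_iff is_tup_def)

lemma wagree_iff:
  assumes "scope xs" "\<forall>(x, y)\<in>set (zip xs ys). same_rel w x y" "length ys = k"
    "scope xs'" "\<forall>(x, y)\<in>set (zip xs' ys'). same_rel w x y" "length ys' = k"
  shows "wagree w xs ys xs' ys' \<longleftrightarrow> agree UNIV xs ys xs' ys'"
proof -
  have l: "length xs = k" "length xs' = k" using assms(1,4) by (simp_all add: scope_def)
  have "ag w x y x' y' \<longleftrightarrow> (\<forall>a b b'. maps x y a b \<longrightarrow> maps x' y' a b' \<longrightarrow> b = b')"
    if "(x, y) \<in> set (zip xs ys)" "(x', y') \<in> set (zip xs' ys')" for x y x' y'
    using ag_iff zip_is_tup[OF assms(1,2) that(1)] zip_is_tup[OF assms(4,5) that(2)] by blast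
  then have "wagree w xs ys xs' ys' \<longleftrightarrow> (\<forall>(x, y)\<in>set (zip xs ys). \<forall>(x', y')\<in>set (zip xs' ys').
      \<forall>a b b'. maps x y a b \<longrightarrow> maps x' y' a b' \<longrightarrow> b = b')"
    unfolding wagree_def by (rule ball_pairs_cong)
  also have "\<dots> \<longleftrightarrow> agree UNIV xs ys xs' ys'"
    using zip_agree[OF l(1) assms(3) l(2) assms(6), of "\<lambda>_. True"] by (simp only: UNIV_def simp_thms)
  finally show ?thesis .
qed

lemma cand_same_rel: "scope xs \<Longrightarrow> cand xs ys \<Longrightarrow> \<forall>(x, y)\<in>set (zip xs ys). same_rel w x y"
  by (auto simp: cand_def set_zip same_rel_iff scope_nth)

lemma wcand_iff:
  assumes "scope xs" "length ys = k"
  shows "wcand w xs ys \<longleftrightarrow> cand xs ys"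
proof (cases "\<forall>(x, y)\<in>set (zip xs ys). same_rel w x y")
  case True
  have "ys ! i \<in> TB (xs ! i)" if "i < k" for i
  proof -
    have "(xs ! i, ys ! i) \<in> set (zip xs ys)" using that assms by (auto simp: set_zip scope_def)
    then show ?thesis using True by (auto simp: same_rel_iff)
  qed
  then show ?thesis
    using wagree_iff[OF assms(1) True assms(2) assms(1) True assms(2)] True assms(2) by (simp add: wcand_def cand_def)
next
  case False
  then show ?thesis using cand_same_rel[OF assms(1)] by (auto simp: wcand_def)
qed

lemma wagreev_iff:
  assumes "scope xs" "cand xs ys" "cand xs ys'" and i: "i < length p" "fst (p ! i) = Forall"
  shows "wagreev w (var_pos i) xs ys xs ys' \<longleftrightarrow>
    agree {u. u \<noteq> snd (p ! i) \<and> comes_after p (snd (p ! i)) u} xs ys xs ys'"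
proof -
  have l: "length xs = k" "length ys = k" "length ys' = k" using assms by (auto simp: scope_def cand_def)
  have "agv w (var_pos i) x y x' y' \<longleftrightarrow> (\<forall>a b b'. a \<noteq> snd (p ! i) \<and> comes_after p (snd (p ! i)) a \<longrightarrow>
      maps x y a b \<longrightarrow> maps x' y' a b' \<longrightarrow> b = b')"
    if "(x, y) \<in> set (zip xs ys)" "(x', y') \<in> set (zip xs ys')" for x y x' y'
    using agv_iff[OF _ _ _ _ i] zip_is_tup[OF assms(1) cand_same_rel[OF assms(1,2)] that(1)]
      zip_is_tup[OF assms(1) cand_same_rel[OF assms(1,3)] that(2)] by blast
  then show ?thesis
    unfolding wagreev_def zip_agree[OF l(1,2) l(1,3)] by (rule ball_pairs_cong)
qed

lemma wvalue_iff:
  assumes "scope xs" "cand xs ys" "natat w v c" "natat w b d"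
  shows "wvalue w v b xs ys \<longleftrightarrow> (\<forall>b'. pairs xs ys c b' \<longrightarrow> b' = d)"
proof -
  have l: "length xs = k" "length ys = k" using assms by (auto simp: scope_def cand_def)
  have "vl w v b x y \<longleftrightarrow> (\<forall>b'. maps x y c b' \<longrightarrow> b' = d)" if "(x, y) \<in> set (zip xs ys)" for x y
    using vl_iff[OF _ _ assms(3,4)] zip_is_tup[OF assms(1) cand_same_rel[OF assms(1,2)] that] by blast
  then show ?thesis
    unfolding wvalue_def pairs_zip[OF l] by blast
qed

lemma cand_tuples:
  assumes "scope xs" "cand xs ys"
  shows "ys \<in> tuples (length w) k"
proof -
  have "ys ! i \<le> length w" if "i < k" for i
    using assms that by (auto simp: cand_def TB_def tupB_def ltr_def dest!: spec[of _ i])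
  moreover have "length ys = k" using assms by (simp add: cand_def)
  ultimately show ?thesis by (auto simp: tuples_def in_set_conv_nth)
qed

lemma scope_tuples: "scope xs \<Longrightarrow> xs \<in> tuples (length w) k"
  by (auto simp: tuples_def scope_def TA_iff subset_iff tupA_def ltr_def)

definition lost :: "nat list \<Rightarrow> bool" where
  "lost zs \<longleftrightarrow> scope (take k zs) \<and> cand (take k zs) (drop k zs) \<and> bad (take k zs) (drop k zs)"

lemma lost_append: "length xs = k \<Longrightarrow> lost (xs @ ys) \<longleftrightarrow> scope xs \<and> cand xs ys \<and> bad xs ys"
  by (simp add: lost_def)

lemma wforth_iff:
  assumes "scope xs" "cand xs ys"
  shows "wforth w k Z xs ys \<longleftrightarrow> (\<exists>xs'. scope xs' \<and> (\<forall>ys'. cand xs' ys' \<longrightarrow> agree UNIV xs ys xs' ys' \<longrightarrow> xs' @ ys' \<in> Z))"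
proof -
  have "(\<forall>ys'\<in>tuples (length w) k. wcand w xs' ys' \<longrightarrow> wagree w xs ys xs' ys' \<longrightarrow> xs' @ ys' \<in> Z) \<longleftrightarrow>
      (\<forall>ys'. cand xs' ys' \<longrightarrow> agree UNIV xs ys xs' ys' \<longrightarrow> xs' @ ys' \<in> Z)" if s: "scope xs'" for xs'
  proof -
    have "length ys = k" using assms(2) by (simp add: cand_def)
    then have "wagree w xs ys xs' ys' \<longleftrightarrow> agree UNIV xs ys xs' ys'" if "cand xs' ys'" for ys'
      using wagree_iff[OF assms(1) cand_same_rel[OF assms] _ s cand_same_rel[OF s that]] that by (simp add: cand_def)
    moreover have "wcand w xs' ys' \<longleftrightarrow> cand xs' ys'" if "ys' \<in> tuples (length w) k" for ys'
      by (rule wcand_iff[OF s tuples_k[OF that]])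
    ultimately show ?thesis using cand_tuples[OF s] by blast
  qed
  then show ?thesis unfolding wforth_def using scope_iff scope_tuples by blast
qed

lemma wforall_iff:
  assumes "scope xs" "cand xs ys"
  shows "wforall w k Z xs ys \<longleftrightarrow> (\<exists>v b. (Forall, v) \<in> set p \<and> b \<in> universe B \<and> (\<forall>ys'. cand xs ys' \<longrightarrow>
    (\<forall>b'. pairs xs ys' v b' \<longrightarrow> b' = b) \<longrightarrow> agree {u. u \<noteq> v \<and> comes_after p v u} xs ys xs ys' \<longrightarrow> xs @ ys' \<in> Z))"
proof -
  have *: "(\<forall>ys'\<in>tuples (length w) k. wcand w xs ys' \<longrightarrow> wvalue w (var_pos i) b xs ys' \<longrightarrow> wagreev w (var_pos i) xs ys xs ys' \<longrightarrow> xs @ ys' \<in> Z) \<longleftrightarrow>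
     (\<forall>ys'. cand xs ys' \<longrightarrow> (\<forall>b'. pairs xs ys' (snd (p ! i)) b' \<longrightarrow> b' = d) \<longrightarrow>
       agree {u. u \<noteq> snd (p ! i) \<and> comes_after p (snd (p ! i)) u} xs ys xs ys' \<longrightarrow> xs @ ys' \<in> Z)"
    if i: "i < length p" "fst (p ! i) = Forall" and b: "natat w b d" for i b d
  proof -
    have "wcand w xs ys' \<longleftrightarrow> cand xs ys'" if "ys' \<in> tuples (length w) k" for ys'
      by (rule wcand_iff[OF assms(1) tuples_k[OF that]])
    moreover note wagreev_iff[OF assms _ i] wvalue_iff[OF assms(1) _ var_pos_natat[OF i(1)] b]
    ultimately show ?thesis using cand_tuples[OF assms(1)] by blast
  qed
  show ?thesis
  proof
    assume "wforall w k Z xs ys"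
    then obtain v b where vb: "wuniv w v" "ltr (0, 0) w b Open (1, 4)"
      "\<forall>ys'\<in>tuples (length w) k. wcand w xs ys' \<longrightarrow> wvalue w v b xs ys' \<longrightarrow> wagreev w v xs ys xs ys' \<longrightarrow> xs @ ys' \<in> Z"
      unfolding wforall_def by blast
    obtain i where i: "i < length p" "fst (p ! i) = Forall" "v = var_pos i" using vb(1) wuniv_iff by blast
    obtain d where d: "d \<in> universe B" "natat w b d" using vb(2) elem_pos(1)[of b] us' by (auto simp: elem_pos_def)
    have "(Forall, snd (p ! i)) \<in> set p" using i nth_mem[of i p] by (metis prod.collapse)
    then show "\<exists>v b. (Forall, v) \<in> set p \<and> b \<in> universe B \<and> (\<forall>ys'. cand xs ys' \<longrightarrow>
      (\<forall>b'. pairs xs ys' v b' \<longrightarrow> b' = b) \<longrightarrow> agree {u. u \<noteq> v \<and> comes_after p v u} xs ys xs ys' \<longrightarrow> xs @ ys' \<in> Z)"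
      using *[OF i(1,2) d(2)] vb(3) i(3) d(1) by blast
  next
    assume "\<exists>v b. (Forall, v) \<in> set p \<and> b \<in> universe B \<and> (\<forall>ys'. cand xs ys' \<longrightarrow>
      (\<forall>b'. pairs xs ys' v b' \<longrightarrow> b' = b) \<longrightarrow> agree {u. u \<noteq> v \<and> comes_after p v u} xs ys xs ys' \<longrightarrow> xs @ ys' \<in> Z)"
    then obtain v d where vd: "(Forall, v) \<in> set p" "d \<in> universe B" "\<forall>ys'. cand xs ys' \<longrightarrow>
      (\<forall>b'. pairs xs ys' v b' \<longrightarrow> b' = d) \<longrightarrow> agree {u. u \<noteq> v \<and> comes_after p v u} xs ys xs ys' \<longrightarrow> xs @ ys' \<in> Z"
      by blast
    obtain i where i: "i < length p" "p ! i = (Forall, v)" using vd(1) by (auto simp: in_set_conv_nth)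
    then have i': "fst (p ! i) = Forall" "snd (p ! i) = v" by auto
    obtain b where b: "ltr (0, 0) w b Open (1, 4)" "natat w b d" using elem_pos(2)[of d] vd(2) us' by (auto simp: elem_pos_def)
    have "wuniv w (var_pos i)" using wuniv_iff i(1) i'(1) by blast
    moreover have "var_pos i \<le> length w" "b \<le> length w" using natat_less var_pos_natat[OF i(1)] b(2) by blast+
    ultimately show "wforall w k Z xs ys"
      unfolding wforall_def using *[OF i(1) i'(1) b(2)] vd(3) i'(2) b(1) by blast
  qed
qed

lemma bad_step:
  assumes s: "scope xs" "cand xs ys" and w: "wforth w k L xs ys \<or> wforall w k L xs ys"
    and L: "\<And>xs ys. scope xs \<Longrightarrow> cand xs ys \<Longrightarrow> xs @ ys \<in> L \<Longrightarrow> bad xs ys"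
  shows "bad xs ys"
  using w
proof (elim disjE)
  assume "wforth w k L xs ys"
  from wforth_iff[OF s, THEN iffD1, OF this]
  obtain xs' where xs': "scope xs'" "\<forall>ys'. cand xs' ys' \<longrightarrow> agree UNIV xs ys xs' ys' \<longrightarrow> xs' @ ys' \<in> L"
    by (elim exE conjE) (rule that)
  show ?thesis
  proof (rule forth[OF xs'(1)])
    fix ys' assume "cand xs' ys'" "agree UNIV xs ys xs' ys'"
    with xs'(2) show "bad xs' ys'" using L[OF xs'(1)] by simp
  qed
next
  assume "wforall w k L xs ys"
  from wforall_iff[OF s, THEN iffD1, OF this]
  obtain v b where v: "(Forall, v) \<in> set p" "b \<in> universe B" and bad: "\<forall>ys'. cand xs ys' \<longrightarrow>
    (\<forall>b'. pairs xs ys' v b' \<longrightarrow> b' = b) \<longrightarrow>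
    agree {u. u \<noteq> v \<and> comes_after p v u} xs ys xs ys' \<longrightarrow> xs @ ys' \<in> L"
    by (elim exE conjE) (rule that)
  show ?thesis
  proof (rule univ[OF v])
    fix ys' assume "cand xs ys'" "\<forall>b'. pairs xs ys' v b' \<longrightarrow> b' = b"
      "agree {u. u \<noteq> v \<and> comes_after p v u} xs ys xs ys'"
    with bad have "xs @ ys' \<in> L" by simp
    with L[OF s(1) \<open>cand xs ys'\<close>] show "bad xs ys'" by simp
  qed
qed

text \<open>Both rules of \<open>bad\<close> ask only about candidates on scopes, so the restriction
  of \<open>bad\<close> to these is a least fixed point in its own right: closed by the two rules,
  minimal by induction on \<open>bad\<close>.\<close>

lemma sem_bad_stage:
  assumes "computed w 12 ar0"
  shows "sem w 0 (\<lambda>_. 0) (fix_stage 12 (2 * k) (bad_fm k)) ar0 =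
    ar0(12 := table (length w) {zs \<in> tuples (length w) (2 * k). lost zs})"
proof -
  define \<Phi> where "\<Phi> Z zs \<longleftrightarrow> (let xs = take k zs; ys = drop k zs in wscope w xs \<and> wcand w xs ys \<and>
    (wforth w k Z xs ys \<or> wforall w k Z xs ys))" for Z zs
  have split: "zs = take k zs @ drop k zs" "take k zs \<in> tuples (length w) k" "drop k zs \<in> tuples (length w) k"
    if "zs \<in> tuples (length w) (2 * k)" for zs
    using that by (auto simp: tuples_def dest: in_set_takeD in_set_dropD)
  have \<Phi>: "\<Phi> Z zs \<longleftrightarrow> scope (take k zs) \<and> cand (take k zs) (drop k zs) \<and>
     (wforth w k Z (take k zs) (drop k zs) \<or> wforall w k Z (take k zs) (drop k zs))"
    if "zs \<in> tuples (length w) (2 * k)" for Z zs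
    using scope_iff[OF split(2)[OF that]] wcand_iff[of "take k zs" "drop k zs"] tuples_k[OF split(3)[OF that]]
    by (auto simp: \<Phi>_def Let_def)
  let ?L = "{zs \<in> tuples (length w) (2 * k). lost zs}"
  have inL: "xs @ ys \<in> ?L \<longleftrightarrow> bad xs ys" if "scope xs" "cand xs ys" for xs ys
    using tuples_append[OF scope_tuples[OF that(1)] cand_tuples[OF that]] lost_append[of xs ys] that
    by (simp add: scope_def mult_2)
  show ?thesis
  proof (rule fix_stage_lfp[where m = 12 and \<Phi> = \<Phi>])
    show "readable w 12 ar0" "ar0 12 = (\<lambda>_. False)" using assms by (auto simp: computed_def)
  next
    fix ar Z zs assume r: "readable w 12 ar"
      and Z: "\<And>ys. ys \<in> tuples (length w) (2 * k) \<Longrightarrow> ar 12 (addr (length w) ys) = (ys \<in> Z)"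
      and zs: "zs \<in> tuples (length w) (2 * k)"
    show "ev w ar (2 * k) (val zs) (bad_fm k) \<longleftrightarrow> \<Phi> Z zs"
      using ev_bad_fm[OF r Z split(2,3)[OF zs]] split(1)[OF zs] by (simp add: \<Phi>_def Let_def)
  next
    fix Z Z' :: "nat list set" and zs assume "Z \<subseteq> Z'" "\<Phi> Z zs"
    then show "\<Phi> Z' zs" unfolding \<Phi>_def Let_def wforth_def wforall_def by (meson subsetD)
  next
    fix zs assume zs: "zs \<in> tuples (length w) (2 * k)" and "\<Phi> ?L zs"
    note * = \<Phi>[OF zs, THEN iffD1, OF this(2)]
    note s = *[THEN conjunct1] *[THEN conjunct2, THEN conjunct1]
    have "bad (take k zs) (drop k zs)"
      by (rule bad_step[OF s *[THEN conjunct2, THEN conjunct2]]) (rule inL[THEN iffD1])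
    with s show "lost zs" by (simp add: lost_def)
  next
    fix Z zs assume Z: "\<And>zs. zs \<in> tuples (length w) (2 * k) \<Longrightarrow> \<Phi> Z zs \<Longrightarrow> zs \<in> Z"
      and zs: "zs \<in> tuples (length w) (2 * k)" "lost zs"
    have close: "xs @ ys \<in> Z" if s: "scope xs" "cand xs ys" and "wforth w k Z xs ys \<or> wforall w k Z xs ys" for xs ys
    proof (rule Z)
      show t: "xs @ ys \<in> tuples (length w) (2 * k)"
        using tuples_append[OF scope_tuples[OF s(1)] cand_tuples[OF s]] by (simp add: mult_2)
      show "\<Phi> Z (xs @ ys)" unfolding \<Phi>[OF t] using that by (simp add: scope_def)
    qed
    have "xs @ ys \<in> Z" if "bad xs ys" "scope xs" "cand xs ys" for xs ys
      using that
    proof induction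
      case (forth xs' xs ys)
      show ?case
        by (rule close[OF forth.prems], unfold wforth_iff[OF forth.prems]) (use forth in blast)
    next
      case (univ v b xs ys)
      show ?case
        by (rule close[OF univ.prems], unfold wforall_iff[OF univ.prems]) (use univ in blast)
    qed
    then show "zs \<in> Z" using zs split(1)[OF zs(1)] unfolding lost_def by metis
  qed simp
qed

text \<open>If the right universe is empty, the first quantifier alone decides the sentence.\<close>

lemma ev_accept:
  assumes "computed w 12 ar0"
  shows "ev w (sem w 0 (\<lambda>_. 0) (fix_stage 12 (2 * k) (bad_fm k)) ar0) 0 (\<lambda>_. 0) (accept_fm k) \<longleftrightarrow>
    (if universe B \<noteq> {} \<or> p = [] then \<forall>xs. scope xs \<longrightarrow> (\<exists>ys. cand xs ys \<and> \<not> bad xs ys)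
     else fst (hd p) = Forall)"
proof -
  let ?L = "{zs \<in> tuples (length w) (2 * k). lost zs}"
  let ?ar = "ar0(12 := table (length w) ?L)"
  have r: "readable w 12 ?ar" using assms readable_upd by (simp add: computed_def)
  have Z: "?ar 12 (addr (length w) zs) \<longleftrightarrow> zs \<in> ?L" if "zs \<in> tuples (length w) (2 * k)" for zs
    using table_iff[of ?L "length w" "2 * k" zs] that by auto
  have "(\<exists>b\<le>length w. ltr (0, 0) w b Open (1, 4)) \<longleftrightarrow> universe B \<noteq> {}"
    using elem_pos us' natat_less unfolding elem_pos_def by blast
  moreover have "(\<exists>v\<le>length w. ltr (0, 0) w v Open (1, 1)) \<longleftrightarrow> p \<noteq> []"
  proof -
    have "var_pos 0 \<le> length w" if "p \<noteq> []" using natat_less[OF var_pos_natat[of 0]] that by simp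
    then show ?thesis unfolding prefix_pos(1) by auto
  qed
  moreover have "(\<forall>xs\<in>tuples (length w) k. wscope w xs \<longrightarrow> (\<exists>ys\<in>tuples (length w) k. wcand w xs ys \<and> xs @ ys \<notin> ?L)) \<longleftrightarrow>
     (\<forall>xs. scope xs \<longrightarrow> (\<exists>ys. cand xs ys \<and> \<not> bad xs ys))"
  proof -
    have "(\<exists>ys\<in>tuples (length w) k. wcand w xs ys \<and> xs @ ys \<notin> ?L) \<longleftrightarrow> (\<exists>ys. cand xs ys \<and> \<not> bad xs ys)" if s: "scope xs" for xs
    proof -
      have "xs @ ys \<in> ?L \<longleftrightarrow> bad xs ys" if "cand xs ys" for ys
        using tuples_append[OF scope_tuples[OF s] cand_tuples[OF s that]] lost_append[of xs ys] s that
        by (simp add: scope_def mult_2)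
      moreover have "wcand w xs ys \<longleftrightarrow> cand xs ys" if "ys \<in> tuples (length w) k" for ys
        by (rule wcand_iff[OF s tuples_k[OF that]])
      ultimately show ?thesis using cand_tuples[OF s] by blast
    qed
    then show ?thesis using scope_iff scope_tuples by blast
  qed
  moreover have "(\<exists>z\<le>length w. ltr (0, 0) w z One (1, 1) \<and> \<not> (\<exists>u\<le>length w. u < z \<and> ltr (0, 0) w u Zero (1, 1))) \<longleftrightarrow>
    fst (hd p) = Forall" if ne: "p \<noteq> []"
  proof
    assume "\<exists>z\<le>length w. ltr (0, 0) w z One (1, 1) \<and> \<not> (\<exists>u\<le>length w. u < z \<and> ltr (0, 0) w u Zero (1, 1))"
    then obtain z j where z: "j < length p" "fst (p ! j) = Forall" "Suc z = var_pos j" "z \<le> length w"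
      "\<And>u. u \<le> length w \<Longrightarrow> u < z \<Longrightarrow> \<not> ltr (0, 0) w u Zero (1, 1)"
      unfolding prefix_pos(3) by blast
    show "fst (hd p) = Forall"
    proof (rule ccontr)
      assume "fst (hd p) \<noteq> Forall"
      then have E: "fst (p ! 0) = Exists" using ne by (cases "fst (hd p)") (auto simp: hd_conv_nth)
      define u where "u = var_pos 0 - 1"
      have u: "Suc u = var_pos 0" by (simp add: u_def var_pos_def)
      have "j \<noteq> 0" using E z(2) by (metis quantifier.distinct(1))
      then have "u < z" using var_pos_mono[of 0 j] z(1,3) u by simp
      moreover have "ltr (0, 0) w u Zero (1, 1)" using prefix_pos(2) E ne u by auto
      ultimately show False using z(4,5) by (meson le_trans less_imp_le)
    qed
  next
    assume F: "fst (hd p) = Forall"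
    define z where "z = var_pos 0 - 1"
    have z: "Suc z = var_pos 0" by (simp add: z_def var_pos_def)
    have "ltr (0, 0) w z One (1, 1)" using prefix_pos(3) F ne z by (auto simp: hd_conv_nth)
    moreover have "z \<le> length w" using calculation by (simp add: ltr_def)
    moreover have "\<not> ltr (0, 0) w u Zero (1, 1)" if "u < z" for u
    proof
      assume "ltr (0, 0) w u Zero (1, 1)"
      then obtain j where "j < length p" "Suc u = var_pos j" using prefix_pos(2) by blast
      moreover from this have "var_pos 0 \<le> var_pos j" using var_pos_mono[of 0 j] by (cases "j = 0") auto
      ultimately show False using that z by simp
    qed
    ultimately show "\<exists>z\<le>length w. ltr (0, 0) w z One (1, 1) \<and> \<not> (\<exists>u\<le>length w. u < z \<and> ltr (0, 0) w u Zero (1, 1))" by blast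
  qed
  moreover note ev_accept_fm[OF r Z]
  ultimately show ?thesis
    unfolding sem_bad_stage[OF assms] by presburger
qed

end

section \<open>Schemes of small weight\<close>

lemma finite_hyperedges: "is_structure \<sigma> A \<Longrightarrow> finite (hyperedges \<sigma> A)"
  by (rule finite_subset[of _ "Pow (universe A)"]) (fastforce simp: hyperedges_def is_structure_def)+

lemma hyperedges_sub: "is_structure \<sigma> A \<Longrightarrow> e \<in> hyperedges \<sigma> A \<Longrightarrow> e \<subseteq> universe A"
  by (fastforce simp: hyperedges_def is_structure_def)

text \<open>\<open>Min\<close> says something about its argument only if that is nonempty; this
  scheme is the witness.\<close>

lemma complete_scheme:
  assumes "is_quant_structure \<sigma> (p, A)"
  shows "is_scheme \<sigma> (p, A) {e. e \<subseteq> universe A \<and> card e = 2}"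
proof -
  have A: "is_structure \<sigma> A" "distinct (map snd p)" "set (map snd p) = universe A" using assms by auto
  let ?vs = "map snd p"
  have "perfect_elimination_ordering (universe A) {e. e \<subseteq> universe A \<and> card e = 2} ?vs"
    unfolding perfect_elimination_ordering_def
  proof (intro conjI allI impI)
    fix i j l assume ijl: "i < j \<and> j < l \<and> l < length ?vs \<and> {?vs ! i, ?vs ! l} \<in> {e. e \<subseteq> universe A \<and> card e = 2} \<and>
      {?vs ! j, ?vs ! l} \<in> {e. e \<subseteq> universe A \<and> card e = 2}"
    then have "?vs ! i \<noteq> ?vs ! j" using nth_eq_iff_index_eq[OF A(2), of i j] by auto
    then show "{?vs ! i, ?vs ! j} \<in> {e. e \<subseteq> universe A \<and> card e = 2}" using ijl by auto
  qed (use A in auto)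
  moreover have "comes_after p (?vs ! j) (?vs ! i)" if "i < j" "j < length ?vs" for i j
    using comes_after_iff[OF A(2), of i j] that by simp
  ultimately show ?thesis
    using hyperedges_sub[OF A(1)] by (auto simp: is_graph_def is_clique_def intro!: exI[of _ ?vs])
qed

text \<open>Turns \<open>Min\<close>, \<open>Max\<close> and \<open>LEAST\<close> into a scheme and
  actual covers. Finiteness comes from the finite universe, and the minimal number of hyperedges
  exists because all of them together cover every clique as far as it can be covered.\<close>

lemma coverwidth_scheme:
  assumes q: "is_quant_structure \<sigma> (p, A)" and cw: "coverwidth \<sigma> (p, A) \<le> k"
  obtains F where "is_scheme \<sigma> (p, A) F"
    "\<And>C. is_clique (universe A) F C \<Longrightarrow> \<exists>E \<subseteq> hyperedges \<sigma> A. card E \<le> k \<and> C \<inter> \<Union>(hyperedges \<sigma> A) \<subseteq> \<Union>E"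
proof -
  have A: "is_structure \<sigma> A" and fin: "finite (universe A)" using q by (auto simp: is_structure_def)
  let ?H = "hyperedges \<sigma> A"
  let ?S = "{scheme_weight \<sigma> (p, A) F | F. is_scheme \<sigma> (p, A) F}"
  have "?S \<subseteq> scheme_weight \<sigma> (p, A) ` Pow (Pow (universe A))"
    by (auto simp: is_graph_def)
  then have "finite ?S" by (rule finite_subset) (use fin in auto)
  moreover have "?S \<noteq> {}" using complete_scheme[OF q] by blast
  ultimately have "coverwidth \<sigma> (p, A) \<in> ?S" unfolding coverwidth_def by (rule Min_in)
  then obtain F where F: "is_scheme \<sigma> (p, A) F" "scheme_weight \<sigma> (p, A) F \<le> k"
    using cw by (smt (verit) mem_Collect_eq)
  have "\<exists>E \<subseteq> ?H. card E \<le> k \<and> C \<inter> \<Union>?H \<subseteq> \<Union>E" if C: "is_clique (universe A) F C" for C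
  proof -
    have "{weight ?H X | X. is_clique (universe A) F X} \<subseteq> weight ?H ` Pow (universe A)"
      by (auto simp: is_clique_def)
    then have "finite {weight ?H X | X. is_clique (universe A) F X}" by (rule finite_subset) (use fin in auto)
    then have "weight ?H C \<le> scheme_weight \<sigma> (p, A) F"
      unfolding scheme_weight.simps by (rule Max_ge) (use C in blast)
    then have k: "weight ?H C \<le> k" using F(2) by simp
    have "\<exists>m U. is_union ?H m U \<and> C \<inter> \<Union>?H \<subseteq> U"
      by (intro exI[of _ "card ?H"] exI[of _ "\<Union>?H"]) (use finite_hyperedges[OF A] in \<open>auto simp: is_union_def\<close>)
    then have "\<exists>U. is_union ?H (weight ?H C) U \<and> C \<inter> \<Union>?H \<subseteq> U"
      unfolding weight_def by (rule LeastI_ex)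
    then obtain E where "E \<subseteq> ?H" "card E = weight ?H C" "C \<inter> \<Union>?H \<subseteq> \<Union>E"
      unfolding is_union_def by (elim exE conjE) simp
    with k show ?thesis by (intro exI[of _ E]) simp
  qed
  with F(1) show thesis by (rule that)
qed

context qcsp_word
begin

lemma hyperedges_TA: "hyperedges \<sigma> A = (\<lambda>x. set (tup x)) ` TA"
proof
  show "hyperedges \<sigma> A \<subseteq> (\<lambda>x. set (tup x)) ` TA"
    using tup_surj[of 3] by (fastforce simp: hyperedges_def TA_iff tupA_def)
  show "(\<lambda>x. set (tup x)) ` TA \<subseteq> hyperedges \<sigma> A"
    using TA_props by (fastforce simp: hyperedges_def)
qed

text \<open>A cover by fewer than \<open>k\<close> hyperedges is filled up with copies of an
  arbitrary tuple; \<open>TA\<close> must be nonempty to provide one.\<close>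

lemma union_scope:
  assumes "E \<subseteq> hyperedges \<sigma> A" "card E \<le> k" "TA \<noteq> {}"
  shows "\<exists>xs. scope xs \<and> \<Union>E \<subseteq> cov xs"
proof -
  have "finite E" using assms(1) finite_hyperedges A'(1) finite_subset by blast
  then obtain es where es: "set es = E" "length es = card E" using finite_distinct_list distinct_card by metis
  have "\<forall>e\<in>E. \<exists>x\<in>TA. e = set (tup x)" using assms(1) hyperedges_TA by auto
  then obtain g where g: "\<And>e. e \<in> E \<Longrightarrow> g e \<in> TA \<and> e = set (tup (g e))" by metis
  obtain x0 where "x0 \<in> TA" using assms(3) by blast
  define xs where "xs = map g es @ replicate (k - length es) x0"
  have "scope xs" unfolding scope_def xs_def using es g assms(2) \<open>x0 \<in> TA\<close> by auto
  moreover have "\<Union>E \<subseteq> cov xs" unfolding cov_def xs_def using es g by fastforce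
  ultimately show ?thesis by blast
qed

text \<open>The bound on coverwidth enters in the direction from the game to the sentence, where a
  scheme and the covers of its cliques meet the assumptions of
  \<open>not_bad_imp_sat\<close>.\<close>

lemma decides:
  assumes "coverwidth \<sigma> (p, A) \<le> k" "computed w 12 ar0"
  shows "ev w (sem w 0 (\<lambda>_. 0) (fix_stage 12 (2 * k) (bad_fm k)) ar0) 0 (\<lambda>_. 0) (accept_fm k) \<longleftrightarrow> quant_hom \<sigma> (p, A) B"
proof -
  have hom: "quant_hom \<sigma> (p, A) B \<longleftrightarrow> sat (universe B) p sol (\<lambda>_. undefined)"
    unfolding quant_hom.simps sol_iff ..
  show ?thesis
  proof (cases "universe B \<noteq> {} \<or> p = []")
    case True
    obtain F where F: "is_scheme \<sigma> (p, A) F"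
      "\<And>C. is_clique (universe A) F C \<Longrightarrow> \<exists>E \<subseteq> hyperedges \<sigma> A. card E \<le> k \<and> C \<inter> \<Union>(hyperedges \<sigma> A) \<subseteq> \<Union>E"
      using coverwidth_scheme[OF A assms(1)] by blast
    then obtain vs where vs: "perfect_elimination_ordering (universe A) F vs"
      "\<forall>i j. i < j \<and> j < length vs \<longrightarrow> comes_after p (vs ! j) (vs ! i)"
      "\<forall>e\<in>hyperedges \<sigma> A. is_clique (universe A) F e" by auto
    have set_vs: "set vs = universe A" using vs(1) by (simp add: perfect_elimination_ordering_def)
    have "(\<forall>xs. scope xs \<longrightarrow> (\<exists>ys. cand xs ys \<and> \<not> bad xs ys)) \<longleftrightarrow> sat (universe B) p sol (\<lambda>_. undefined)"
    proof
      assume good: "\<forall>xs. scope xs \<longrightarrow> (\<exists>ys. cand xs ys \<and> \<not> bad xs ys)"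
      show "sat (universe B) p sol (\<lambda>_. undefined)"
      proof (rule not_bad_imp_sat[where vs = vs and F = F])
        show "distinct vs" using vs(1) by (simp add: perfect_elimination_ordering_def)
        show "set vs = snd ` set p" using set_vs A'(3) by simp
        show "{vs ! i, vs ! j} \<in> F" if "i < j" "j < l" "l < length vs" "{vs ! i, vs ! l} \<in> F" "{vs ! j, vs ! l} \<in> F" for i j l
          using vs(1) that unfolding perfect_elimination_ordering_def by blast
        show "comes_after p (vs ! j) (vs ! i)" if "i < j" "j < length vs" for i j
          using vs(2) that by blast
        show "is_clique (set vs) F (set (tup x))" if "x \<in> TA" for x
          using vs(3) that hyperedges_TA set_vs by auto
        show "\<exists>ys. cand xs ys \<and> \<not> bad xs ys" if "scope xs" for xs using good that by blast
        show "universe B \<noteq> {} \<or> p = []" by (rule True)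
        show "\<exists>xs. scope xs \<and> C \<inter> (\<Union>x\<in>TA. set (tup x)) \<subseteq> cov xs" if C: "is_clique (set vs) F C" "TA \<noteq> {}" for C
        proof -
          obtain E where E: "E \<subseteq> hyperedges \<sigma> A" "card E \<le> k" "C \<inter> \<Union>(hyperedges \<sigma> A) \<subseteq> \<Union>E"
            using F(2)[of C] C(1) set_vs by auto
          obtain xs where "scope xs" "\<Union>E \<subseteq> cov xs" using union_scope[OF E(1,2) C(2)] by blast
          then show ?thesis using E(3) hyperedges_TA by (intro exI[of _ xs]) auto
        qed
      qed
    next
      assume "sat (universe B) p sol (\<lambda>_. undefined)"
      then show "\<forall>xs. scope xs \<longrightarrow> (\<exists>ys. cand xs ys \<and> \<not> bad xs ys)" using sat_imp_not_bad True by blast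
    qed
    then show ?thesis unfolding ev_accept[OF assms(2)] hom using True by simp
  next
    case False
    then obtain q v p' where p: "p = (q, v) # p'" by (cases p) auto
    show ?thesis unfolding ev_accept[OF assms(2)] hom using False p by (cases q) auto
  qed
qed

end

theorem theorem10:
  fixes k :: nat
  assumes "k \<ge> 1"
  shows "polytime_decidable instance_encodings (QCSP_coverwidth k)"
  unfolding QCSP_coverwidth_def
proof (rule prog_polytime_decidable[where p = "Then prepare (fix_stage 12 (2 * k) (bad_fm k))" and \<phi> = "accept_fm k"])
  fix x w
  assume x: "x \<in> fst QCSP \<inter> {(\<sigma>, q, B). coverwidth \<sigma> q \<le> k}" and w: "w \<in> instance_encodings x"
  obtain \<sigma> p A B where xe: "x = (\<sigma>, (p, A), B)" by (metis prod.collapse)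
  from x have q: "is_quant_structure \<sigma> (p, A)" "is_structure \<sigma> B" "coverwidth \<sigma> (p, A) \<le> k"
    by (auto simp: xe QCSP_def)
  from w obtain s a b where sab: "w = s @ enc_list (enc_pair enc_quantifier enc_nat) p @ a @ b"
    "s \<in> signature_encodings \<sigma>" "a \<in> structure_encodings \<sigma> A" "b \<in> structure_encodings \<sigma> B"
    by (auto simp: xe)
  from sab(2) obtain ss where ss: "s = enc_list (enc_pair enc_nat enc_nat) ss" by (auto simp: signature_encodings_def)
  from sab(3) obtain us rs where a: "a = enc_list enc_nat us @ enc_list enc_rel rs"
    "set (map fst rs) = dom \<sigma>" "\<forall>(R, ts)\<in>set rs. set ts = interp A R"
    unfolding structure_encodings_def by fast
  from sab(4) obtain us' rs' where b: "b = enc_list enc_nat us' @ enc_list enc_rel rs'" "set us' = universe B"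
    "set (map fst rs') = dom \<sigma>" "\<forall>(R, ts)\<in>set rs'. set ts = interp B R"
    unfolding structure_encodings_def by fast
  interpret qcsp_word w ss p us rs us' rs' k \<sigma> A B
    by unfold_locales (use assms q a b sab(1) ss in auto)
  have "ev w (sem w 0 (\<lambda>_. 0) (Then prepare (fix_stage 12 (2 * k) (bad_fm k))) (\<lambda>_ _. False)) 0 (\<lambda>_. 0) (accept_fm k)
    \<longleftrightarrow> quant_hom \<sigma> (p, A) B"
    using decides[OF q(3) computed_prepare] by simp
  then show "ev w (sem w 0 (\<lambda>_. 0) (Then prepare (fix_stage 12 (2 * k) (bad_fm k))) (\<lambda>_ _. False)) 0 (\<lambda>_. 0) (accept_fm k)
    \<longleftrightarrow> x \<in> snd QCSP"
    by (simp add: xe QCSP_def)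
qed

end
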